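(* Let $p\ge2$. Assume that there is a constant $C_f$ such that, $\mathbb{P}$-a.s., for all $t\in[0,T]$, $y,y'\in\mathbb{R}^m$, $z,z',\tilde z,\tilde z'\in\mathbb{R}^{m\times d}$ and $\mu,\nu\in\mathcal{P}_2(\mathbb{R}^m)$, $$|f(t,y,z,\tilde z,\mu)-f(t,y',z',\tilde z',\nu)|\le C_f\big(|y-y'|+|z-z'|+|\tilde z-\tilde z'|+W_2(\mu,\nu)\big),$$ that $\mathbb{E}[\int_0^T|f(s,0,0,0,\delta_0)|^2ds]<\infty$ and that $\xi$ is $\mathcal{F}_T$-measurable with $\mathbb{E}[|\xi|^2]<\infty$. Assume furthermore that $\mathbb{E}[|\xi|^p]<\infty$ and $$\mathbb{E}\Big[\int_0^T|f(s,0,0,0,\delta_0)|^p\,ds\Big]<+\infty.$$ Let $(Y,Z,Z^0)\in\mathcal{S}^2\times\mathcal{H}^2\times\mathcal{H}^2$ be the unique solution of $$Y_t=\xi+\int_t^T f(s,Y_s,Z_s,Z^0_s,\mathcal{L}^1(Y_s))\,ds-\int_t^T Z_s\,dW_s-\int_t^T Z^0_s\,dW^0_s,\qquad t\in[0,T].$$ Then $Y\in\mathcal{S}^p$, that is, $\mathbb{E}\big[\sup_{t\le T}|Y_t|^p\big]<+\infty$.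
   Context: Fix a finite horizon $T>0$ and integers $m,d\ge1$; $|\cdot|$ denotes Euclidean norms. Let $(\Omega^0,\mathcal{F}^0,\mathbb{P}^0)$ and $(\Omega^1,\mathcal{F}^1,\mathbb{P}^1)$ be complete probability spaces carrying $d$-dimensional Brownian motions $W^0$ (the common noise) and $W$ respectively, with $\mathbb{F}^0=(\mathcal{F}^0_t)$ and $\mathbb{F}^1=(\mathcal{F}^1_t)$ the right-continuous complete augmentations of the filtrations generated by $W^0$ and $W$. Let $\Omega=\Omega^0\times\Omega^1$, let $(\mathcal{F},\mathbb{P})$ be the completion of $(\mathcal{F}^0\otimes\mathcal{F}^1,\mathbb{P}^0\otimes\mathbb{P}^1)$, and let $\mathbb{F}=(\mathcal{F}_t)$ be the right-continuous complete augmentation of $(\mathcal{F}^0_t\otimes\mathcal{F}^1_t)$. $W$ and $W^0$ are extended to $\Omega$ in the obvious way and are independent. For a random variable $X$ on $\Omega$, $\mathcal{L}^1(X)$ is the random measure $\omega^0\mapsto$ law of $X(\omega^0,\cdot)$ under $\mathbb{P}^1$; it is the conditional law of $X$ given the common noise $\mathcal{F}^0$. $\mathcal{P}_2(\mathbb{R}^m)$ is the set of probability measures on $\mathbb{R}^m$ with finite second moment and $W_2$ is the 2-Wasserstein distance. For $p\ge1$: $\mathcal{S}^p$ is the set of $\mathbb{R}^m$-valued $\mathbb{F}$-progressively measurable processes $y$ with $\mathbb{E}[\sup_{t\le T}|y_t|^p]<\infty$; $\mathcal{H}^p$ is the set of $\mathbb{R}^{m\times d}$-valued $\mathbb{F}$-progressively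 measurable processes $z$ with $\mathbb{E}[(\int_0^T|z_s|^2ds)^{p/2}]<\infty$. The driver $f:\Omega\times[0,T]\times\mathbb{R}^m\times\mathbb{R}^{m\times d}\times\mathbb{R}^{m\times d}\times\mathcal{P}_2(\mathbb{R}^m)\to\mathbb{R}^m$ is progressively measurable in $(\omega,t)$ (the argument $\omega$ is omitted). Under the Lipschitz and square-integrability hypotheses the equation has a unique solution in $\mathcal{S}^2\times\mathcal{H}^2\times\mathcal{H}^2$. *)

theory Defs
  imports "HOL-Probability.Probability"
begin

text \<open>
  As usual in the library, a sub-\<open>\<sigma>\<close>-algebra is represented by a measure of which only the space
  and the measurable sets matter. All processes live on the time interval \<open>[0,T]\<close>; filtrations are
  indexed by \<^typ>\<open>real\<close> and are constant after \<open>T\<close>, so that the right limit at \<open>T\<close> is the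
  \<open>\<sigma>\<close>-algebra at \<open>T\<close> itself.
\<close>

definition natural_filtration ::
  "'w measure \<Rightarrow> real \<Rightarrow> (real \<Rightarrow> 'w \<Rightarrow> 'e::topological_space) \<Rightarrow> real \<Rightarrow> 'w measure" where
  "natural_filtration M T X t =
     sigma (space M) {X u -` A \<inter> space M | u A. u \<in> {0..min t T} \<and> A \<in> sets borel}"

text \<open>Right-continuous complete augmentation, for \<open>M\<close> complete: the null sets of \<open>M\<close> are adjoined
  to every \<open>G s\<close> and right limits are taken.\<close>

definition augmentation :: "'w measure \<Rightarrow> (real \<Rightarrow> 'w measure) \<Rightarrow> real \<Rightarrow> 'w measure" where
  "augmentation M G t =
     sigma (space M) (\<Inter>s\<in>{t<..}. sigma_sets (space M) (sets (G s) \<union> null_sets M))"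

definition brownian_motion ::
  "'w measure \<Rightarrow> real \<Rightarrow> (real \<Rightarrow> 'w \<Rightarrow> real^'d::finite) \<Rightarrow> bool" where
  "brownian_motion M T W \<longleftrightarrow>
     (\<forall>t\<in>{0..T}. W t \<in> borel_measurable M) \<and>
     (AE \<omega> in M. W 0 \<omega> = 0) \<and>
     (AE \<omega> in M. continuous_on {0..T} (\<lambda>t. W t \<omega>)) \<and>
     (\<forall>s t. 0 \<le> s \<and> s < t \<and> t \<le> T \<longrightarrow>
        distributed M lborel (\<lambda>\<omega>. W t \<omega> - W s \<omega>)
          (\<lambda>x. ennreal (\<Prod>i\<in>UNIV. normal_density 0 (sqrt (t - s)) (x $ i)))) \<and>
     (\<forall>n (\<tau> :: nat \<Rightarrow> real). (\<forall>i\<le>n. \<tau> i \<in> {0..T}) \<and> (\<forall>i<n. \<tau> i < \<tau> (Suc i)) \<longrightarrow>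
        prob_space.indep_vars M (\<lambda>_. borel) (\<lambda>i \<omega>. W (\<tau> (Suc i)) \<omega> - W (\<tau> i) \<omega>) {..<n})"

definition progressive ::
  "(real \<Rightarrow> 'w measure) \<Rightarrow> real \<Rightarrow> (real \<Rightarrow> 'w \<Rightarrow> 'e::topological_space) \<Rightarrow> bool" where
  "progressive F T X \<longleftrightarrow>
     (\<forall>t\<in>{0..T}. (\<lambda>(s, \<omega>). X s \<omega>) \<in> borel_measurable (restrict_space borel {0..t} \<Otimes>\<^sub>M F t))"

definition S_space ::
  "'w measure \<Rightarrow> (real \<Rightarrow> 'w measure) \<Rightarrow> real \<Rightarrow> real \<Rightarrow> (real \<Rightarrow> 'w \<Rightarrow> real^'m::finite) set" where
  "S_space M F T p =
     {y. progressive F T y \<and>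
         (\<integral>\<^sup>+\<omega>. (SUP t\<in>{0..T}. ennreal (norm (y t \<omega>) powr p)) \<partial>M) < \<infinity>}"

text \<open>The norm of \<^typ>\<open>real^'d^'m\<close> is the Euclidean (Frobenius) norm of matrices with \<open>m\<close> rows and
  \<open>d\<close> columns.\<close>

definition H2_space ::
  "'w measure \<Rightarrow> (real \<Rightarrow> 'w measure) \<Rightarrow> real \<Rightarrow> (real \<Rightarrow> 'w \<Rightarrow> real^'d::finite^'m::finite) set" where
  "H2_space M F T =
     {z. progressive F T z \<and>
         (\<integral>\<^sup>+\<omega>. (\<integral>\<^sup>+s\<in>{0..T}. ennreal ((norm (z s \<omega>))\<^sup>2) \<partial>lborel) \<partial>M) < \<infinity>}"

text \<open>\<open>simple_integrand F T n \<tau> h\<close>: the data of the simple process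
  \<open>\<Sum>i<n. h\<^sub>i 1\<^bsub>(\<tau>\<^sub>i, \<tau>\<^sub>i\<^sub>+\<^sub>1]\<^esub>\<close> with \<open>h\<^sub>i\<close> bounded and measurable at time \<open>\<tau>\<^sub>i\<close>.\<close>

definition simple_integrand ::
  "(real \<Rightarrow> 'w measure) \<Rightarrow> real \<Rightarrow> nat \<Rightarrow> (nat \<Rightarrow> real) \<Rightarrow> (nat \<Rightarrow> 'w \<Rightarrow> real^'d::finite^'m::finite)
     \<Rightarrow> bool" where
  "simple_integrand F T n \<tau> h \<longleftrightarrow>
     (\<forall>i\<le>n. \<tau> i \<in> {0..T}) \<and> (\<forall>i<n. \<tau> i < \<tau> (Suc i)) \<and>
     (\<forall>i<n. h i \<in> borel_measurable (F (\<tau> i)) \<and> (\<exists>C. \<forall>\<omega>\<in>space (F (\<tau> i)). norm (h i \<omega>) \<le> C))"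

definition simple_process ::
  "nat \<Rightarrow> (nat \<Rightarrow> real) \<Rightarrow> (nat \<Rightarrow> 'w \<Rightarrow> real^'d::finite^'m::finite) \<Rightarrow> real \<Rightarrow> 'w \<Rightarrow> real^'d^'m" where
  "simple_process n \<tau> h s \<omega> = (\<Sum>i<n. if \<tau> i < s \<and> s \<le> \<tau> (Suc i) then h i \<omega> else 0)"

definition simple_integral ::
  "(real \<Rightarrow> 'w \<Rightarrow> real^'d::finite) \<Rightarrow> nat \<Rightarrow> (nat \<Rightarrow> real) \<Rightarrow> (nat \<Rightarrow> 'w \<Rightarrow> real^'d^'m::finite)
     \<Rightarrow> real \<Rightarrow> 'w \<Rightarrow> real^'m" where
  "simple_integral W n \<tau> h t \<omega> =
     (\<Sum>i<n. h i \<omega> *v (W (min (\<tau> (Suc i)) t) \<omega> - W (min (\<tau> i) t) \<omega>))"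

text \<open>\<open>J\<close> is (a version of) the Ito integral process \<open>t \<mapsto> \<integral>\<^sub>0\<^sup>t z\<^sub>s dW\<^sub>s\<close>, \<open>t \<in> [0,T]\<close>, of a square
  integrable \<open>z\<close>: the a.s. continuous adapted \<open>L\<^sup>2\<close>-limit of the elementary integrals along simple
  processes converging to \<open>z\<close> in \<open>L\<^sup>2(dt \<otimes> dP)\<close>. Such a \<open>J\<close> is unique up to indistinguishability.\<close>

definition has_ito_integral ::
  "'w measure \<Rightarrow> (real \<Rightarrow> 'w measure) \<Rightarrow> real \<Rightarrow> (real \<Rightarrow> 'w \<Rightarrow> real^'d::finite)
     \<Rightarrow> (real \<Rightarrow> 'w \<Rightarrow> real^'d^'m::finite) \<Rightarrow> (real \<Rightarrow> 'w \<Rightarrow> real^'m) \<Rightarrow> bool" where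
  "has_ito_integral M F T W z J \<longleftrightarrow>
     (\<forall>t\<in>{0..T}. J t \<in> borel_measurable (F t)) \<and>
     (AE \<omega> in M. continuous_on {0..T} (\<lambda>t. J t \<omega>)) \<and>
     (\<exists>n \<tau> h. (\<forall>k. simple_integrand F T (n k) (\<tau> k) (h k)) \<and>
        ((\<lambda>k. \<integral>\<^sup>+\<omega>. (\<integral>\<^sup>+s\<in>{0..T}.
            ennreal ((norm (simple_process (n k) (\<tau> k) (h k) s \<omega> - z s \<omega>))\<^sup>2) \<partial>lborel) \<partial>M)
          \<longlonglongrightarrow> 0) \<and>
        (\<forall>t\<in>{0..T}.
          (\<lambda>k. \<integral>\<^sup>+\<omega>. ennreal ((norm (simple_integral W (n k) (\<tau> k) (h k) t \<omega> - J t \<omega>))\<^sup>2) \<partial>M)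
          \<longlonglongrightarrow> 0))"

definition P2 :: "(real^'m::finite) measure set" where
  "P2 = {\<mu>. prob_space \<mu> \<and> sets \<mu> = sets borel \<and> (\<integral>\<^sup>+x. ennreal ((norm x)\<^sup>2) \<partial>\<mu>) < \<infinity>}"

definition couplings ::
  "(real^'m::finite) measure \<Rightarrow> (real^'m) measure \<Rightarrow> ((real^'m) \<times> (real^'m)) measure set" where
  "couplings \<mu> \<nu> =
     {\<pi>. prob_space \<pi> \<and> sets \<pi> = sets (borel \<Otimes>\<^sub>M borel) \<and>
         distr \<pi> borel fst = \<mu> \<and> distr \<pi> borel snd = \<nu>}"

text \<open>The infimum is finite for \<open>\<mu>, \<nu> \<in> P2\<close>, the only arguments at which \<open>W2\<close> is used.\<close>

definition W2 :: "(real^'m::finite) measure \<Rightarrow> (real^'m) measure \<Rightarrow> real" where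
  "W2 \<mu> \<nu> =
     sqrt (enn2real (INF \<pi>\<in>couplings \<mu> \<nu>. \<integral>\<^sup>+(x, y). ennreal ((norm (x - y))\<^sup>2) \<partial>\<pi>))"

text \<open>The random measure \<open>\<omega>\<^sup>0 \<mapsto> law of X(\<omega>\<^sup>0, \<cdot>)\<close> under \<open>M1\<close>. For the processes considered, it belongs
  to \<open>P2\<close> off a null set of \<open>\<omega>\<^sup>0\<close>.\<close>

definition cond_law :: "'b measure \<Rightarrow> ('a \<times> 'b \<Rightarrow> real^'m::finite) \<Rightarrow> 'a \<Rightarrow> (real^'m) measure" where
  "cond_law M1 X \<omega>0 = distr M1 borel (\<lambda>\<omega>1. X (\<omega>0, \<omega>1))"

definition common_noise_space :: "'a measure \<Rightarrow> 'b measure \<Rightarrow> ('a \<times> 'b) measure" where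
  "common_noise_space M0 M1 = completion (M0 \<Otimes>\<^sub>M M1)"

definition common_noise_filtration ::
  "'a measure \<Rightarrow> 'b measure \<Rightarrow> real \<Rightarrow> (real \<Rightarrow> 'a \<Rightarrow> real^'d::finite) \<Rightarrow> (real \<Rightarrow> 'b \<Rightarrow> real^'d)
     \<Rightarrow> real \<Rightarrow> ('a \<times> 'b) measure" where
  "common_noise_filtration M0 M1 T W0 W =
     augmentation (common_noise_space M0 M1)
       (\<lambda>t. augmentation M0 (natural_filtration M0 T W0) t \<Otimes>\<^sub>M
            augmentation M1 (natural_filtration M1 T W) t)"

text \<open>The integrals over \<open>[t,T]\<close> with respect to \<open>W\<close> and \<open>W0\<close> are the increments \<open>J T - J t\<close> and
  \<open>J0 T - J0 t\<close> of the integral processes; the equation holds almost surely for all times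
  simultaneously.\<close>

definition mkv_bsde_solution ::
  "'a measure \<Rightarrow> 'b measure \<Rightarrow> real
     \<Rightarrow> (real \<Rightarrow> 'a \<Rightarrow> real^'d::finite) \<Rightarrow> (real \<Rightarrow> 'b \<Rightarrow> real^'d)
     \<Rightarrow> ('a \<times> 'b \<Rightarrow> real \<Rightarrow> real^'m::finite \<Rightarrow> real^'d^'m \<Rightarrow> real^'d^'m \<Rightarrow> (real^'m) measure \<Rightarrow> real^'m)
     \<Rightarrow> ('a \<times> 'b \<Rightarrow> real^'m)
     \<Rightarrow> (real \<Rightarrow> 'a \<times> 'b \<Rightarrow> real^'m)
     \<Rightarrow> (real \<Rightarrow> 'a \<times> 'b \<Rightarrow> real^'d^'m) \<Rightarrow> (real \<Rightarrow> 'a \<times> 'b \<Rightarrow> real^'d^'m) \<Rightarrow> bool" where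
  "mkv_bsde_solution M0 M1 T W0 W f \<xi> Y Z Z0 \<longleftrightarrow>
     (let M = common_noise_space M0 M1;
          F = common_noise_filtration M0 M1 T W0 W;
          g = (\<lambda>\<omega> s. f \<omega> s (Y s \<omega>) (Z s \<omega>) (Z0 s \<omega>) (cond_law M1 (Y s) (fst \<omega>)))
      in Y \<in> S_space M F T 2 \<and> Z \<in> H2_space M F T \<and> Z0 \<in> H2_space M F T \<and>
         (AE \<omega> in M. set_integrable lborel {0..T} (g \<omega>)) \<and>
         (\<exists>J J0. has_ito_integral M F T (\<lambda>t \<omega>. W t (snd \<omega>)) Z J \<and>
            has_ito_integral M F T (\<lambda>t \<omega>. W0 t (fst \<omega>)) Z0 J0 \<and>
            (AE \<omega> in M. \<forall>t\<in>{0..T}.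
               Y t \<omega> = \<xi> \<omega> + (LINT s:{t..T}|lborel. g \<omega> s)
                 - (J T \<omega> - J t \<omega>) - (J0 T \<omega> - J0 t \<omega>))))"

end

theory Submission
  imports Defs
begin

text \<open>
  Put \<open>A\<^sub>t = |Y\<^sub>t|\<^sup>2\<close> and \<open>q = p/2\<close>. For \<open>p = 2\<close> the claim is part of the notion of a solution, so let
  \<open>q > 1\<close>. The proof first derives a linear inequality between \<open>A\<^sub>t\<close> and the future of \<open>A\<close>, valid under
  every weight that is known at time \<open>t\<close>, and then improves integrability by choosing the weights.

  The coordinates of the two Brownian motions form one family of scalar noises. Given the past, their
  increments over \<open>(s,u]\<close> are centred with covariance \<open>u - s\<close> times the identity (\<open>coord_increment\<close>).
  Hence the energy identity holds for elementary integrals under any bounded weight \<open>V \<ge> 0\<close> known at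
  time \<open>t\<close> (\<open>simple_integral_energy\<close>), and in the limit, since \<open>Y\<^sub>t\<close> plus the stochastic integrals over
  \<open>[t,b]\<close> is \<open>Y\<^sub>b\<close> plus the integral of the driver,
  \<open>E[V (A\<^sub>t + \<integral>\<^sub>t\<^sup>b |Z\<^sub>s|\<^sup>2 + |Z\<^sup>0\<^sub>s|\<^sup>2 ds)] \<le> 4 E[V |Y\<^sub>b + \<integral>\<^sub>t\<^sup>b f ds|\<^sup>2]\<close> (\<open>ito_energy\<close>).
  By the Lipschitz condition \<open>|f|\<^sup>2\<close> is at most a constant times
  \<open>|f(s,0,0,0,\<delta>\<^sub>0)|\<^sup>2 + A\<^sub>s + m\<^sub>s + |Z\<^sub>s|\<^sup>2 + |Z\<^sup>0\<^sub>s|\<^sup>2\<close>, where \<open>m\<^sub>s\<close> is the second moment of the conditional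
  law of \<open>Y\<^sub>s\<close>. On a short interval the Cauchy--Schwarz inequality supplies a small factor and the terms
  in \<open>Z\<close> and \<open>Z\<^sup>0\<close> are absorbed on the left; chaining finitely many short intervals gives
  \<open>E[V A\<^sub>t] \<le> K E[V (|\<xi>|\<^sup>2 + \<integral>\<^sub>t\<^sup>T |f(s,0,0,0,\<delta>\<^sub>0)|\<^sup>2 + A\<^sub>s + m\<^sub>s ds)]\<close> for all \<open>t\<close> and all \<open>V \<ge> 0\<close> known at
  time \<open>t\<close> (\<open>weighted_estimate\<close>).

  This inequality improves itself. With \<open>V = min(A\<^sub>t, N)\<^sup>q\<^sup>-\<^sup>1\<close>, Young's inequality and Gronwall's lemma
  bound \<open>E[A\<^sub>t min(A\<^sub>t, N)\<^sup>q\<^sup>-\<^sup>1]\<close> uniformly in \<open>t\<close> and \<open>N\<close>; the truncation makes this quantity finite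
  beforehand, because \<open>A\<^sub>t\<close> is integrable (\<open>moment_bound\<close>). With \<open>V\<close> the \<open>k\<close>-th increment of the
  \<open>(q-1)\<close>-st power of the running maximum along a time grid, it becomes a maximal inequality of
  Doob's type (\<open>running_max_bound\<close>), and continuity of the paths turns grid maxima into the
  supremum (\<open>sup_bound\<close>). The term \<open>m\<^sub>s\<close> costs as much as \<open>A\<^sub>s\<close>: it averages \<open>A\<^sub>s\<close> over an independent copy
  of the idiosyncratic noise, and Young's inequality is applied before averaging
  (\<open>decoupling_inequality\<close>).
\<close>

section \<open>Moments of Gaussian increments\<close>

text \<open>
  Lebesgue measure on \<^typ>\<open>real^'d\<close> is the image of a product of one-dimensional Lebesgue measures under
  the expansion in the standard basis, so Fubini's theorem applies coordinate by coordinate.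
\<close>

lemma lborel_vec_integral_prod:
  fixes g :: "'d::finite \<Rightarrow> real \<Rightarrow> real"
  assumes g: "\<And>i. integrable lborel (g i)"
  shows "integrable (lborel :: (real^'d) measure) (\<lambda>x. \<Prod>i\<in>UNIV. g i (x $ i))"
    and "(\<integral>x. (\<Prod>i\<in>UNIV. g i (x $ i)) \<partial>(lborel :: (real^'d) measure)) = (\<Prod>i\<in>UNIV. \<integral>x. g i x \<partial>lborel)"
proof -
  interpret product_sigma_finite "\<lambda>_::real^'d. lborel :: real measure" by standard
  define e :: "'d \<Rightarrow> real^'d" where "e = (\<lambda>i. axis i 1)"
  have inj: "inj e" by (auto simp: e_def inj_on_def axis_eq_axis)
  have Basis: "(Basis :: (real^'d) set) = range e" by (auto simp: Basis_vec_def e_def)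
  have e_nth: "e k $ i = (if k = i then 1 else 0)" for k i by (simp add: e_def axis_def)
  define G where "G = (\<lambda>b. g (inv e b))"
  have G: "integrable lborel (G b)" for b by (simp add: G_def g)
  have comp: "(\<Sum>b\<in>Basis. f b *\<^sub>R b) $ i = f (e i)" for f :: "real^'d \<Rightarrow> real" and i
    unfolding Basis by (simp add: sum.reindex[OF inj] e_nth if_distrib cong: if_cong)
  have P: "(\<Prod>i\<in>UNIV. g i ((\<Sum>b\<in>Basis. f b *\<^sub>R b) $ i)) = (\<Prod>b\<in>Basis. G b (f b))" for f
    unfolding comp unfolding Basis by (simp add: prod.reindex[OF inj] G_def inv_f_f[OF inj])
  have [measurable]: "g i \<in> borel_measurable borel" for i
    using borel_measurable_integrable[OF g[of i]] by simp
  have meas: "(\<lambda>f. \<Sum>b\<in>Basis. f b *\<^sub>R b) \<in> (\<Pi>\<^sub>M b\<in>(Basis::(real^'d) set). lborel) \<rightarrow>\<^sub>M borel" by measurable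
  show "integrable (lborel :: (real^'d) measure) (\<lambda>x. \<Prod>i\<in>UNIV. g i (x $ i))"
    unfolding lborel_eq[where 'a="real^'d"]
    by (subst integrable_distr_eq[OF meas], measurable) (simp only: P product_integrable_prod[OF _ G] finite_Basis)
  have "(\<integral>x. (\<Prod>i\<in>UNIV. g i (x $ i)) \<partial>(lborel :: (real^'d) measure)) = (\<Prod>b\<in>Basis. \<integral>x. G b x \<partial>lborel)"
    unfolding lborel_eq[where 'a="real^'d"]
    by (subst integral_distr[OF meas], measurable) (simp only: P product_integral_prod[OF _ G] finite_Basis)
  also have "\<dots> = (\<Prod>i\<in>UNIV. \<integral>x. g i x \<partial>lborel)"
    unfolding Basis by (simp add: prod.reindex[OF inj] G_def inv_f_f[OF inj])
  finally show "(\<integral>x. (\<Prod>i\<in>UNIV. g i (x $ i)) \<partial>(lborel :: (real^'d) measure)) = (\<Prod>i\<in>UNIV. \<integral>x. g i x \<partial>lborel)" .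
qed

text \<open>
  The product density times a monomial in the coordinates is again a product of functions of one
  variable, which leaves the moments of the one-dimensional normal density.
\<close>

lemma gaussian_moments:
  fixes \<sigma> :: real and i j :: "'d::finite"
  assumes \<sigma>: "0 < \<sigma>"
  defines "\<mu> \<equiv> density lborel (\<lambda>x::real^'d. ennreal (\<Prod>i\<in>UNIV. normal_density 0 \<sigma> (x $ i)))"
  shows "integrable \<mu> (\<lambda>x. x $ i)" "(\<integral>x. x $ i \<partial>\<mu>) = 0"
    "integrable \<mu> (\<lambda>x. x $ i * x $ j)" "(\<integral>x. x $ i * x $ j \<partial>\<mu>) = (if i = j then \<sigma>\<^sup>2 else 0)"
proof -
  define D where "D = normal_density 0 \<sigma>"
  have D0: "integrable lborel D" "(\<integral>x. D x \<partial>lborel) = 1"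
    using \<sigma> by (auto simp: D_def)
  have D1: "integrable lborel (\<lambda>x. D x * x)" "(\<integral>x. D x * x \<partial>lborel) = 0"
    using \<sigma> integrable_normal_moment_nz_1[of \<sigma> 0] integral_normal_moment_nz_1[of \<sigma> 0] by (auto simp: D_def)
  have D2: "integrable lborel (\<lambda>x. D x * x * x)" "(\<integral>x. D x * x * x \<partial>lborel) = \<sigma>\<^sup>2"
    using \<sigma> integrable_normal_moment[of \<sigma> 0 2] integral_normal_moment_even[of \<sigma> 0 1]
    by (auto simp: D_def power2_eq_square mult.assoc fact_numeral)
  have Dp: "0 \<le> D x" for x using \<sigma> by (simp add: D_def)
  have Pp: "0 \<le> (\<Prod>i\<in>UNIV. D (x $ i))" for x :: "real^'d" by (simp add: prod_nonneg Dp)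
  have [measurable]: "(\<lambda>x::real^'d. \<Prod>i\<in>UNIV. D (x $ i)) \<in> borel_measurable borel" unfolding D_def by measurable
  have mu: "\<mu> = density lborel (\<lambda>x::real^'d. ennreal (\<Prod>i\<in>UNIV. D (x $ i)))" by (simp add: \<mu>_def D_def)
  define g1 where "g1 = (\<lambda>k x. D x * (if k = i then x else 1))"
  define g2 where "g2 = (\<lambda>k x. D x * (if k = i then x else 1) * (if k = j then x else 1))"
  have g1: "integrable lborel (g1 k)" for k using D0 D1 by (cases "k = i") (auto simp: g1_def)
  have g2: "integrable lborel (g2 k)" for k using D0 D1 D2 by (cases "k = i"; cases "k = j") (auto simp: g2_def)
  have d: "(\<Prod>k\<in>UNIV. if k = l then y k else 1) = y l" for l :: 'd and y :: "'d \<Rightarrow> real"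
    by (simp add: prod.delta)
  have e1: "(\<Prod>k\<in>UNIV. g1 k (x $ k)) = (\<Prod>k\<in>UNIV. D (x $ k)) * x $ i" for x
    by (simp add: g1_def prod.distrib d)
  have e2: "(\<Prod>k\<in>UNIV. g2 k (x $ k)) = (\<Prod>k\<in>UNIV. D (x $ k)) * (x $ i * x $ j)" for x
    by (simp add: g2_def prod.distrib d)
  show "integrable \<mu> (\<lambda>x. x $ i)" unfolding mu
    by (subst integrable_density) (use lborel_vec_integral_prod(1)[of g1, OF g1] in \<open>simp_all add: Pp e1\<close>)
  have "(\<integral>x. x $ i \<partial>\<mu>) = (\<Prod>k\<in>UNIV. \<integral>x. g1 k x \<partial>lborel)" unfolding mu
    by (subst integral_density) (use lborel_vec_integral_prod(2)[of g1, OF g1] in \<open>simp_all add: Pp e1\<close>)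
  also have "\<dots> = 0" using D1 prod_zero[of UNIV "\<lambda>k. \<integral>x. g1 k x \<partial>lborel"] by (auto simp: g1_def intro!: exI[of _ i])
  finally show "(\<integral>x. x $ i \<partial>\<mu>) = 0" .
  show "integrable \<mu> (\<lambda>x. x $ i * x $ j)" unfolding mu
    by (subst integrable_density) (use lborel_vec_integral_prod(1)[of g2, OF g2] in \<open>simp_all add: Pp e2\<close>)
  have *: "(\<integral>x. x $ i * x $ j \<partial>\<mu>) = (\<Prod>k\<in>UNIV. \<integral>x. g2 k x \<partial>lborel)" unfolding mu
    by (subst integral_density) (use lborel_vec_integral_prod(2)[of g2, OF g2] in \<open>simp_all add: Pp e2\<close>)
  show "(\<integral>x. x $ i * x $ j \<partial>\<mu>) = (if i = j then \<sigma>\<^sup>2 else 0)"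
  proof (cases "i = j")
    case True
    have "(\<integral>x. g2 k x \<partial>lborel) = (if k = i then \<sigma>\<^sup>2 else 1)" for k
      using D0 D2 True by (auto simp: g2_def)
    then show ?thesis unfolding * using True by (simp add: prod.delta)
  next
    case False
    then have "(\<integral>x. g2 i x \<partial>lborel) = 0" using D1 by (auto simp: g2_def)
    then show ?thesis unfolding * using False by (simp add: prod_zero_iff) blast
  qed
qed

section \<open>Independence of Brownian increments from the completed past\<close>

text \<open>
  The events that agree almost surely with a finite-dimensional cylinder of times up to \<open>r\<close> are stable
  under intersection. They include the null sets (the empty cylinder at time \<open>0\<close>), so the completed past
  is handled together with the natural filtration. As \<open>W 0 = 0\<close> almost surely, such an event is
  determined by finitely many increments before \<open>r\<close>, which are independent of the increment after \<open>r\<close>.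
\<close>

lemma brownian_increment_independent:
  fixes W :: "real \<Rightarrow> 'w \<Rightarrow> real^'d::finite"
  assumes M: "prob_space M" and bm: "brownian_motion M T W"
    and r: "0 \<le> r" and ru: "r < u" and u: "u \<le> T"
    and B: "B \<in> sigma_sets (space M) (sets (natural_filtration M T W r) \<union> null_sets M)"
    and C: "C \<in> sets borel"
  shows "measure M (B \<inter> {\<omega>\<in>space M. W u \<omega> - W r \<omega> \<in> C})
    = measure M B * measure M {\<omega>\<in>space M. W u \<omega> - W r \<omega> \<in> C}"
proof -
  interpret prob_space M by fact
  have W_meas: "W v \<in> borel_measurable M" if "v \<in> {0..T}" for v
    using bm that by (auto simp: brownian_motion_def)
  have [measurable]: "W u \<in> borel_measurable M" "W r \<in> borel_measurable M"
    using r ru u by (auto intro: W_meas)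
  have W_0: "AE \<omega> in M. W 0 \<omega> = 0" using bm by (auto simp: brownian_motion_def)
  define cyl where "cyl = (\<lambda>B D A. finite D \<and> D \<subseteq> {0..r} \<and> (\<forall>v\<in>D. A v \<in> sets borel) \<and>
    (AE \<omega> in M. \<omega> \<in> B \<longleftrightarrow> (\<forall>v\<in>D. W v \<omega> \<in> A v)))"
  define Cyl where "Cyl = {B \<in> sets M. \<exists>D A. cyl B D A}"
  define Inc where "Inc = {{\<omega>\<in>space M. W u \<omega> - W r \<omega> \<in> C} | C. C \<in> sets borel}"
  have Cyl: "Int_stable Cyl"
  proof (rule Int_stableI)
    fix a b assume "a \<in> Cyl" "b \<in> Cyl"
    then obtain D A D' A' where *: "a \<in> sets M" "b \<in> sets M" "cyl a D A" "cyl b D' A'"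
      by (auto simp: Cyl_def)
    define A'' where "A'' = (\<lambda>v. (if v \<in> D then A v else UNIV) \<inter> (if v \<in> D' then A' v else UNIV))"
    have "AE \<omega> in M. \<omega> \<in> a \<longleftrightarrow> (\<forall>v\<in>D. W v \<omega> \<in> A v)" "AE \<omega> in M. \<omega> \<in> b \<longleftrightarrow> (\<forall>v\<in>D'. W v \<omega> \<in> A' v)"
      using * by (auto simp: cyl_def)
    then have "AE \<omega> in M. \<omega> \<in> a \<inter> b \<longleftrightarrow> (\<forall>v\<in>D \<union> D'. W v \<omega> \<in> A'' v)"
      by eventually_elim (auto simp: A''_def)
    then have "cyl (a \<inter> b) (D \<union> D') A''" using * by (auto simp: cyl_def A''_def)
    then show "a \<inter> b \<in> Cyl" using * by (auto simp: Cyl_def)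
  qed
  have Inc: "Int_stable Inc"
  proof (rule Int_stableI)
    fix a b assume "a \<in> Inc" "b \<in> Inc"
    then obtain C C' where *: "C \<in> sets borel" "C' \<in> sets borel"
      "a = {\<omega>\<in>space M. W u \<omega> - W r \<omega> \<in> C}" "b = {\<omega>\<in>space M. W u \<omega> - W r \<omega> \<in> C'}" by (auto simp: Inc_def)
    then show "a \<inter> b \<in> Inc" unfolding Inc_def by (auto intro!: exI[of _ "C \<inter> C'"])
  qed
  have "indep_set Cyl Inc"
  proof (rule indep_setI)
    show "Cyl \<subseteq> events" "Inc \<subseteq> events" by (auto simp: Cyl_def Inc_def)
    fix a b assume "a \<in> Cyl" "b \<in> Inc"
    then obtain D A C where a: "a \<in> sets M" "cyl a D A" and C: "C \<in> sets borel"
      and b: "b = {\<omega>\<in>space M. W u \<omega> - W r \<omega> \<in> C}" by (auto simp: Cyl_def Inc_def)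
    have D: "finite D" "D \<subseteq> {0..r}" and A: "\<And>v. v \<in> D \<Longrightarrow> A v \<in> sets borel"
      and aeq: "AE \<omega> in M. \<omega> \<in> a \<longleftrightarrow> (\<forall>v\<in>D. W v \<omega> \<in> A v)" using a by (auto simp: cyl_def)
    \<comment> \<open>With the times \<open>0\<close> and \<open>r\<close> added, increment number \<open>k\<close> is the one from \<open>r\<close> to \<open>u\<close>, and the increments
        before it determine the cylinder.\<close>
    define D' where "D' = insert 0 (insert r D)"
    define xs where "xs = sorted_list_of_set D'"
    define k where "k = length xs - 1"
    have fin: "finite D'" using D by (simp add: D'_def)
    have set_xs: "set xs = D'" using fin by (simp add: xs_def)
    have len: "length xs = Suc k" using set_xs unfolding k_def D'_def by (cases xs) auto
    have sorted: "xs ! i < xs ! j" if "i < j" "j \<le> k" for i j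
      using that len strict_sorted_list_of_set[of D'] unfolding xs_def[symmetric]
      by (auto intro: sorted_wrt_nth_less)
    have in_D': "xs ! i \<in> D'" if "i \<le> k" for i using set_xs len that nth_mem[of i xs] by auto
    have D'_sub: "D' \<subseteq> {0..r}" using D r by (auto simp: D'_def)
    have first: "xs ! 0 = 0"
    proof -
      obtain j where j: "j \<le> k" "xs ! j = 0"
        using set_xs len by (metis D'_def in_set_conv_nth insertI1 less_Suc_eq_le)
      show ?thesis using sorted[of 0 j] in_D'[of 0] D'_sub j by (cases "j = 0") fastforce+
    qed
    have last: "xs ! k = r"
    proof -
      have "r \<in> set xs" by (simp add: set_xs D'_def)
      then obtain j where j: "j \<le> k" "xs ! j = r"
        using len by (metis in_set_conv_nth less_Suc_eq_le)
      show ?thesis using sorted[of j k] in_D'[of k] D'_sub j by (cases "j = k") fastforce+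
    qed
    define \<tau> where "\<tau> = (\<lambda>i. if i \<le> k then xs ! i else u)"
    have \<tau>_in: "\<tau> i \<in> {0..T}" if "i \<le> Suc k" for i
      using that in_D'[of i] D'_sub r ru u unfolding \<tau>_def by fastforce
    have \<tau>_less: "\<tau> i < \<tau> (Suc i)" if "i < Suc k" for i
      using that sorted[of i "Suc i"] last ru unfolding \<tau>_def by (cases "i = k") auto
    define X where "X = (\<lambda>i \<omega>. W (\<tau> (Suc i)) \<omega> - W (\<tau> i) \<omega>)"
    have ind: "indep_vars (\<lambda>_. borel) X {..<Suc k}"
      using bm \<tau>_in \<tau>_less unfolding brownian_motion_def X_def by blast
    have Xk: "X k = (\<lambda>\<omega>. W u \<omega> - W r \<omega>)" using last by (simp add: X_def \<tau>_def)
    have tele: "W (xs ! i) \<omega> = W 0 \<omega> + (\<Sum>j<i. X j \<omega>)" if "i \<le> k" for i \<omega>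
    proof -
      have "(\<Sum>j<i. X j \<omega>) = W (\<tau> i) \<omega> - W (\<tau> 0) \<omega>"
        unfolding X_def by (rule sum_lessThan_telescope)
      then show ?thesis using that first by (simp add: \<tau>_def)
    qed
    have "\<exists>i\<le>k. xs ! i = v" if "v \<in> D" for v
      using that set_xs len by (metis D'_def in_set_conv_nth insertI2 less_Suc_eq_le)
    then obtain idx where idx: "\<And>v. v \<in> D \<Longrightarrow> idx v \<le> k" "\<And>v. v \<in> D \<Longrightarrow> xs ! idx v = v" by metis
    define PM where "PM = PiM {..<k} (\<lambda>_. borel :: (real^'d) measure)"
    define E where "E = {f\<in>space PM. \<forall>v\<in>D. (\<Sum>j<idx v. f j) \<in> A v}"
    have cp: "(\<lambda>f. f j) \<in> borel_measurable PM" if "j < k" for j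
      unfolding PM_def using that by (intro measurable_component_singleton) auto
    have E: "E \<in> sets PM"
    proof -
      have "(\<lambda>f. \<Sum>j<idx v. f j) \<in> borel_measurable PM" if "v \<in> D" for v
        using idx[OF that] by (intro borel_measurable_sum cp) auto
      then have "{f\<in>space PM. (\<Sum>j<idx v. f j) \<in> A v} \<in> sets PM" if "v \<in> D" for v
        using that A[OF that] by measurable
      then show ?thesis unfolding E_def using D by (intro sets.sets_Collect_finite_All) auto
    qed
    have "indep_var (PiM {..<k} (\<lambda>_. borel)) (\<lambda>\<omega>. restrict (\<lambda>i. X i \<omega>) {..<k})
       (PiM {k} (\<lambda>_. borel)) (\<lambda>\<omega>. restrict (\<lambda>i. X i \<omega>) {k})"
      by (rule indep_var_restrict[OF ind]) auto
    then have iv: "indep_var PM (\<lambda>\<omega>. restrict (\<lambda>i. X i \<omega>) {..<k})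
       (PiM {k} (\<lambda>_. borel)) (\<lambda>\<omega>. restrict (\<lambda>i. X i \<omega>) {k})" by (simp add: PM_def)
    define G where "G = {f\<in>space (PiM {k} (\<lambda>_. borel :: (real^'d) measure)). f k \<in> C}"
    have G: "G \<in> sets (PiM {k} (\<lambda>_. borel :: (real^'d) measure))" using C unfolding G_def by measurable
    define a' where "a' = {\<omega>\<in>space M. restrict (\<lambda>i. X i \<omega>) {..<k} \<in> E}"
    have a'_meas: "a' \<in> sets M"
    proof -
      have "(\<lambda>\<omega>. restrict (\<lambda>i. X i \<omega>) {..<k}) \<in> M \<rightarrow>\<^sub>M PM" using iv by (rule indep_var_rv1)
      from measurable_sets[OF this E] show ?thesis unfolding a'_def by (simp add: vimage_def Int_def conj_commute)
    qed
    have a'_iff: "AE \<omega> in M. \<omega> \<in> a \<longleftrightarrow> \<omega> \<in> a'"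
    proof -
      have s1: "\<omega> \<in> a' \<longleftrightarrow> (\<forall>v\<in>D. (\<Sum>j<idx v. X j \<omega>) \<in> A v)" if "\<omega> \<in> space M" for \<omega>
      proof -
        have "restrict (\<lambda>i. X i \<omega>) {..<k} \<in> space PM" by (simp add: PM_def space_PiM)
        moreover have "(\<Sum>j<idx v. restrict (\<lambda>i. X i \<omega>) {..<k} j) = (\<Sum>j<idx v. X j \<omega>)" if "v \<in> D" for v
          using idx(1)[OF that] by (intro sum.cong) auto
        ultimately show ?thesis using that by (auto simp: a'_def E_def)
      qed
      have s2: "(\<Sum>j<idx v. X j \<omega>) = W v \<omega>" if "v \<in> D" "W 0 \<omega> = 0" for v \<omega>
        using tele[of "idx v" \<omega>] idx[OF that(1)] that by simp
      show ?thesis using aeq W_0 AE_space by eventually_elim (auto simp: s1 s2)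
    qed
    have b_eq: "b = (\<lambda>\<omega>. restrict (\<lambda>i. X i \<omega>) {k}) -` G \<inter> space M"
      by (auto simp: b G_def space_PiM Xk)
    have b_meas: "b \<in> sets M" using C unfolding b by measurable
    have "prob (a \<inter> b) = prob (a' \<inter> b)"
      by (rule finite_measure_eq_AE) (use a'_iff a a'_meas b_meas in auto)
    also have "a' \<inter> b = (\<lambda>\<omega>. (restrict (\<lambda>i. X i \<omega>) {..<k}, restrict (\<lambda>i. X i \<omega>) {k})) -` (E \<times> G) \<inter> space M"
      unfolding b_eq a'_def by auto
    also have "prob \<dots> = prob ((\<lambda>\<omega>. restrict (\<lambda>i. X i \<omega>) {..<k}) -` E \<inter> space M) * prob ((\<lambda>\<omega>. restrict (\<lambda>i. X i \<omega>) {k}) -` G \<inter> space M)"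
      by (rule indep_varD[OF iv E G])
    also have "(\<lambda>\<omega>. restrict (\<lambda>i. X i \<omega>) {..<k}) -` E \<inter> space M = a'" unfolding a'_def by auto
    also have "prob a' = prob a" by (rule finite_measure_eq_AE) (use a'_iff a a'_meas in auto)
    finally show "prob (a \<inter> b) = prob a * prob b" unfolding b_eq .
  qed
  then have "indep_set (sigma_sets (space M) Cyl) (sigma_sets (space M) Inc)"
    by (rule indep_set_sigma_sets[OF _ Cyl Inc])
  moreover have "B \<in> sigma_sets (space M) Cyl"
  proof -
    have gen: "{W v -` A \<inter> space M | v A. v \<in> {0..min r T} \<and> A \<in> sets borel} \<subseteq> Cyl"
    proof safe
      fix v and A :: "(real^'d) set" assume v: "v \<in> {0..min r T}" and A: "A \<in> sets borel"
      have "cyl (W v -` A \<inter> space M) {v} (\<lambda>_. A)" using v A AE_space by (auto simp: cyl_def)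
      moreover have "W v -` A \<inter> space M \<in> sets M" using W_meas[of v] v A by (auto intro: measurable_sets)
      ultimately show "W v -` A \<inter> space M \<in> Cyl" by (auto simp: Cyl_def)
    qed
    have "sets (natural_filtration M T W r)
        = sigma_sets (space M) {W v -` A \<inter> space M | v A. v \<in> {0..min r T} \<and> A \<in> sets borel}"
      unfolding natural_filtration_def by (rule sets_measure_of) auto
    also have "\<dots> \<subseteq> sigma_sets (space M) Cyl" by (rule sigma_sets_mono'[OF gen])
    finally have "sets (natural_filtration M T W r) \<subseteq> sigma_sets (space M) Cyl" .
    moreover have "null_sets M \<subseteq> Cyl"
    proof
      fix N assume N: "N \<in> null_sets M"
      have "AE \<omega> in M. \<omega> \<notin> N" using N by (rule AE_not_in)
      then have "cyl N {0} (\<lambda>_. {})" using r by (auto simp: cyl_def)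
      then show "N \<in> Cyl" using N by (auto simp: Cyl_def)
    qed
    ultimately have "sets (natural_filtration M T W r) \<union> null_sets M \<subseteq> sigma_sets (space M) Cyl"
      by (auto intro: sigma_sets.Basic)
    then show ?thesis using B sigma_sets_mono by blast
  qed
  ultimately show ?thesis
    by (rule indep_setD) (use C in \<open>auto simp: Inc_def\<close>)
qed

section \<open>Brownian increments and the common noise filtration\<close>

text \<open>
  The right limit at \<open>t\<close> lies in every completed \<open>\<sigma>\<close>-algebra at a later time, where independence of
  subsequent increments can be tested.
\<close>

lemma sets_augmentation:
  assumes "sets (G r) \<subseteq> Pow (space M)" and "t < r"
  shows "sets (augmentation M G t) = sigma_sets (space M) (\<Inter>s\<in>{t<..}. sigma_sets (space M) (sets (G s) \<union> null_sets M))"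
    and "sets (augmentation M G t) \<subseteq> sigma_sets (space M) (sets (G r) \<union> null_sets M)"
proof -
  let ?I = "\<Inter>s\<in>{t<..}. sigma_sets (space M) (sets (G s) \<union> null_sets M)"
  have sub: "?I \<subseteq> sigma_sets (space M) (sets (G r) \<union> null_sets M)" using assms by auto
  have gen: "sets (G r) \<union> null_sets M \<subseteq> Pow (space M)"
    using assms by (auto dest: sets.sets_into_space[OF null_setsD2])
  have "?I \<subseteq> Pow (space M)"
    using sub sigma_sets_into_sp[OF gen] by (meson PowI subset_iff)
  then show eq: "sets (augmentation M G t) = sigma_sets (space M) ?I"
    unfolding augmentation_def by (rule sets_measure_of)
  show "sets (augmentation M G t) \<subseteq> sigma_sets (space M) (sets (G r) \<union> null_sets M)"
    unfolding eq using sub by (rule sigma_sets_mono)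
qed

lemma space_augmentation [simp]: "space (augmentation M G t) = space M"
  unfolding augmentation_def by (simp add: space_measure_of_conv)

lemma space_natural_filtration [simp]: "space (natural_filtration M T X t) = space M"
  unfolding natural_filtration_def by (simp add: space_measure_of_conv)

lemma sets_natural_filtration_Pow: "sets (natural_filtration M T X t) \<subseteq> Pow (space M)"
  using sets.space_closed[of "natural_filtration M T X t"] by simp

lemma sets_augmentation_mono: 
  assumes "\<And>r. sets (G r) \<subseteq> Pow (space M)" and "s \<le> t"
  shows "sets (augmentation M G s) \<subseteq> sets (augmentation M G t)"
  unfolding sets_augmentation(1)[OF assms(1) less_add_one]
  by (rule sigma_sets_mono') (use \<open>s \<le> t\<close> in \<open>auto\<close>)

lemma in_sets_augmentation:
  assumes "\<And>r. sets (G r) \<subseteq> Pow (space M)" and "\<And>r. t < r \<Longrightarrow> A \<in> sets (G r)"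
  shows "A \<in> sets (augmentation M G t)"
  unfolding sets_augmentation(1)[OF assms(1) less_add_one]
  using assms(2) by (auto intro!: sigma_sets.Basic)

lemma sets_natural_filtration:
  assumes "brownian_motion M T W"
  shows "sets (natural_filtration M T W t) \<subseteq> sets M"
proof -
  have "sets (natural_filtration M T W t)
      = sigma_sets (space M) {W v -` A \<inter> space M | v A. v \<in> {0..min t T} \<and> A \<in> sets borel}"
    unfolding natural_filtration_def by (rule sets_measure_of) auto
  also have "\<dots> \<subseteq> sets M"
    by (rule sets.sigma_sets_subset) (use assms in \<open>auto simp: brownian_motion_def intro!: measurable_sets\<close>)
  finally show ?thesis .
qed

text \<open>
  The filtration of the product space contains three completions, those of the two factors and that
  of the product, and right limits on both levels.
\<close>

locale common_noise_brownian =
  fixes T :: real and M0 :: "'a measure" and M1 :: "'b measure"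
    and W0 :: "real \<Rightarrow> 'a \<Rightarrow> real^'d::finite" and W :: "real \<Rightarrow> 'b \<Rightarrow> real^'d"
    and M :: "('a \<times> 'b) measure" and F :: "real \<Rightarrow> ('a \<times> 'b) measure"
  assumes T: "0 < T"
    and prob_M0: "prob_space M0" and prob_M1: "prob_space M1"
    and W0: "brownian_motion M0 T W0" and W: "brownian_motion M1 T W"
    and M: "M = common_noise_space M0 M1"
    and F: "F = common_noise_filtration M0 M1 T W0 W"
begin

sublocale M0: prob_space M0 by (rule prob_M0)
sublocale M1: prob_space M1 by (rule prob_M1)
sublocale P: pair_prob_space M0 M1 by standard

lemma M_eq: "M = completion (M0 \<Otimes>\<^sub>M M1)" by (simp add: M common_noise_space_def)

sublocale M: prob_space M
  unfolding M_eq by (rule prob_spaceI) (simp add: P.emeasure_space_1)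

lemma space_M: "space M = space M0 \<times> space M1" by (simp add: M_eq space_pair_measure)

lemma fst_measurable [measurable]: "fst \<in> M \<rightarrow>\<^sub>M M0" and snd_measurable [measurable]: "snd \<in> M \<rightarrow>\<^sub>M M1"
  unfolding M_eq by (auto intro: measurable_completion)

abbreviation "G0 \<equiv> augmentation M0 (natural_filtration M0 T W0)"
abbreviation "G1 \<equiv> augmentation M1 (natural_filtration M1 T W)"

lemma F_eq: "F t = augmentation M (\<lambda>t. G0 t \<Otimes>\<^sub>M G1 t) t"
  by (simp add: F common_noise_filtration_def M)

lemma sets_G: "sets (G0 t) \<subseteq> sets M0" "sets (G1 t) \<subseteq> sets M1"
proof -
  have "sigma_sets (space M0) (sets (natural_filtration M0 T W0 (t+1)) \<union> null_sets M0) \<subseteq> sets M0"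
    using sets_natural_filtration[OF W0] by (intro sets.sigma_sets_subset) auto
  then show "sets (G0 t) \<subseteq> sets M0"
    using sets_augmentation(2)[of "natural_filtration M0 T W0" "t+1" M0 t]
      sets.space_closed[of "natural_filtration M0 T W0 (t+1)"] by auto
  have "sigma_sets (space M1) (sets (natural_filtration M1 T W (t+1)) \<union> null_sets M1) \<subseteq> sets M1"
    using sets_natural_filtration[OF W] by (intro sets.sigma_sets_subset) auto
  then show "sets (G1 t) \<subseteq> sets M1"
    using sets_augmentation(2)[of "natural_filtration M1 T W" "t+1" M1 t]
      sets.space_closed[of "natural_filtration M1 T W (t+1)"] by auto
qed

lemma sets_G_pair: "sets (G0 t \<Otimes>\<^sub>M G1 t) \<subseteq> sets M" "sets (G0 t \<Otimes>\<^sub>M G1 t) \<subseteq> Pow (space M)"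
proof -
  have "a \<times> b \<in> sets (M0 \<Otimes>\<^sub>M M1)" if "a \<in> sets (G0 t)" "b \<in> sets (G1 t)" for a b
    using that sets_G[of t] by auto
  then have "{a \<times> b |a b. a \<in> sets (G0 t) \<and> b \<in> sets (G1 t)} \<subseteq> sets (M0 \<Otimes>\<^sub>M M1)" by auto
  from sets.sigma_sets_subset[OF this] have "sets (G0 t \<Otimes>\<^sub>M G1 t) \<subseteq> sets (M0 \<Otimes>\<^sub>M M1)"
    by (simp add: sets_pair_measure[of "G0 t" "G1 t"] space_pair_measure)
  then show "sets (G0 t \<Otimes>\<^sub>M G1 t) \<subseteq> sets M" unfolding M_eq by auto
  then show "sets (G0 t \<Otimes>\<^sub>M G1 t) \<subseteq> Pow (space M)" using sets.space_closed[of M] by auto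
qed

lemma space_F [simp]: "space (F t) = space M" by (simp add: F_eq)

lemma subalgebra_F: "subalgebra M (F t)"
proof -
  have "sigma_sets (space M) (sets (G0 (t+1) \<Otimes>\<^sub>M G1 (t+1)) \<union> null_sets M) \<subseteq> sets M"
    using sets_G_pair by (intro sets.sigma_sets_subset) auto
  then have "sets (F t) \<subseteq> sets M"
    unfolding F_eq using sets_augmentation(2)[of "\<lambda>t. G0 t \<Otimes>\<^sub>M G1 t" "t+1" M t] sets_G_pair(2)[of "t+1"] by auto
  then show ?thesis by (simp add: subalgebra_def)
qed

lemma F_mono: "s \<le> t \<Longrightarrow> sets (F s) \<subseteq> sets (F t)"
  unfolding F_eq by (rule sets_augmentation_mono) (rule sets_G_pair(2))

lemma W_adapted:
  assumes "t \<in> {0..T}"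
  shows "(\<lambda>\<omega>. W0 t (fst \<omega>)) \<in> borel_measurable (F t)" "(\<lambda>\<omega>. W t (snd \<omega>)) \<in> borel_measurable (F t)"
proof -
  have nat0: "W0 t -` A \<inter> space M0 \<in> sets (natural_filtration M0 T W0 r)" if "t \<le> r" "A \<in> sets borel" for r A
    unfolding natural_filtration_def
    by (subst sets_measure_of) (use assms that in \<open>auto intro!: sigma_sets.Basic exI[of _ t] exI[of _ A]\<close>)
  have G0: "W0 t -` A \<inter> space M0 \<in> sets (G0 r)" if "t < r" "A \<in> sets borel" for r A
    using that by (intro in_sets_augmentation nat0 sets_natural_filtration_Pow) auto
  have nat1: "W t -` A \<inter> space M1 \<in> sets (natural_filtration M1 T W r)" if "t \<le> r" "A \<in> sets borel" for r A
    unfolding natural_filtration_def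
    by (subst sets_measure_of) (use assms that in \<open>auto intro!: sigma_sets.Basic exI[of _ t] exI[of _ A]\<close>)
  have G1: "W t -` A \<inter> space M1 \<in> sets (G1 r)" if "t < r" "A \<in> sets borel" for r A
    using that by (intro in_sets_augmentation nat1 sets_natural_filtration_Pow) auto
  show "(\<lambda>\<omega>. W0 t (fst \<omega>)) \<in> borel_measurable (F t)"
  proof (rule measurableI)
    fix A :: "(real^'d) set" assume A: "A \<in> sets borel"
    have "(\<lambda>\<omega>. W0 t (fst \<omega>)) -` A \<inter> space (F t) = (W0 t -` A \<inter> space M0) \<times> space M1" 
      by (auto simp: space_M)
    also have "\<dots> \<in> sets (F t)" unfolding F_eq
    proof (rule in_sets_augmentation)
      fix r assume "t < r"
      then have "(W0 t -` A \<inter> space M0) \<times> space (G1 r) \<in> sets (G0 r \<Otimes>\<^sub>M G1 r)" using G0 A by blast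
      then show "(W0 t -` A \<inter> space M0) \<times> space M1 \<in> sets (G0 r \<Otimes>\<^sub>M G1 r)" by simp
    qed (rule sets_G_pair(2))
    finally show "(\<lambda>\<omega>. W0 t (fst \<omega>)) -` A \<inter> space (F t) \<in> sets (F t)" .
  qed simp
  show "(\<lambda>\<omega>. W t (snd \<omega>)) \<in> borel_measurable (F t)"
  proof (rule measurableI)
    fix A :: "(real^'d) set" assume A: "A \<in> sets borel"
    have "(\<lambda>\<omega>. W t (snd \<omega>)) -` A \<inter> space (F t) = space M0 \<times> (W t -` A \<inter> space M1)" 
      by (auto simp: space_M)
    also have "\<dots> \<in> sets (F t)" unfolding F_eq
    proof (rule in_sets_augmentation)
      fix r assume "t < r"
      then have "space (G0 r) \<times> (W t -` A \<inter> space M1) \<in> sets (G0 r \<Otimes>\<^sub>M G1 r)" using G1 A by blast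
      then show "space M0 \<times> (W t -` A \<inter> space M1) \<in> sets (G0 r \<Otimes>\<^sub>M G1 r)" by simp
    qed (rule sets_G_pair(2))
    finally show "(\<lambda>\<omega>. W t (snd \<omega>)) -` A \<inter> space (F t) \<in> sets (F t)" .
  qed simp
qed

lemma W_meas: "t \<in> {0..T} \<Longrightarrow> W0 t \<in> borel_measurable M0" "t \<in> {0..T} \<Longrightarrow> W t \<in> borel_measurable M1"
  using W0 W by (auto simp: brownian_motion_def)

lemma measure_M_times:
  assumes "A \<in> sets M0" "B \<in> sets M1"
  shows "measure M (A \<times> B) = measure M0 A * measure M1 B"
  using assms unfolding M_eq
  by (simp add: measure_def M1.emeasure_pair_measure_Times enn2real_mult)

text \<open>
  An event of \<open>F s\<close> lies in the completed product \<open>\<sigma>\<close>-algebra at a time \<open>q\<close> strictly between \<open>s\<close> and \<open>r\<close>,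
  and the factors of that product lie in the completed natural filtrations at time \<open>r\<close>: the gap
  between \<open>s\<close> and \<open>r\<close> leaves room for both right limits. Up to null sets it therefore suffices to treat
  rectangles, for which the independence of the two noises reduces the claim to each factor.
\<close>

lemma increments_independent:
  assumes s: "0 \<le> s" "s < r" and r: "r < u" "u \<le> T"
    and B: "B \<in> sets (F s)"
    and \<phi> [measurable]: "\<phi> \<in> borel_measurable borel" 
    and int: "integrable M (\<lambda>\<omega>. \<phi> (W0 u (fst \<omega>) - W0 r (fst \<omega>), W u (snd \<omega>) - W r (snd \<omega>)))"
  shows "(\<integral>\<omega>. indicator B \<omega> * \<phi> (W0 u (fst \<omega>) - W0 r (fst \<omega>), W u (snd \<omega>) - W r (snd \<omega>)) \<partial>M)
    = measure M B * (\<integral>\<omega>. \<phi> (W0 u (fst \<omega>) - W0 r (fst \<omega>), W u (snd \<omega>) - W r (snd \<omega>)) \<partial>M)"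
proof -
  have [measurable]: "W0 u \<in> borel_measurable M0" "W0 r \<in> borel_measurable M0" "W u \<in> borel_measurable M1" "W r \<in> borel_measurable M1"
    using s r by (auto intro!: W_meas)
  define X0 where "X0 = (\<lambda>\<omega>. W0 u \<omega> - W0 r \<omega>)"
  define X1 where "X1 = (\<lambda>\<omega>. W u \<omega> - W r \<omega>)"
  have [measurable]: "X0 \<in> borel_measurable M0" "X1 \<in> borel_measurable M1" by (auto simp: X0_def X1_def)
  define X where "X = (\<lambda>\<omega>. (X0 (fst \<omega>), X1 (snd \<omega>)))"
  have X_meas [measurable]: "X \<in> borel_measurable M" 
    unfolding X_def by measurable
  define H0 where "H0 = sigma_sets (space M0) (sets (natural_filtration M0 T W0 r) \<union> null_sets M0)"
  define H1 where "H1 = sigma_sets (space M1) (sets (natural_filtration M1 T W r) \<union> null_sets M1)"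
  have H: "H0 \<subseteq> sets M0" "H1 \<subseteq> sets M1"
    unfolding H0_def H1_def using sets_natural_filtration[OF W0] sets_natural_filtration[OF W]
    by (auto intro!: sets.sigma_sets_subset)
  interpret H0: sigma_algebra "space M0" H0
    unfolding H0_def using H(1) sets.space_closed[of M0] sets.space_closed[of "natural_filtration M0 T W0 r"]
    by (intro sigma_algebra_sigma_sets) (auto dest: sets.sets_into_space[OF null_setsD2])
  interpret H1: sigma_algebra "space M1" H1
    unfolding H1_def using H(2) sets.space_closed[of M1] sets.space_closed[of "natural_filtration M1 T W r"]
    by (intro sigma_algebra_sigma_sets) (auto dest: sets.sets_into_space[OF null_setsD2])
  define Rect where "Rect = {B \<in> sets M. \<exists>B0\<in>H0. \<exists>B1\<in>H1. AE \<omega> in M. \<omega> \<in> B \<longleftrightarrow> fst \<omega> \<in> B0 \<and> snd \<omega> \<in> B1}"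
  define Inc where "Inc = {{\<omega>\<in>space M. X0 (fst \<omega>) \<in> C0 \<and> X1 (snd \<omega>) \<in> C1} | C0 C1. C0 \<in> sets borel \<and> C1 \<in> sets borel}"
  have stable1: "Int_stable Rect"
  proof (rule Int_stableI)
    fix a b assume "a \<in> Rect" "b \<in> Rect"
    then obtain A0 A1 B0 B1 where *: "a \<in> sets M" "b \<in> sets M" "A0 \<in> H0" "A1 \<in> H1" "B0 \<in> H0" "B1 \<in> H1"
      and AE: "AE \<omega> in M. \<omega> \<in> a \<longleftrightarrow> fst \<omega> \<in> A0 \<and> snd \<omega> \<in> A1" "AE \<omega> in M. \<omega> \<in> b \<longleftrightarrow> fst \<omega> \<in> B0 \<and> snd \<omega> \<in> B1"
      by (auto simp: Rect_def)
    have "AE \<omega> in M. \<omega> \<in> a \<inter> b \<longleftrightarrow> fst \<omega> \<in> A0 \<inter> B0 \<and> snd \<omega> \<in> A1 \<inter> B1"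
      using AE by eventually_elim auto
    then show "a \<inter> b \<in> Rect" using * H0.Int H1.Int unfolding Rect_def by blast
  qed
  have stable2: "Int_stable Inc"
  proof (rule Int_stableI)
    fix a b assume "a \<in> Inc" "b \<in> Inc"
    then obtain C0 C1 D0 D1 where *: "C0 \<in> sets borel" "C1 \<in> sets borel" "D0 \<in> sets borel" "D1 \<in> sets borel"
      "a = {\<omega>\<in>space M. X0 (fst \<omega>) \<in> C0 \<and> X1 (snd \<omega>) \<in> C1}" "b = {\<omega>\<in>space M. X0 (fst \<omega>) \<in> D0 \<and> X1 (snd \<omega>) \<in> D1}"
      by (auto simp: Inc_def)
    then have "a \<inter> b = {\<omega>\<in>space M. X0 (fst \<omega>) \<in> C0 \<inter> D0 \<and> X1 (snd \<omega>) \<in> C1 \<inter> D1}" by auto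
    then show "a \<inter> b \<in> Inc" unfolding Inc_def using * by blast
  qed
  have "M.indep_set Rect Inc"
  proof (rule M.indep_setI)
    show "Rect \<subseteq> M.events" by (auto simp: Rect_def)
    show "Inc \<subseteq> M.events" by (auto simp: Inc_def)
    fix a b assume "a \<in> Rect" "b \<in> Inc"
    then obtain B0 B1 C0 C1 where a: "a \<in> sets M" and B01: "B0 \<in> H0" "B1 \<in> H1"
      and AE: "AE \<omega> in M. \<omega> \<in> a \<longleftrightarrow> fst \<omega> \<in> B0 \<and> snd \<omega> \<in> B1"
      and C [measurable]: "C0 \<in> sets borel" "C1 \<in> sets borel"
      and b: "b = {\<omega>\<in>space M. X0 (fst \<omega>) \<in> C0 \<and> X1 (snd \<omega>) \<in> C1}" by (auto simp: Rect_def Inc_def)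
    have [measurable]: "B0 \<in> sets M0" "B1 \<in> sets M1" using B01 H by auto
    define D0 where "D0 = {\<omega>\<in>space M0. X0 \<omega> \<in> C0}"
    define D1 where "D1 = {\<omega>\<in>space M1. X1 \<omega> \<in> C1}"
    have [measurable]: "D0 \<in> sets M0" "D1 \<in> sets M1" by (auto simp: D0_def D1_def)
    have b': "b = D0 \<times> D1" by (auto simp: b D0_def D1_def space_M)
    have times: "E0 \<times> E1 \<in> sets M" if "E0 \<in> sets M0" "E1 \<in> sets M1" for E0 E1
      using that unfolding M_eq by auto
    have ind0: "measure M0 (B0 \<inter> D0) = measure M0 B0 * measure M0 D0"
      using brownian_increment_independent[OF prob_M0 W0 _ r B01(1)[unfolded H0_def] C(1)] s by (simp add: D0_def X0_def)
    have ind1: "measure M1 (B1 \<inter> D1) = measure M1 B1 * measure M1 D1"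
      using brownian_increment_independent[OF prob_M1 W _ r B01(2)[unfolded H1_def] C(2)] s by (simp add: D1_def X1_def)
    have "measure M (a \<inter> b) = measure M ((B0 \<inter> D0) \<times> (B1 \<inter> D1))"
      by (rule M.finite_measure_eq_AE) (use AE a in \<open>auto simp: b' intro!: times\<close>)
    also have "\<dots> = measure M (B0 \<times> B1) * measure M b"
      by (simp add: b' measure_M_times ind0 ind1)
    also have "measure M (B0 \<times> B1) = measure M a"
      by (rule M.finite_measure_eq_AE) (use AE a in \<open>auto intro!: times\<close>)
    finally show "measure M (a \<inter> b) = measure M a * measure M b" .
  qed
  then have indep: "M.indep_set (sigma_sets (space M) Rect) (sigma_sets (space M) Inc)"
    by (rule M.indep_set_sigma_sets[OF _ stable1 stable2])
  have "B \<in> sigma_sets (space M) Rect"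
  proof -
    define q where "q = (s + r) / 2"
    have q: "s < q" "q < r" using s by (auto simp: q_def)
    have "sets (G0 q) \<subseteq> H0" unfolding H0_def
      using q sets.space_closed[of "natural_filtration M0 T W0 r"] by (intro sets_augmentation(2)) auto
    moreover have "sets (G1 q) \<subseteq> H1" unfolding H1_def
      using q sets.space_closed[of "natural_filtration M1 T W r"] by (intro sets_augmentation(2)) auto
    ultimately have "{a \<times> b |a b. a \<in> sets (G0 q) \<and> b \<in> sets (G1 q)} \<subseteq> Rect"
      unfolding Rect_def using H by (fastforce simp: M_eq mem_Times_iff)
    then have "sets (G0 q \<Otimes>\<^sub>M G1 q) \<subseteq> sigma_sets (space M) Rect"
      by (simp add: sets_pair_measure space_M sigma_sets_mono')
    moreover have "null_sets M \<subseteq> Rect"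
    proof
      fix N assume N: "N \<in> null_sets M"
      then have "AE \<omega> in M. \<omega> \<in> N \<longleftrightarrow> fst \<omega> \<in> {} \<and> snd \<omega> \<in> {}" using AE_not_in[OF N] by auto
      then show "N \<in> Rect" using N H0.empty_sets H1.empty_sets unfolding Rect_def by blast
    qed
    ultimately have "sets (G0 q \<Otimes>\<^sub>M G1 q) \<union> null_sets M \<subseteq> sigma_sets (space M) Rect"
      by (auto intro: sigma_sets.Basic)
    then have "sigma_sets (space M) (sets (G0 q \<Otimes>\<^sub>M G1 q) \<union> null_sets M) \<subseteq> sigma_sets (space M) Rect"
      by (rule sigma_sets_mono)
    moreover have "sets (F s) \<subseteq> sigma_sets (space M) (sets (G0 q \<Otimes>\<^sub>M G1 q) \<union> null_sets M)"
      unfolding F_eq using q sets_G_pair(2) by (intro sets_augmentation(2)) 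
    ultimately show ?thesis using B by auto
  qed
  moreover have Inc_X: "{X -` A \<inter> space M |A. A \<in> sets borel} \<subseteq> sigma_sets (space M) Inc"
  proof safe
    fix A :: "((real^'d) \<times> (real^'d)) set" assume "A \<in> sets borel"
    then have A: "A \<in> sets ((borel :: (real^'d) measure) \<Otimes>\<^sub>M (borel :: (real^'d) measure))" by (subst borel_prod)
    define N where "N = sigma (space M) Inc"
    have Inc_sp: "Inc \<subseteq> Pow (space M)" by (auto simp: Inc_def)
    have setsN: "sets N = sigma_sets (space M) Inc" and spN: "space N = space M"
      using Inc_sp by (auto simp: N_def)
    have "X \<in> N \<rightarrow>\<^sub>M (borel \<Otimes>\<^sub>M borel)"
    proof (rule measurable_pair)
      show "fst \<circ> X \<in> borel_measurable N"
      proof (rule measurableI)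
        fix C0 :: "(real^'d) set" assume C0: "C0 \<in> sets borel"
        have "(fst \<circ> X) -` C0 \<inter> space N = {\<omega>\<in>space M. X0 (fst \<omega>) \<in> C0 \<and> X1 (snd \<omega>) \<in> UNIV}"
          by (auto simp: spN X_def)
        also have "\<dots> \<in> Inc" unfolding Inc_def
          by (intro CollectI exI[of _ C0] exI[of _ UNIV] conjI refl) (auto simp: C0)
        finally have "(fst \<circ> X) -` C0 \<inter> space N \<in> Inc" .
        then show "(fst \<circ> X) -` C0 \<inter> space N \<in> sets N" by (simp add: setsN)
      qed simp
      show "snd \<circ> X \<in> borel_measurable N"
      proof (rule measurableI)
        fix C0 :: "(real^'d) set" assume C0: "C0 \<in> sets borel"
        have "(snd \<circ> X) -` C0 \<inter> space N = {\<omega>\<in>space M. X0 (fst \<omega>) \<in> UNIV \<and> X1 (snd \<omega>) \<in> C0}"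
          by (auto simp: spN X_def)
        also have "\<dots> \<in> Inc" unfolding Inc_def
          by (intro CollectI exI[of _ UNIV] exI[of _ C0] conjI refl) (auto simp: C0)
        finally have "(snd \<circ> X) -` C0 \<inter> space N \<in> Inc" .
        then show "(snd \<circ> X) -` C0 \<inter> space N \<in> sets N" by (simp add: setsN)
      qed simp
    qed
    from measurable_sets[OF this A] show "X -` A \<inter> space M \<in> sigma_sets (space M) Inc"
      by (simp add: setsN spN)
  qed
  have B_meas [measurable]: "B \<in> sets M" using B subalgebra_F[of s] by (auto simp: subalgebra_def)
  have "sigma_algebra (space M) (sigma_sets (space M) Rect)"
    by (rule sigma_algebra_sigma_sets) (auto simp: Rect_def dest: sets.sets_into_space)
  then interpret R: sigma_algebra "space M" "sigma_sets (space M) Rect" .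
  have "{(indicator B :: _ \<Rightarrow> real) -` A \<inter> space M |A. A \<in> sets borel} \<subseteq> sigma_sets (space M) Rect"
  proof safe
    fix A :: "real set" assume "A \<in> sets borel"
    have "(indicator B :: _ \<Rightarrow> real) -` A \<inter> space M
        = (if 1 \<in> A then B else {}) \<union> (if 0 \<in> A then space M - B else {})"
    proof (rule set_eqI)
      fix w show "w \<in> (indicator B :: _ \<Rightarrow> real) -` A \<inter> space M
        \<longleftrightarrow> w \<in> (if 1 \<in> A then B else {}) \<union> (if 0 \<in> A then space M - B else {})"
        using subsetD[OF sets.sets_into_space[OF B_meas], of w] by (cases "w \<in> B") simp_all
    qed
    then show "(indicator B :: _ \<Rightarrow> real) -` A \<inter> space M \<in> sigma_sets (space M) Rect"
      using \<open>B \<in> sigma_sets (space M) Rect\<close> by auto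
  qed
  moreover have "{(\<lambda>\<omega>. \<phi> (X \<omega>)) -` A \<inter> space M |A. A \<in> sets borel} \<subseteq> sigma_sets (space M) Inc"
  proof safe
    fix A :: "real set" assume "A \<in> sets borel"
    then have "\<phi> -` A \<in> sets borel" using measurable_sets[OF \<phi>, of A] by simp
    then have "X -` (\<phi> -` A) \<inter> space M \<in> sigma_sets (space M) Inc" using Inc_X by blast
    then show "(\<lambda>\<omega>. \<phi> (X \<omega>)) -` A \<inter> space M \<in> sigma_sets (space M) Inc" by (simp add: vimage_def)
  qed
  ultimately have sub: "sigma_sets (space M) {(indicator B :: _ \<Rightarrow> real) -` A \<inter> space M |A. A \<in> sets borel}
      \<subseteq> sigma_sets (space M) Rect"
    "sigma_sets (space M) {(\<lambda>\<omega>. \<phi> (X \<omega>)) -` A \<inter> space M |A. A \<in> sets borel} \<subseteq> sigma_sets (space M) Inc"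
    by (auto intro!: sigma_sets_mono del: subsetI)
  have "M.indep_set (sigma_sets (space M) {(indicator B :: _ \<Rightarrow> real) -` A \<inter> space M |A. A \<in> sets borel})
     (sigma_sets (space M) {(\<lambda>\<omega>. \<phi> (X \<omega>)) -` A \<inter> space M |A. A \<in> sets borel})"
    unfolding M.indep_sets2_eq
  proof (intro conjI ballI)
    fix a b assume "a \<in> sigma_sets (space M) {(indicator B :: _ \<Rightarrow> real) -` A \<inter> space M |A. A \<in> sets borel}"
      and "b \<in> sigma_sets (space M) {(\<lambda>\<omega>. \<phi> (X \<omega>)) -` A \<inter> space M |A. A \<in> sets borel}"
    then show "M.prob (a \<inter> b) = M.prob a * M.prob b"
      using M.indep_setD[OF indep, of a b] sub by blast
  qed (use sub M.indep_setD_ev1[OF indep] M.indep_setD_ev2[OF indep] in blast)+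
  then have iv': "M.indep_var borel (indicator B :: _ \<Rightarrow> real) borel (\<lambda>\<omega>. \<phi> (X \<omega>))"
    unfolding M.indep_var_eq by (intro conjI) auto
  have "(\<integral>\<omega>. indicator B \<omega> * \<phi> (X \<omega>) \<partial>M) = (\<integral>\<omega>. indicator B \<omega> \<partial>M) * (\<integral>\<omega>. \<phi> (X \<omega>) \<partial>M)"
  proof (rule M.indep_var_lebesgue_integral[OF iv'])
    show "integrable M (indicator B :: _ \<Rightarrow> real)" by (rule M.integrable_const_bound[of _ 1]) auto
  qed (use int in \<open>simp add: X_def X0_def X1_def\<close>)
  then show ?thesis by (simp add: X_def X0_def X1_def)
qed

end

lemma borel_measurable_vec_nth [measurable (raw)]:
  fixes f :: "'a \<Rightarrow> ('b::real_normed_vector)^'n::finite"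
  assumes "f \<in> borel_measurable N"
  shows "(\<lambda>x. f x $ i) \<in> borel_measurable N"
  using assms by (rule measurable_compose) (intro borel_measurable_continuous_onI continuous_intros)

lemma eq_0_if_small:
  fixes x K d :: real
  assumes "0 < d" and "\<And>\<delta>. 0 < \<delta> \<Longrightarrow> \<delta> < d \<Longrightarrow> \<bar>x\<bar> \<le> K * \<delta>"
  shows "x = 0"
proof (rule ccontr)
  assume "x \<noteq> 0"
  define \<delta> where "\<delta> = min (d / 2) (\<bar>x\<bar> / (2 * (\<bar>K\<bar> + 1)))"
  have "0 < \<delta>" "\<delta> < d" using assms \<open>x \<noteq> 0\<close> by (auto simp: \<delta>_def min_less_iff_disj)
  then have "\<bar>x\<bar> \<le> K * \<delta>" by (rule assms)
  also have "\<dots> \<le> (\<bar>K\<bar> + 1) * \<delta>" using \<open>0 < \<delta>\<close> by (intro mult_right_mono) auto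
  also have "\<dots> \<le> (\<bar>K\<bar> + 1) * (\<bar>x\<bar> / (2 * (\<bar>K\<bar> + 1)))" by (intro mult_left_mono) (auto simp: \<delta>_def)
  also have "\<dots> = \<bar>x\<bar> / 2" by (simp add: field_simps)
  finally show False using \<open>x \<noteq> 0\<close> by simp
qed

lemma brownian_moments:
  fixes W :: "real \<Rightarrow> 'w \<Rightarrow> real^'d::finite"
  assumes "brownian_motion M T W" and "0 \<le> s" "s < u" "u \<le> T"
  shows "integrable M (\<lambda>\<omega>. (W u \<omega> - W s \<omega>) $ i)" "(\<integral>\<omega>. (W u \<omega> - W s \<omega>) $ i \<partial>M) = 0"
    "integrable M (\<lambda>\<omega>. (W u \<omega> - W s \<omega>) $ i * (W u \<omega> - W s \<omega>) $ j)"
    "(\<integral>\<omega>. (W u \<omega> - W s \<omega>) $ i * (W u \<omega> - W s \<omega>) $ j \<partial>M) = (if i = j then u - s else 0)"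
proof -
  have D: "distributed M lborel (\<lambda>\<omega>. W u \<omega> - W s \<omega>)
          (\<lambda>x. ennreal (\<Prod>i\<in>UNIV. normal_density 0 (sqrt (u - s)) (x $ i)))"
    using assms by (auto simp: brownian_motion_def)
  have m: "(\<lambda>\<omega>. W u \<omega> - W s \<omega>) \<in> M \<rightarrow>\<^sub>M lborel" using D by (simp add: distributed_def)
  have d: "distr M lborel (\<lambda>\<omega>. W u \<omega> - W s \<omega>)
      = density lborel (\<lambda>x. ennreal (\<Prod>i\<in>UNIV. normal_density 0 (sqrt (u - s)) (x $ i)))"
    using D by (simp add: distributed_def)
  have \<sigma>: "0 < sqrt (u - s)" using assms by simp
  note G = gaussian_moments[where 'd='d, OF \<sigma>, folded d]
  show "integrable M (\<lambda>\<omega>. (W u \<omega> - W s \<omega>) $ i)"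
    using G(1)[of i] by (subst (asm) integrable_distr_eq[OF m]) auto
  show "(\<integral>\<omega>. (W u \<omega> - W s \<omega>) $ i \<partial>M) = 0"
    using G(2)[of i] by (subst (asm) integral_distr[OF m]) auto
  show "integrable M (\<lambda>\<omega>. (W u \<omega> - W s \<omega>) $ i * (W u \<omega> - W s \<omega>) $ j)"
    using G(3)[of i j] by (subst (asm) integrable_distr_eq[OF m]) auto
  show "(\<integral>\<omega>. (W u \<omega> - W s \<omega>) $ i * (W u \<omega> - W s \<omega>) $ j \<partial>M) = (if i = j then u - s else 0)"
    using G(4)[of i j] assms by (subst (asm) integral_distr[OF m]) auto
qed

context common_noise_brownian
begin

lemma integral_product:
  fixes f :: "'a \<Rightarrow> real" and g :: "'b \<Rightarrow> real"
  assumes f: "integrable M0 f" and g: "integrable M1 g"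
  shows "integrable M (\<lambda>\<omega>. f (fst \<omega>) * g (snd \<omega>))"
    and "(\<integral>\<omega>. f (fst \<omega>) * g (snd \<omega>) \<partial>M) = (\<integral>x. f x \<partial>M0) * (\<integral>y. g y \<partial>M1)"
proof -
  have [measurable]: "f \<in> borel_measurable M0" "g \<in> borel_measurable M1" using f g by auto
  have i: "integrable (M0 \<Otimes>\<^sub>M M1) (\<lambda>\<omega>. f (fst \<omega>) * g (snd \<omega>))"
  proof (rule P.Fubini_integrable)
    show "integrable M0 (\<lambda>x. \<integral>y. norm (f (fst (x, y)) * g (snd (x, y))) \<partial>M1)"
      using f by (simp add: abs_mult)
  qed (use g in auto)
  then show "integrable M (\<lambda>\<omega>. f (fst \<omega>) * g (snd \<omega>))"
    unfolding M_eq by (subst integrable_completion) auto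
  have "(\<integral>\<omega>. f (fst \<omega>) * g (snd \<omega>) \<partial>M) = (\<integral>\<omega>. f (fst \<omega>) * g (snd \<omega>) \<partial>(M0 \<Otimes>\<^sub>M M1))"
    unfolding M_eq by (rule integral_completion) auto
  also have "\<dots> = (\<integral>x. (\<integral>y. f x * g y \<partial>M1) \<partial>M0)"
    using P.integral_fst'[OF i] by simp
  finally show "(\<integral>\<omega>. f (fst \<omega>) * g (snd \<omega>) \<partial>M) = (\<integral>x. f x \<partial>M0) * (\<integral>y. g y \<partial>M1)" by simp
qed

text \<open>
  The coordinates of both noises as one family of scalar processes, those of \<open>W0\<close> on the left and
  those of \<open>W\<close> on the right. Cross terms between the noises then are the off-diagonal entries of
  one covariance matrix.
\<close>

definition coord :: "'d + 'd \<Rightarrow> real \<Rightarrow> 'a \<times> 'b \<Rightarrow> real" where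
  "coord a t \<omega> = (case a of Inl i \<Rightarrow> W0 t (fst \<omega>) $ i | Inr j \<Rightarrow> W t (snd \<omega>) $ j)"

lemma coord_simps [simp]:
  "coord (Inl i) t \<omega> = W0 t (fst \<omega>) $ i" "coord (Inr j) t \<omega> = W t (snd \<omega>) $ j"
  by (simp_all add: coord_def)

lemma coord_adapted: "t \<in> {0..T} \<Longrightarrow> coord a t \<in> borel_measurable (F t)"
proof -
  assume "t \<in> {0..T}"
  note [measurable] = W_adapted[OF this]
  show ?thesis by (cases a) (simp_all add: coord_def[abs_def])
qed

lemma coord_moments:
  assumes "0 \<le> s" "s < u" "u \<le> T"
  shows "integrable M (\<lambda>\<omega>. coord a u \<omega> - coord a s \<omega>)"
    "(\<integral>\<omega>. coord a u \<omega> - coord a s \<omega> \<partial>M) = 0"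
    "integrable M (\<lambda>\<omega>. (coord a u \<omega> - coord a s \<omega>) * (coord b u \<omega> - coord b s \<omega>))"
    "(\<integral>\<omega>. (coord a u \<omega> - coord a s \<omega>) * (coord b u \<omega> - coord b s \<omega>) \<partial>M) = (if a = b then u - s else 0)"
proof -
  note m0 = brownian_moments[OF W0 assms, simplified] and m1 = brownian_moments[OF W assms, simplified]
  have i0: "integrable M0 (\<lambda>_. 1 :: real)" and i1: "integrable M1 (\<lambda>_. 1 :: real)" by auto
  note l = integral_product[OF m0(1) i1, simplified] and r = integral_product[OF i0 m1(1), simplified]
  show "integrable M (\<lambda>\<omega>. coord a u \<omega> - coord a s \<omega>)"
    using l(1) r(1) by (cases a) auto
  show "(\<integral>\<omega>. coord a u \<omega> - coord a s \<omega> \<partial>M) = 0"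
    using l(2) r(2) m0(2) m1(2) by (cases a) (auto simp: M0.prob_space M1.prob_space)
  note ll = integral_product[OF m0(3) i1, simplified] and rr = integral_product[OF i0 m1(3), simplified]
    and lr = integral_product[OF m0(1) m1(1)]
  show "integrable M (\<lambda>\<omega>. (coord a u \<omega> - coord a s \<omega>) * (coord b u \<omega> - coord b s \<omega>))"
    using ll(1) rr(1) lr(1) by (cases a; cases b) (auto simp: mult.commute)
  show "(\<integral>\<omega>. (coord a u \<omega> - coord a s \<omega>) * (coord b u \<omega> - coord b s \<omega>) \<partial>M) = (if a = b then u - s else 0)"
  proof (cases a; cases b)
    fix i j assume "a = Inr j" "b = Inl i"
    then show ?thesis using lr(2)[of i j] m0(2) by (simp add: mult.commute)
  qed (use ll(2) rr(2) lr(2) m0(2) m0(4) m1(4) in \<open>auto simp: M0.prob_space M1.prob_space\<close>)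
qed

lemma coord_increment_past:
  assumes s: "0 \<le> s" "s < r" and r: "r < u" "u \<le> T" and B: "B \<in> sets (F s)"
  shows "(\<integral>\<omega>. indicator B \<omega> * (coord a u \<omega> - coord a r \<omega>) \<partial>M) = 0"
    "(\<integral>\<omega>. indicator B \<omega> * ((coord a u \<omega> - coord a r \<omega>) * (coord b u \<omega> - coord b r \<omega>)) \<partial>M)
      = measure M B * (if a = b then u - r else 0)"
proof -
  define proj :: "'d + 'd \<Rightarrow> (real^'d) \<times> (real^'d) \<Rightarrow> real"
    where "proj = (\<lambda>a (x, y). case a of Inl i \<Rightarrow> x $ i | Inr j \<Rightarrow> y $ j)"
  have pm [measurable]: "proj a \<in> borel_measurable borel" for a
    unfolding proj_def borel_prod[symmetric] case_prod_beta' by (cases a; simp only: sum.case; measurable)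
  have p: "proj a (W0 u (fst \<omega>) - W0 r (fst \<omega>), W u (snd \<omega>) - W r (snd \<omega>)) = coord a u \<omega> - coord a r \<omega>" for a \<omega>
    by (cases a) (auto simp: proj_def)
  have r0: "0 \<le> r" using s by simp
  note m = coord_moments[OF r0 r]
  show "(\<integral>\<omega>. indicator B \<omega> * (coord a u \<omega> - coord a r \<omega>) \<partial>M) = 0"
    using increments_independent[OF s r B pm[of a]] m by (simp add: p)
  show "(\<integral>\<omega>. indicator B \<omega> * ((coord a u \<omega> - coord a r \<omega>) * (coord b u \<omega> - coord b r \<omega>)) \<partial>M)
      = measure M B * (if a = b then u - r else 0)"
    using increments_independent[OF s r B, of "\<lambda>x. proj a x * proj b x"] m(3,4)[of a b]  by (simp add: p)
qed

text \<open>
  Right limit \<open>r \<down> s\<close> in the previous lemma. The error terms contain an increment over \<open>(s,r]\<close>, whose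
  \<open>L\<^sup>2\<close>-norm is \<open>\<delta> = sqrt (r - s)\<close>; weighting the elementary inequality
  \<open>2 |x y| \<le> x\<^sup>2 / \<delta> + \<delta> y\<^sup>2\<close> by this \<open>\<delta>\<close> makes each of them of order \<open>\<delta>\<close>.
\<close>

lemma coord_increment:
  assumes s: "0 \<le> s" "s < u" "u \<le> T" and B: "B \<in> sets (F s)"
  shows "(\<integral>\<omega>. indicator B \<omega> * (coord a u \<omega> - coord a s \<omega>) \<partial>M) = 0"
    "(\<integral>\<omega>. indicator B \<omega> * ((coord a u \<omega> - coord a s \<omega>) * (coord b u \<omega> - coord b s \<omega>)) \<partial>M)
      = measure M B * (if a = b then u - s else 0)"
proof -
  have B_meas [measurable]: "B \<in> sets M" using B subalgebra_F[of s] by (auto simp: subalgebra_def)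
  define d where "d = min 1 (sqrt (u - s))"
  have d: "0 < d" using s by (simp add: d_def)
  have small: "\<bar>\<integral>\<omega>. indicator B \<omega> * (coord a u \<omega> - coord a s \<omega>) \<partial>M\<bar> \<le> 1 * \<delta> \<and>
     \<bar>(\<integral>\<omega>. indicator B \<omega> * ((coord a u \<omega> - coord a s \<omega>) * (coord b u \<omega> - coord b s \<omega>)) \<partial>M)
        - measure M B * (if a = b then u - s else 0)\<bar> \<le> (3 + (u - s)) * \<delta>" if \<delta>: "0 < \<delta>" "\<delta> < d" for \<delta>
  proof -
    define r where "r = s + \<delta>\<^sup>2"
    have "\<delta>\<^sup>2 < (sqrt (u - s))\<^sup>2" using \<delta> by (intro power_strict_mono) (auto simp: d_def)
    then have r: "s < r" "r < u" using s \<delta> by (auto simp: r_def)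
    have r0: "0 \<le> r" and rT: "r \<le> T" using r s by auto
    have \<delta>2: "\<delta>\<^sup>2 \<le> \<delta>" using \<delta> by (simp add: d_def power2_eq_square mult_left_le)
    define x1 where "x1 = (\<lambda>c \<omega>. coord c r \<omega> - coord c s \<omega>)"
    define x2 where "x2 = (\<lambda>c \<omega>. coord c u \<omega> - coord c r \<omega>)"
    have x1: "coord c r \<omega> - coord c s \<omega> = x1 c \<omega>" and x2: "coord c u \<omega> - coord c r \<omega> = x2 c \<omega>" for c \<omega>
      by (simp_all add: x1_def x2_def)
    have split: "coord c u \<omega> - coord c s \<omega> = x1 c \<omega> + x2 c \<omega>" for c \<omega> by (simp add: x1_def x2_def)
    note m1 = coord_moments[OF s(1) r(1) rT, unfolded x1] and m2 = coord_moments[OF r0 r(2) s(3), unfolded x2]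
    note p = coord_increment_past[OF s(1) r s(3) B, unfolded x2]
    have ind [simp]: "integrable M (\<lambda>\<omega>. indicator B \<omega> * f \<omega>)" if "integrable M f" for f :: "'a \<times> 'b \<Rightarrow> real"
      using that by (subst mult.commute) (rule integrable_real_mult_indicator, auto)
    have bnd: "\<bar>\<integral>\<omega>. indicator B \<omega> * f \<omega> \<partial>M\<bar> \<le> (\<integral>\<omega>. g \<omega> \<partial>M)"
      if "integrable M f" "integrable M g" "\<And>\<omega>. \<bar>f \<omega>\<bar> \<le> g \<omega>" for f g :: "'a \<times> 'b \<Rightarrow> real"
    proof -
      have "0 \<le> g \<omega>" for \<omega> using that(3)[of \<omega>] by linarith
      then have "norm (\<integral>\<omega>. indicator B \<omega> * f \<omega> \<partial>M) \<le> (\<integral>\<omega>. g \<omega> \<partial>M)"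
        using that by (intro order_trans[OF integral_norm_bound integral_mono] integrable_norm ind) (auto simp: indicator_def)
      then show ?thesis by simp
    qed
    have young: "\<bar>x * y\<bar> \<le> (x * x / \<delta> + \<delta> * (y * y)) / 2" for x y :: real
    proof -
      have "0 \<le> (\<bar>x\<bar> - \<delta> * \<bar>y\<bar>)\<^sup>2 / \<delta>" using \<delta> by simp
      also have "\<dots> = x * x / \<delta> + \<delta> * (y * y) - 2 * \<bar>x * y\<bar>"
        using \<delta> by (simp add: power2_eq_square field_simps abs_mult)
      finally show ?thesis by simp
    qed
    have sq [simp]: "integrable M (\<lambda>\<omega>. x1 c \<omega> * x1 e \<omega>)" "integrable M (\<lambda>\<omega>. x2 c \<omega> * x2 e \<omega>)"
       "integrable M (x1 c)" "integrable M (x2 c)" for c e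
      using m1 m2 by auto
    have meas [measurable]: "x1 c \<in> borel_measurable M" "x2 c \<in> borel_measurable M" for c using sq by blast+
    have i12 [simp]: "integrable M (\<lambda>\<omega>. x1 c \<omega> * x2 e \<omega>)" "integrable M (\<lambda>\<omega>. x2 e \<omega> * x1 c \<omega>)" for c e
    proof -
      show "integrable M (\<lambda>\<omega>. x1 c \<omega> * x2 e \<omega>)"
      proof (rule Bochner_Integration.integrable_bound)
        show "integrable M (\<lambda>\<omega>. (x1 c \<omega> * x1 c \<omega> / \<delta> + \<delta> * (x2 e \<omega> * x2 e \<omega>)) / 2)" by simp
        show "AE \<omega> in M. norm (x1 c \<omega> * x2 e \<omega>) \<le> norm ((x1 c \<omega> * x1 c \<omega> / \<delta> + \<delta> * (x2 e \<omega> * x2 e \<omega>)) / 2)"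
          unfolding real_norm_def by (intro AE_I2 order.trans[OF young abs_ge_self])
      qed measurable
      then show "integrable M (\<lambda>\<omega>. x2 e \<omega> * x1 c \<omega>)" by (simp add: mult.commute)
    qed
    have s1: "(\<integral>\<omega>. x1 c \<omega> * x1 c \<omega> \<partial>M) = \<delta>\<^sup>2" for c using m1(4)[of c c] by (simp add: r_def)
    have s2: "(\<integral>\<omega>. x2 c \<omega> * x2 c \<omega> \<partial>M) = u - r" for c using m2(4)[of c c] by simp
    have b12: "\<bar>\<integral>\<omega>. indicator B \<omega> * (x1 c \<omega> * x2 e \<omega>) \<partial>M\<bar> \<le> (\<delta> + \<delta> * (u - s)) / 2" for c e
    proof -
      have "\<bar>\<integral>\<omega>. indicator B \<omega> * (x1 c \<omega> * x2 e \<omega>) \<partial>M\<bar>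
          \<le> (\<integral>\<omega>. (x1 c \<omega> * x1 c \<omega> / \<delta> + \<delta> * (x2 e \<omega> * x2 e \<omega>)) / 2 \<partial>M)"
        by (rule bnd[OF _ _ young]) simp_all
      also have "\<dots> = (\<delta> + \<delta> * (u - r)) / 2" using \<delta> by (simp add: s1 s2 power2_eq_square)
      also have "\<dots> \<le> (\<delta> + \<delta> * (u - s)) / 2" using \<delta> r by (simp add: mult_left_mono)
      finally show ?thesis .
    qed
    have b11: "\<bar>\<integral>\<omega>. indicator B \<omega> * (x1 a \<omega> * x1 b \<omega>) \<partial>M\<bar> \<le> \<delta>\<^sup>2"
    proof -
      have am: "\<bar>x * y\<bar> \<le> (x * x + y * y) / 2" for x y :: real
        using sum_squares_bound[of "\<bar>x\<bar>" "\<bar>y\<bar>"] by (simp add: abs_mult power2_eq_square)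
      have "\<bar>\<integral>\<omega>. indicator B \<omega> * (x1 a \<omega> * x1 b \<omega>) \<partial>M\<bar> \<le> (\<integral>\<omega>. (x1 a \<omega> * x1 a \<omega> + x1 b \<omega> * x1 b \<omega>) / 2 \<partial>M)"
        by (rule bnd[OF _ _ am]) simp_all
      also have "\<dots> = \<delta>\<^sup>2" by (simp add: s1)
      finally show ?thesis .
    qed
    have "(\<integral>\<omega>. indicator B \<omega> * (coord a u \<omega> - coord a s \<omega>) \<partial>M) = (\<integral>\<omega>. indicator B \<omega> * x1 a \<omega> \<partial>M)"
      unfolding split distrib_left using p(1)[of a] by (subst Bochner_Integration.integral_add) auto
    also have "\<bar>\<dots>\<bar> \<le> (\<integral>\<omega>. (x1 a \<omega> * x1 a \<omega> / \<delta> + \<delta> * (1 * 1)) / 2 \<partial>M)"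
      by (rule bnd) (use young[of _ 1] in \<open>simp_all only: mult_1_right, simp_all\<close>)
    also have "\<dots> = 1 * \<delta>" using \<delta> by (simp add: s1 power2_eq_square M.prob_space)
    finally have 1: "\<bar>\<integral>\<omega>. indicator B \<omega> * (coord a u \<omega> - coord a s \<omega>) \<partial>M\<bar> \<le> 1 * \<delta>" .
    have "(\<integral>\<omega>. indicator B \<omega> * ((coord a u \<omega> - coord a s \<omega>) * (coord b u \<omega> - coord b s \<omega>)) \<partial>M)
      = (\<integral>\<omega>. indicator B \<omega> * (x1 a \<omega> * x1 b \<omega>) + (indicator B \<omega> * (x1 a \<omega> * x2 b \<omega>)
         + (indicator B \<omega> * (x1 b \<omega> * x2 a \<omega>) + indicator B \<omega> * (x2 a \<omega> * x2 b \<omega>))) \<partial>M)"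
      unfolding split by (intro Bochner_Integration.integral_cong) (auto simp: algebra_simps)
    also have "\<dots> = (\<integral>\<omega>. indicator B \<omega> * (x1 a \<omega> * x1 b \<omega>) \<partial>M) + ((\<integral>\<omega>. indicator B \<omega> * (x1 a \<omega> * x2 b \<omega>) \<partial>M)
         + ((\<integral>\<omega>. indicator B \<omega> * (x1 b \<omega> * x2 a \<omega>) \<partial>M) + measure M B * (if a = b then u - r else 0)))"
      by (simp add: p(2) del: mult_indicator_cong)
    finally have eq: "(\<integral>\<omega>. indicator B \<omega> * ((coord a u \<omega> - coord a s \<omega>) * (coord b u \<omega> - coord b s \<omega>)) \<partial>M) = \<dots>" .
    have tri: "\<bar>d - e\<bar> \<le> x \<Longrightarrow> \<bar>a\<bar> \<le> x \<Longrightarrow> \<bar>b\<bar> \<le> y / 2 \<Longrightarrow> \<bar>c\<bar> \<le> y / 2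
        \<Longrightarrow> \<bar>a + (b + (c + d)) - e\<bar> \<le> x + y + x" for a b c d e x y :: real by linarith
    have "\<bar>measure M B * (if a = b then u - r else 0) - measure M B * (if a = b then u - s else 0)\<bar> \<le> \<delta>\<^sup>2"
      using M.prob_le_1[of B] by (auto simp: r_def algebra_simps mult_left_le_one_le)
    then have "\<bar>(\<integral>\<omega>. indicator B \<omega> * ((coord a u \<omega> - coord a s \<omega>) * (coord b u \<omega> - coord b s \<omega>)) \<partial>M)
        - measure M B * (if a = b then u - s else 0)\<bar> \<le> \<delta>\<^sup>2 + (\<delta> + \<delta> * (u - s)) + \<delta>\<^sup>2"
      unfolding eq using b11 b12[of a b] b12[of b a] by (rule tri)
    also have "\<dots> \<le> (3 + (u - s)) * \<delta>" using \<delta>2 by (simp add: algebra_simps)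
    finally show ?thesis using 1 by blast
  qed
  show "(\<integral>\<omega>. indicator B \<omega> * (coord a u \<omega> - coord a s \<omega>) \<partial>M) = 0"
    by (rule eq_0_if_small[OF d]) (use small in blast)
  have "(\<integral>\<omega>. indicator B \<omega> * ((coord a u \<omega> - coord a s \<omega>) * (coord b u \<omega> - coord b s \<omega>)) \<partial>M)
      - measure M B * (if a = b then u - s else 0) = 0"
    by (rule eq_0_if_small[OF d]) (use small in blast)
  then show "(\<integral>\<omega>. indicator B \<omega> * ((coord a u \<omega> - coord a s \<omega>) * (coord b u \<omega> - coord b s \<omega>)) \<partial>M)
      = measure M B * (if a = b then u - s else 0)" by simp
qed

end

section \<open>Orthogonality of increments and the energy identity\<close>

text \<open>
  Scalar processes that share with independent Brownian motions the first two moments of increments,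
  restricted to events of the past.
\<close>

locale brownian_family = prob_space M
  for M :: "'w measure" and F :: "real \<Rightarrow> 'w measure" and T :: real
    and \<beta> :: "'i \<Rightarrow> real \<Rightarrow> 'w \<Rightarrow> real" +
  assumes subalg: "subalgebra M (F t)"
    and mono: "s \<le> t \<Longrightarrow> sets (F s) \<subseteq> sets (F t)"
    and adapted: "t \<in> {0..T} \<Longrightarrow> \<beta> a t \<in> borel_measurable (F t)"
    and increment_integrable: "0 \<le> s \<Longrightarrow> s < u \<Longrightarrow> u \<le> T \<Longrightarrow> integrable M (\<lambda>\<omega>. \<beta> a u \<omega> - \<beta> a s \<omega>)"
    and increment_prod_integrable: "0 \<le> s \<Longrightarrow> s < u \<Longrightarrow> u \<le> T \<Longrightarrow>
      integrable M (\<lambda>\<omega>. (\<beta> a u \<omega> - \<beta> a s \<omega>) * (\<beta> b u \<omega> - \<beta> b s \<omega>))"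
    and increment_mean: "0 \<le> s \<Longrightarrow> s < u \<Longrightarrow> u \<le> T \<Longrightarrow> B \<in> sets (F s) \<Longrightarrow>
      (\<integral>\<omega>. indicator B \<omega> * (\<beta> a u \<omega> - \<beta> a s \<omega>) \<partial>M) = 0"
    and increment_covariance: "0 \<le> s \<Longrightarrow> s < u \<Longrightarrow> u \<le> T \<Longrightarrow> B \<in> sets (F s) \<Longrightarrow>
      (\<integral>\<omega>. indicator B \<omega> * ((\<beta> a u \<omega> - \<beta> a s \<omega>) * (\<beta> b u \<omega> - \<beta> b s \<omega>)) \<partial>M)
        = measure M B * (if a = b then u - s else 0)"
begin

abbreviation "\<Delta> a s u \<omega> \<equiv> \<beta> a u \<omega> - \<beta> a s \<omega>"

definition bounded_at :: "real \<Rightarrow> ('w \<Rightarrow> real) \<Rightarrow> bool" where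
  "bounded_at s X \<longleftrightarrow> X \<in> borel_measurable (F s) \<and> (\<exists>C. \<forall>\<omega>\<in>space M. \<bar>X \<omega>\<bar> \<le> C)"

lemma F_measurable: "X \<in> borel_measurable (F s) \<Longrightarrow> X \<in> borel_measurable M"
  by (rule measurable_from_subalg[OF subalg])

lemma F_measurable_mono: "X \<in> borel_measurable (F s) \<Longrightarrow> s \<le> u \<Longrightarrow> X \<in> borel_measurable (F u)"
  by (rule measurable_from_subalg[of "F u" "F s"]) (use subalg mono in \<open>auto simp: subalgebra_def\<close>)

lemma bounded_at_measurable: "bounded_at s X \<Longrightarrow> X \<in> borel_measurable M"
  by (auto simp: bounded_at_def F_measurable)

lemma bounded_at_mono: "bounded_at s X \<Longrightarrow> s \<le> u \<Longrightarrow> bounded_at u X"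
  by (auto simp: bounded_at_def F_measurable_mono)

lemma bounded_at_mult:
  assumes "bounded_at s X" "bounded_at s Y"
  shows "bounded_at s (\<lambda>\<omega>. X \<omega> * Y \<omega>)"
proof -
  obtain C D where CD: "\<forall>\<omega>\<in>space M. \<bar>X \<omega>\<bar> \<le> C" "\<forall>\<omega>\<in>space M. \<bar>Y \<omega>\<bar> \<le> D"
    and m [measurable]: "X \<in> borel_measurable (F s)" "Y \<in> borel_measurable (F s)"
    using assms by (auto simp: bounded_at_def)
  have "\<bar>X \<omega> * Y \<omega>\<bar> \<le> \<bar>C\<bar> * \<bar>D\<bar>" if "\<omega> \<in> space M" for \<omega>
    unfolding abs_mult using that CD by (intro mult_mono) force+
  then show ?thesis unfolding bounded_at_def by (intro conjI exI[of _ "\<bar>C\<bar> * \<bar>D\<bar>"]) auto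
qed

lemma integrable_bounded_mult:
  assumes X: "bounded_at s X" and Y: "integrable M Y"
  shows "integrable M (\<lambda>\<omega>. X \<omega> * Y \<omega>)"
proof -
  obtain C where C: "\<forall>\<omega>\<in>space M. \<bar>X \<omega>\<bar> \<le> C" using X by (auto simp: bounded_at_def)
  note [measurable] = bounded_at_measurable[OF X] borel_measurable_integrable[OF Y]
  show ?thesis
  proof (rule Bochner_Integration.integrable_bound)
    show "integrable M (\<lambda>\<omega>. C * Y \<omega>)" using Y by simp
    show "AE \<omega> in M. norm (X \<omega> * Y \<omega>) \<le> norm (C * Y \<omega>)"
      using C by (intro AE_I2) (fastforce simp: abs_mult intro!: mult_right_mono)
  qed measurable
qed

lemma integrable_bounded: "bounded_at s X \<Longrightarrow> integrable M X"
  using integrable_bounded_mult[of s X "\<lambda>_. 1"] by simp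

lemma increment_measurable:
  assumes "0 \<le> s" "s \<le> u" "u \<le> T" shows "\<Delta> a s u \<in> borel_measurable (F u)"
proof -
  have [measurable]: "\<beta> a u \<in> borel_measurable (F u)" "\<beta> a s \<in> borel_measurable (F u)"
    using assms adapted[of u a] F_measurable_mono[OF adapted[of s a], of u] by auto
  show ?thesis by measurable
qed

lemma increments_integrable:
  assumes "0 \<le> s" "s \<le> u" "u \<le> T" "0 \<le> s'" "s' \<le> u'" "u' \<le> T"
  shows "integrable M (\<lambda>\<omega>. \<Delta> a s u \<omega> * \<Delta> b s' u' \<omega>)"
proof -
  have sq: "integrable M (\<lambda>\<omega>. \<Delta> a s u \<omega> * \<Delta> a s u \<omega>)" if "0 \<le> s" "s \<le> u" "u \<le> T" for a s u
    using that increment_prod_integrable[of s u a a] by (cases "s = u") auto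
  have [measurable]: "\<Delta> a s u \<in> borel_measurable M" if "0 \<le> s" "s \<le> u" "u \<le> T" for a s u
    using that F_measurable[OF increment_measurable] by blast
  show ?thesis
  proof (rule Bochner_Integration.integrable_bound)
    show "integrable M (\<lambda>\<omega>. \<Delta> a s u \<omega> * \<Delta> a s u \<omega> + \<Delta> b s' u' \<omega> * \<Delta> b s' u' \<omega>)"
      using sq assms by simp
    have "\<bar>x * y\<bar> \<le> \<bar>x * x + y * y\<bar>" for x y :: real
      using sum_squares_bound[of "\<bar>x\<bar>" "\<bar>y\<bar>"] zero_le_square[of x] zero_le_square[of y]
      unfolding abs_mult power2_eq_square abs_mult_self_eq by linarith
    then show "AE \<omega> in M. norm (\<Delta> a s u \<omega> * \<Delta> b s' u' \<omega>)
        \<le> norm (\<Delta> a s u \<omega> * \<Delta> a s u \<omega> + \<Delta> b s' u' \<omega> * \<Delta> b s' u' \<omega>)"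
      unfolding real_norm_def by (intro AE_I2)
    have "\<Delta> a s u \<in> borel_measurable M" "\<Delta> b s' u' \<in> borel_measurable M"
      using assms F_measurable[OF increment_measurable] by blast+
    then show "(\<lambda>\<omega>. \<Delta> a s u \<omega> * \<Delta> b s' u' \<omega>) \<in> borel_measurable M" by (rule borel_measurable_times)
  qed
qed

text \<open>
  The last hypothesis identifies the conditional expectation of \<open>f\<close> given \<open>F s\<close> with the constant \<open>c\<close>.
\<close>

lemma expectation_past_mult:
  assumes X: "X \<in> borel_measurable (F s)" and f: "integrable M f" and Xf: "integrable M (\<lambda>\<omega>. X \<omega> * f \<omega>)"
    and B: "\<And>B. B \<in> sets (F s) \<Longrightarrow> (\<integral>\<omega>. indicator B \<omega> * f \<omega> \<partial>M) = measure M B * c"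
  shows "(\<integral>\<omega>. X \<omega> * f \<omega> \<partial>M) = c * (\<integral>\<omega>. X \<omega> \<partial>M)"
proof -
  interpret S: finite_measure_subalgebra M "F s" by standard (rule subalg)
  have "AE \<omega> in M. real_cond_exp M (F s) f \<omega> = c"
  proof (rule S.real_cond_exp_charact[OF _ f])
    fix A assume A: "A \<in> sets (F s)"
    then have "A \<in> sets M" using subalg[of s] by (auto simp: subalgebra_def)
    then show "(\<integral>x\<in>A. f x \<partial>M) = (\<integral>x\<in>A. c \<partial>M)"
      using B[OF A] by (simp add: set_lebesgue_integral_def)
  qed auto
  note [measurable] = borel_measurable_integrable[OF f] F_measurable[OF X]
  have "(\<integral>\<omega>. X \<omega> * f \<omega> \<partial>M) = (\<integral>\<omega>. X \<omega> * real_cond_exp M (F s) f \<omega> \<partial>M)"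
    by (rule S.real_cond_exp_intg(2)[symmetric, OF Xf X]) measurable
  also have "\<dots> = (\<integral>\<omega>. X \<omega> * c \<partial>M)"
    by (rule integral_cong_AE) (use \<open>AE \<omega> in M. real_cond_exp M (F s) f \<omega> = c\<close> in auto)
  finally show ?thesis by simp
qed

lemma expectation_mult_increment:
  assumes "0 \<le> s" "s \<le> u" "u \<le> T" and X: "X \<in> borel_measurable (F s)"
    and int: "integrable M (\<lambda>\<omega>. X \<omega> * \<Delta> a s u \<omega>)"
  shows "(\<integral>\<omega>. X \<omega> * \<Delta> a s u \<omega> \<partial>M) = 0"
proof (cases "s = u")
  case False
  then show ?thesis
    using assms expectation_past_mult[OF X _ int, of 0] increment_integrable increment_mean by auto
qed simp

lemma expectation_mult_increments:
  assumes "0 \<le> s" "s \<le> u" "u \<le> T" and X: "bounded_at s X"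
  shows "(\<integral>\<omega>. X \<omega> * (\<Delta> a s u \<omega> * \<Delta> b s u \<omega>) \<partial>M) = (if a = b then u - s else 0) * (\<integral>\<omega>. X \<omega> \<partial>M)"
proof (cases "s = u")
  case False
  have i: "integrable M (\<lambda>\<omega>. \<Delta> a s u \<omega> * \<Delta> b s u \<omega>)" using assms by (intro increments_integrable)
  have m: "X \<in> borel_measurable (F s)" using X by (simp add: bounded_at_def)
  show ?thesis
    by (rule expectation_past_mult[OF m i integrable_bounded_mult[OF X i] increment_covariance])
       (use False assms in auto)
qed simp

text \<open>
  Cut both increments at \<open>s'\<close> and at \<open>w = min u u'\<close>. The two pieces over the common interval \<open>(s', w]\<close>
  give the covariance. Every other product contains an increment multiplied by factors that are
  known at its left end, or an increment of length zero.
\<close>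

lemma expectation_mult_two_increments_le:
  assumes s: "0 \<le> s" "s \<le> s'" and u: "s \<le> u" "u \<le> T" and u': "s' \<le> u'" "u' \<le> T"
    and X: "bounded_at s X" and X': "bounded_at s' X'"
  shows "(\<integral>\<omega>. X \<omega> * X' \<omega> * (\<Delta> a s u \<omega> * \<Delta> b s' u' \<omega>) \<partial>M)
    = (if a = b then max 0 (min u u' - s') else 0) * (\<integral>\<omega>. X \<omega> * X' \<omega> \<partial>M)"
proof -
  have Y: "bounded_at s' (\<lambda>\<omega>. X \<omega> * X' \<omega>)"
    using X X' s by (intro bounded_at_mult bounded_at_mono[OF X])
  have int: "integrable M (\<lambda>\<omega>. X \<omega> * X' \<omega> * (\<Delta> c p q \<omega> * \<Delta> e p' q' \<omega>))"
    if "0 \<le> p" "p \<le> q" "q \<le> T" "0 \<le> p'" "p' \<le> q'" "q' \<le> T" for c e p q p' q'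
    using that by (intro integrable_bounded_mult[OF Y] increments_integrable)
  have past: "(\<integral>\<omega>. X \<omega> * X' \<omega> * (\<Delta> c p q \<omega> * \<Delta> e p' q' \<omega>) \<partial>M) = 0"
    if "0 \<le> p" "p \<le> q" "q \<le> p'" "s' \<le> p'" "p' \<le> q'" "q' \<le> T" for c e p q p' q'
  proof -
    have [measurable]: "(\<lambda>\<omega>. X \<omega> * X' \<omega>) \<in> borel_measurable (F p')" "\<Delta> c p q \<in> borel_measurable (F p')"
      using that bounded_at_mono[OF Y, of p'] F_measurable_mono[OF increment_measurable[of p q c], of p']
      by (auto simp: bounded_at_def)
    have m: "(\<lambda>\<omega>. X \<omega> * X' \<omega> * \<Delta> c p q \<omega>) \<in> borel_measurable (F p')"
      by measurable
    have "(\<integral>\<omega>. (X \<omega> * X' \<omega> * \<Delta> c p q \<omega>) * \<Delta> e p' q' \<omega> \<partial>M) = 0"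
      using int[of p q p' q' c e] that s
      by (intro expectation_mult_increment[OF _ _ _ m]) (simp_all add: mult.assoc)
    then show ?thesis by (simp add: mult.assoc)
  qed
  show ?thesis
  proof (cases "u \<le> s'")
    case True
    then show ?thesis using past[of s u s' u' a b] s u u' by auto
  next
    case False
    define w where "w = min u u'"
    have w: "s' \<le> w" "w \<le> u" "w \<le> u'" "w = u \<or> w = u'" using False u' by (auto simp: w_def)
    have "(\<integral>\<omega>. X \<omega> * X' \<omega> * (\<Delta> a s u \<omega> * \<Delta> b s' u' \<omega>) \<partial>M)
      = (\<integral>\<omega>. X \<omega> * X' \<omega> * (\<Delta> a s s' \<omega> * \<Delta> b s' u' \<omega>) + (X \<omega> * X' \<omega> * (\<Delta> a s' w \<omega> * \<Delta> b s' w \<omega>)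
          + (X \<omega> * X' \<omega> * (\<Delta> a s' w \<omega> * \<Delta> b w u' \<omega>) + X \<omega> * X' \<omega> * (\<Delta> b s' w \<omega> * \<Delta> a w u \<omega>))) \<partial>M)"
      using w(4) by (intro Bochner_Integration.integral_cong) (auto simp: algebra_simps)
    also have "\<dots> = (\<integral>\<omega>. X \<omega> * X' \<omega> * (\<Delta> a s s' \<omega> * \<Delta> b s' u' \<omega>) \<partial>M) + ((\<integral>\<omega>. X \<omega> * X' \<omega> * (\<Delta> a s' w \<omega> * \<Delta> b s' w \<omega>) \<partial>M)
          + ((\<integral>\<omega>. X \<omega> * X' \<omega> * (\<Delta> a s' w \<omega> * \<Delta> b w u' \<omega>) \<partial>M) + (\<integral>\<omega>. X \<omega> * X' \<omega> * (\<Delta> b s' w \<omega> * \<Delta> a w u \<omega>) \<partial>M)))"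
      using s u u' w False by (subst Bochner_Integration.integral_add; (intro Bochner_Integration.integrable_add int)?; simp)+
    also have "\<dots> = (\<integral>\<omega>. X \<omega> * X' \<omega> * (\<Delta> a s' w \<omega> * \<Delta> b s' w \<omega>) \<partial>M)"
      using s u u' w False by (simp add: past)
    also have "\<dots> = (if a = b then w - s' else 0) * (\<integral>\<omega>. X \<omega> * X' \<omega> \<partial>M)"
      using s u u' w by (intro expectation_mult_increments Y) auto
    finally show ?thesis using w by (simp add: w_def)
  qed
qed

text \<open>
  The two intervals are in general position, so simple integrands given on different partitions can
  be multiplied without passing to a common refinement.
\<close>

lemma expectation_mult_two_increments:
  assumes t: "0 \<le> t" and s: "t \<le> s" "s \<le> u" "u \<le> T" and s': "t \<le> s'" "s' \<le> u'" "u' \<le> T"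
    and V: "bounded_at t V" and X: "bounded_at s X" and X': "bounded_at s' X'"
  shows "(\<integral>\<omega>. V \<omega> * (X \<omega> * X' \<omega>) * (\<Delta> a s u \<omega> * \<Delta> b s' u' \<omega>) \<partial>M)
    = (if a = b then max 0 (min u u' - max s s') else 0) * (\<integral>\<omega>. V \<omega> * (X \<omega> * X' \<omega>) \<partial>M)"
proof (cases "s \<le> s'")
  case True
  have "bounded_at s (\<lambda>\<omega>. V \<omega> * X \<omega>)" using s by (intro bounded_at_mult bounded_at_mono[OF V] X)
  from expectation_mult_two_increments_le[OF _ True _ _ _ _ this X', of u u' a b]
  show ?thesis using t s s' True by (simp add: mult.assoc max_absorb2)
next
  case False
  have "bounded_at s' (\<lambda>\<omega>. V \<omega> * X' \<omega>)" using s' by (intro bounded_at_mult bounded_at_mono[OF V] X')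
  from expectation_mult_two_increments_le[OF _ _ _ _ _ _ this X, of u' u b a]
  show ?thesis using t s s' False by (simp add: mult_ac max_absorb1 min.commute eq_commute[of b a])
qed

text \<open>
  Expand the square: the terms linear in the increments have mean zero, and the product of two
  increments contributes the length of the overlap of their intervals.
\<close>

lemma energy_identity:
  fixes E :: "'e set"
  assumes t: "0 \<le> t"
    and e: "\<And>e. e \<in> E \<Longrightarrow> t \<le> s e \<and> s e \<le> u e \<and> u e \<le> T"
    and c: "\<And>e. e \<in> E \<Longrightarrow> bounded_at (s e) (c e)"
    and V: "bounded_at t V" and X: "bounded_at t X"
  shows "integrable M (\<lambda>\<omega>. V \<omega> * (X \<omega> + (\<Sum>e\<in>E. c e \<omega> * \<Delta> (a e) (s e) (u e) \<omega>))\<^sup>2)"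
    and "integrable M (\<lambda>\<omega>. V \<omega> * (X \<omega>)\<^sup>2 + V \<omega> * (\<Sum>e\<in>E. \<Sum>e'\<in>E.
           (if a e = a e' then max 0 (min (u e) (u e') - max (s e) (s e')) else 0) * (c e \<omega> * c e' \<omega>)))"
    and "(\<integral>\<omega>. V \<omega> * (X \<omega> + (\<Sum>e\<in>E. c e \<omega> * \<Delta> (a e) (s e) (u e) \<omega>))\<^sup>2 \<partial>M)
      = (\<integral>\<omega>. V \<omega> * (X \<omega>)\<^sup>2 + V \<omega> * (\<Sum>e\<in>E. \<Sum>e'\<in>E.
           (if a e = a e' then max 0 (min (u e) (u e') - max (s e) (s e')) else 0) * (c e \<omega> * c e' \<omega>)) \<partial>M)"
proof -
  let ?D = "\<lambda>e \<omega>. \<Delta> (a e) (s e) (u e) \<omega>"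
  let ?o = "\<lambda>e e'. if a e = a e' then max 0 (min (u e) (u e') - max (s e) (s e')) else 0"
  have V1: "bounded_at t (\<lambda>\<omega>. V \<omega> * X \<omega>)" "bounded_at t (\<lambda>\<omega>. V \<omega> * X \<omega> * X \<omega>)"
    by (intro bounded_at_mult V X)+
  have i0 [simp]: "integrable M (\<lambda>\<omega>. V \<omega> * (X \<omega>)\<^sup>2)"
    using integrable_bounded[OF V1(2)] by (simp add: power2_eq_square mult.assoc)
  have D_int: "integrable M (?D e)" if "e \<in> E" for e
    using increment_integrable[of "s e" "u e" "a e"] e[OF that] t by (cases "s e = u e") auto
  have Vc: "bounded_at (s e) (\<lambda>\<omega>. V \<omega> * X \<omega> * c e \<omega>)" if "e \<in> E" for e
    using e[OF that] by (intro bounded_at_mult c that bounded_at_mono[OF V] bounded_at_mono[OF X]) auto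
  have i1 [simp]: "integrable M (\<lambda>\<omega>. V \<omega> * X \<omega> * c e \<omega> * ?D e \<omega>)" if "e \<in> E" for e
    by (rule integrable_bounded_mult[OF Vc[OF that] D_int[OF that]])
  have z1: "(\<integral>\<omega>. V \<omega> * X \<omega> * c e \<omega> * ?D e \<omega> \<partial>M) = 0" if "e \<in> E" for e
    using e[OF that] t Vc[OF that] by (intro expectation_mult_increment i1 that) (auto simp: bounded_at_def)
  have Vcc: "bounded_at (max (s e) (s e')) (\<lambda>\<omega>. V \<omega> * (c e \<omega> * c e' \<omega>))" if "e \<in> E" "e' \<in> E" for e e'
    using e[OF that(1)] e[OF that(2)]
    by (intro bounded_at_mult bounded_at_mono[OF V] bounded_at_mono[OF c[OF that(1)]] bounded_at_mono[OF c[OF that(2)]]) auto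
  have i2 [simp]: "integrable M (\<lambda>\<omega>. V \<omega> * (c e \<omega> * c e' \<omega>) * (?D e \<omega> * ?D e' \<omega>))" if "e \<in> E" "e' \<in> E" for e e'
    by (rule integrable_bounded_mult[OF Vcc[OF that] increments_integrable])
       (use e[OF that(1)] e[OF that(2)] t in auto)
  have i3 [simp]: "integrable M (\<lambda>\<omega>. V \<omega> * (c e \<omega> * c e' \<omega>))" if "e \<in> E" "e' \<in> E" for e e'
    by (rule integrable_bounded[OF Vcc[OF that]])
  have z2: "(\<integral>\<omega>. V \<omega> * (c e \<omega> * c e' \<omega>) * (?D e \<omega> * ?D e' \<omega>) \<partial>M) = ?o e e' * (\<integral>\<omega>. V \<omega> * (c e \<omega> * c e' \<omega>) \<partial>M)"
    if "e \<in> E" "e' \<in> E" for e e'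
    by (rule expectation_mult_two_increments[OF t _ _ _ _ _ _ V c[OF that(1)] c[OF that(2)]])
       (use e[OF that(1)] e[OF that(2)] in auto)
  have expand: "V \<omega> * (X \<omega> + (\<Sum>e\<in>E. c e \<omega> * ?D e \<omega>))\<^sup>2 = V \<omega> * (X \<omega>)\<^sup>2 + (2 * (\<Sum>e\<in>E. V \<omega> * X \<omega> * c e \<omega> * ?D e \<omega>)
     + (\<Sum>e\<in>E. \<Sum>e'\<in>E. V \<omega> * (c e \<omega> * c e' \<omega>) * (?D e \<omega> * ?D e' \<omega>)))" for \<omega>
  proof -
    have "(\<Sum>e\<in>E. c e \<omega> * ?D e \<omega>) * (\<Sum>e\<in>E. c e \<omega> * ?D e \<omega>)
        = (\<Sum>e\<in>E. \<Sum>e'\<in>E. (c e \<omega> * c e' \<omega>) * (?D e \<omega> * ?D e' \<omega>))"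
      unfolding sum_product by (intro sum.cong refl) (simp only: mult_ac)
    then have "V \<omega> * (X \<omega> + (\<Sum>e\<in>E. c e \<omega> * ?D e \<omega>))\<^sup>2 = V \<omega> * (X \<omega>)\<^sup>2 + (2 * (V \<omega> * X \<omega> * (\<Sum>e\<in>E. c e \<omega> * ?D e \<omega>))
       + V \<omega> * (\<Sum>e\<in>E. \<Sum>e'\<in>E. (c e \<omega> * c e' \<omega>) * (?D e \<omega> * ?D e' \<omega>)))"
      by (simp add: power2_eq_square algebra_simps)
    then show ?thesis by (simp only: sum_distrib_left mult.assoc)
  qed
  show "integrable M (\<lambda>\<omega>. V \<omega> * (X \<omega> + (\<Sum>e\<in>E. c e \<omega> * ?D e \<omega>))\<^sup>2)"
    unfolding expand by (intro Bochner_Integration.integrable_add integrable_mult_right Bochner_Integration.integrable_sum i0 i1 i2)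
  have "(\<integral>\<omega>. V \<omega> * (X \<omega> + (\<Sum>e\<in>E. c e \<omega> * ?D e \<omega>))\<^sup>2 \<partial>M)
    = (\<integral>\<omega>. V \<omega> * (X \<omega>)\<^sup>2 \<partial>M) + (2 * (\<Sum>e\<in>E. \<integral>\<omega>. V \<omega> * X \<omega> * c e \<omega> * ?D e \<omega> \<partial>M)
       + (\<Sum>e\<in>E. \<Sum>e'\<in>E. \<integral>\<omega>. V \<omega> * (c e \<omega> * c e' \<omega>) * (?D e \<omega> * ?D e' \<omega>) \<partial>M))"
    unfolding expand
    by (subst Bochner_Integration.integral_add Bochner_Integration.integral_sum integral_mult_right;
        (intro Bochner_Integration.integrable_add integrable_mult_right Bochner_Integration.integrable_sum i0 i1 i2)?; simp)+
  also have "\<dots> = (\<integral>\<omega>. V \<omega> * (X \<omega>)\<^sup>2 \<partial>M) + (\<Sum>e\<in>E. \<Sum>e'\<in>E. ?o e e' * (\<integral>\<omega>. V \<omega> * (c e \<omega> * c e' \<omega>) \<partial>M))"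
    by (simp add: z1 z2)
  also have "\<dots> = (\<integral>\<omega>. V \<omega> * (X \<omega>)\<^sup>2 + (\<Sum>e\<in>E. \<Sum>e'\<in>E. ?o e e' * (V \<omega> * (c e \<omega> * c e' \<omega>))) \<partial>M)"
    by (simp add: Bochner_Integration.integral_add Bochner_Integration.integral_sum)
  finally show "(\<integral>\<omega>. V \<omega> * (X \<omega> + (\<Sum>e\<in>E. c e \<omega> * ?D e \<omega>))\<^sup>2 \<partial>M)
      = (\<integral>\<omega>. V \<omega> * (X \<omega>)\<^sup>2 + V \<omega> * (\<Sum>e\<in>E. \<Sum>e'\<in>E. ?o e e' * (c e \<omega> * c e' \<omega>)) \<partial>M)"
    by (simp only: sum_distrib_left mult_ac)
  have "integrable M (\<lambda>\<omega>. V \<omega> * (X \<omega>)\<^sup>2 + (\<Sum>e\<in>E. \<Sum>e'\<in>E. ?o e e' * (V \<omega> * (c e \<omega> * c e' \<omega>))))"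
    by (intro Bochner_Integration.integrable_add integrable_mult_right Bochner_Integration.integrable_sum i0 i3)
  then show "integrable M (\<lambda>\<omega>. V \<omega> * (X \<omega>)\<^sup>2 + V \<omega> * (\<Sum>e\<in>E. \<Sum>e'\<in>E. ?o e e' * (c e \<omega> * c e' \<omega>)))"
    by (simp only: sum_distrib_left mult_ac)
qed

end

text \<open>
  The overlap lengths in the energy identity are the inner products in \<open>L\<^sup>2(dt)\<close> of the indicator
  functions of the intervals, so the double sum there is the energy of a step function.
\<close>

lemma integral_step_square:
  fixes E :: "'e set" and k s u :: "'e \<Rightarrow> real"
  shows "integrable lborel (\<lambda>r. (\<Sum>e\<in>E. k e * indicator {s e<..u e} r)\<^sup>2)"
    "(\<integral>r. (\<Sum>e\<in>E. k e * indicator {s e<..u e} r)\<^sup>2 \<partial>lborel)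
      = (\<Sum>e\<in>E. \<Sum>e'\<in>E. max 0 (min (u e) (u e') - max (s e) (s e')) * (k e * k e'))"
proof -
  have sq: "(\<Sum>e\<in>E. k e * indicator {s e<..u e} r)\<^sup>2
      = (\<Sum>e\<in>E. \<Sum>e'\<in>E. (k e * k e') * indicator {max (s e) (s e')<..min (u e) (u e')} r)" for r
    unfolding power2_eq_square sum_product by (intro sum.cong refl) (auto simp: indicator_def)
  have i: "integrable lborel (\<lambda>r. (k e * k e') * indicator {x<..y} r)" for e e' and x y :: real
  proof (intro integrable_mult_right integrable_real_indicator)
    show "emeasure lborel {x<..y} < \<infinity>" by (cases "x \<le> y") auto
  qed simp
  have v: "(\<integral>r. indicator {x<..y} r \<partial>lborel) = max 0 (y - x)" for x y :: real
    by (cases "x \<le> y") auto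
  show "integrable lborel (\<lambda>r. (\<Sum>e\<in>E. k e * indicator {s e<..u e} r)\<^sup>2)"
    unfolding sq by (intro Bochner_Integration.integrable_sum i)
  show "(\<integral>r. (\<Sum>e\<in>E. k e * indicator {s e<..u e} r)\<^sup>2 \<partial>lborel)
      = (\<Sum>e\<in>E. \<Sum>e'\<in>E. max 0 (min (u e) (u e') - max (s e) (s e')) * (k e * k e'))"
  proof -
    have "(\<integral>r. (\<Sum>e\<in>E. k e * indicator {s e<..u e} r)\<^sup>2 \<partial>lborel)
      = (\<Sum>e\<in>E. \<Sum>e'\<in>E. \<integral>r. (k e * k e') * indicator {max (s e) (s e')<..min (u e) (u e')} r \<partial>lborel)"
      unfolding sq using i by (subst Bochner_Integration.integral_sum; (intro Bochner_Integration.integrable_sum i)?; simp)+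
    then show ?thesis by (simp only: integral_mult_right_zero v)  (simp only: mult.commute)
  qed
qed

section \<open>The energy identity for matrix-valued simple integrands\<close>

lemma norm_vec_squared: "(norm x)\<^sup>2 = (\<Sum>i\<in>UNIV. (norm (x $ i))\<^sup>2)" for x :: "'a::real_normed_vector^'n::finite"
  by (simp add: norm_vec_def L2_set_def sum_nonneg)

lemma sum_UNIV_Plus:
  fixes f :: "'i::finite + 'j::finite \<Rightarrow> 'c::comm_monoid_add"
  shows "(\<Sum>a\<in>UNIV. f a) = (\<Sum>i\<in>UNIV. f (Inl i)) + (\<Sum>j\<in>UNIV. f (Inr j))"
  unfolding UNIV_Plus_UNIV[symmetric] by (subst sum.Plus) auto

definition clamp :: "real \<Rightarrow> real \<Rightarrow> real \<Rightarrow> real" where "clamp t b x = max t (min b x)"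

text \<open>
  The increment over \<open>[t,b]\<close> of an elementary integral is the elementary sum over the partition points
  moved into \<open>[t,b]\<close>.
\<close>

lemma simple_integral_increment:
  assumes "t \<le> b"
  shows "simple_integral W n \<tau> h b \<omega> - simple_integral W n \<tau> h t \<omega>
    = (\<Sum>i<n. h i \<omega> *v (W (clamp t b (\<tau> (Suc i))) \<omega> - W (clamp t b (\<tau> i)) \<omega>))"
proof -
  have "W (min x b) \<omega> - W (min x t) \<omega> = W (clamp t b x) \<omega> - W t \<omega>" for x
  proof (cases "x \<le> t")
    case True
    then have "min x b = x" "min x t = x" "clamp t b x = t" using assms by (auto simp: clamp_def)
    then show ?thesis by simp
  next
    case False
    then have "min x t = t" "clamp t b x = min x b" using assms by (auto simp: clamp_def)
    then show ?thesis by simp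
  qed
  then have *: "W (min x b) \<omega> - W (min y b) \<omega> - (W (min x t) \<omega> - W (min y t) \<omega>)
      = W (clamp t b x) \<omega> - W (clamp t b y) \<omega>" for x y
    by (smt (verit) add_diff_cancel_left' diff_add_cancel diff_diff_add diff_diff_eq2 add.commute)
  show ?thesis
    unfolding simple_integral_def by (simp add: sum_subtractf[symmetric] matrix_vector_mult_diff_distrib[symmetric] *)
qed

lemma (in brownian_family) bounded_atI:
  "X \<in> borel_measurable (F s) \<Longrightarrow> (\<And>\<omega>. \<omega> \<in> space M \<Longrightarrow> \<bar>X \<omega>\<bar> \<le> C) \<Longrightarrow> bounded_at s X"
  unfolding bounded_at_def by blast

context common_noise_brownian
begin

sublocale BF: brownian_family M F T coord
  using subalgebra_F F_mono coord_adapted coord_moments coord_increment by unfold_locales auto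

text \<open>
  The scalar energy identity is applied in each row, to the family of all pairs \<open>(a, i)\<close> of a noise
  coordinate \<open>a\<close> and a partition interval number \<open>i\<close> of the integrand belonging to that noise.
\<close>

lemma simple_integral_energy:
  fixes h h0 :: "nat \<Rightarrow> 'a \<times> 'b \<Rightarrow> real^'d^'m::finite" and X :: "'a \<times> 'b \<Rightarrow> real^'m"
  assumes H: "simple_integrand F T n \<tau> h" and H0: "simple_integrand F T n0 \<tau>0 h0"
    and t: "0 \<le> t" "t \<le> b" "b \<le> T"
    and V: "BF.bounded_at t V" "\<And>\<omega>. 0 \<le> V \<omega>"
    and X: "X \<in> borel_measurable (F t)" "\<And>\<omega>. \<omega> \<in> space M \<Longrightarrow> norm (X \<omega>) \<le> C"
  defines "I \<equiv> simple_integral (\<lambda>t \<omega>. W t (snd \<omega>)) n \<tau> h"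
    and "I0 \<equiv> simple_integral (\<lambda>t \<omega>. W0 t (fst \<omega>)) n0 \<tau>0 h0"
  shows "(\<integral>\<^sup>+\<omega>. ennreal (V \<omega>) * (ennreal ((norm (X \<omega>))\<^sup>2) +
      (\<integral>\<^sup>+s\<in>{t..b}. ennreal ((norm (simple_process n \<tau> h s \<omega>))\<^sup>2) + ennreal ((norm (simple_process n0 \<tau>0 h0 s \<omega>))\<^sup>2) \<partial>lborel)) \<partial>M)
    = (\<integral>\<^sup>+\<omega>. ennreal (V \<omega>) * ennreal ((norm (X \<omega> + (I b \<omega> - I t \<omega>) + (I0 b \<omega> - I0 t \<omega>)))\<^sup>2) \<partial>M)"
proof -
  define N where "N = case_sum (\<lambda>_::'d. n0) (\<lambda>_::'d. n)"
  define \<theta> where "\<theta> = case_sum (\<lambda>_::'d. \<tau>0) (\<lambda>_::'d. \<tau>)"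
  define E where "E = (SIGMA a:UNIV. {..<N a})"
  define s where "s = (\<lambda>(a, i). clamp t b (\<theta> a i))"
  define u where "u = (\<lambda>(a, i). clamp t b (\<theta> a (Suc i)))"
  define k where "k = (\<lambda>r (a, i) \<omega>. case a of Inl j \<Rightarrow> h0 i \<omega> $ r $ j | Inr j \<Rightarrow> h i \<omega> $ r $ j)"
  \<comment> \<open>An interval outside \<open>[t,b]\<close> becomes empty. Its coefficient need not be known at the moved left end
    and is replaced by \<open>0\<close>, which does not change the sum.\<close>
  define c where "c = (\<lambda>r e \<omega>. if s e < u e then k r e \<omega> else (0::real))"
  have EN: "N (fst e) > snd e" if "e \<in> E" for e using that by (auto simp: E_def)
  have Esum: "(\<Sum>e\<in>E. f e) = (\<Sum>a\<in>UNIV. \<Sum>i<N a. f (a, i))" for f :: "('d + 'd) \<times> nat \<Rightarrow> real"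
    unfolding E_def by (subst sum.Sigma) auto
  have su: "t \<le> s e \<and> s e \<le> u e \<and> u e \<le> T" if "e \<in> E" for e
  proof -
    have "\<theta> (fst e) (snd e) < \<theta> (fst e) (Suc (snd e))"
      using EN[OF that] H H0 by (cases "fst e") (auto simp: \<theta>_def N_def simple_integrand_def)
    then show ?thesis using t by (auto simp: s_def u_def clamp_def split: prod.splits)
  qed
  have c: "BF.bounded_at (s e) (c r e)" if "e \<in> E" for e r
  proof (cases "s e < u e")
    case False
    then show ?thesis by (simp add: c_def BF.bounded_at_def exI[of _ 0])
  next
    case True
    obtain a i where ei: "e = (a, i)" by (cases e)
    have \<theta>s: "\<theta> a i \<le> s e" using True by (auto simp: ei s_def u_def clamp_def split: if_splits)
    have "BF.bounded_at (\<theta> a i) (k r e)"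
    proof (cases a)
      case (Inl j)
      have i: "i < n0" using EN[OF that] by (simp add: ei Inl N_def)
      then obtain D where D: "h0 i \<in> borel_measurable (F (\<tau>0 i))" "\<And>\<omega>. \<omega> \<in> space M \<Longrightarrow> norm (h0 i \<omega>) \<le> D"
        using H0 i unfolding simple_integrand_def space_F by blast
      have k: "k r e = (\<lambda>\<omega>. h0 i \<omega> $ r $ j)" "\<theta> a i = \<tau>0 i"
        by (simp_all add: ei Inl k_def \<theta>_def fun_eq_iff)
      note [measurable] = D(1)
      have "\<bar>h0 i \<omega> $ r $ j\<bar> \<le> D" if "\<omega> \<in> space M" for \<omega>
        using D(2)[OF that] Finite_Cartesian_Product.norm_nth_le[of "h0 i \<omega>" r]
          Finite_Cartesian_Product.norm_nth_le[of "h0 i \<omega> $ r" j] by simp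
      then show ?thesis unfolding k by (intro BF.bounded_atI) measurable
    next
      case (Inr j)
      have i: "i < n" using EN[OF that] by (simp add: ei Inr N_def)
      then obtain D where D: "h i \<in> borel_measurable (F (\<tau> i))" "\<And>\<omega>. \<omega> \<in> space M \<Longrightarrow> norm (h i \<omega>) \<le> D"
        using H i unfolding simple_integrand_def space_F by blast
      have k: "k r e = (\<lambda>\<omega>. h i \<omega> $ r $ j)" "\<theta> a i = \<tau> i"
        by (simp_all add: ei Inr k_def \<theta>_def fun_eq_iff)
      note [measurable] = D(1)
      have "\<bar>h i \<omega> $ r $ j\<bar> \<le> D" if "\<omega> \<in> space M" for \<omega>
        using D(2)[OF that] Finite_Cartesian_Product.norm_nth_le[of "h i \<omega>" r]
          Finite_Cartesian_Product.norm_nth_le[of "h i \<omega> $ r" j] by simp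
      then show ?thesis unfolding k by (intro BF.bounded_atI) measurable
    qed
    then have "BF.bounded_at (s e) (k r e)" using \<theta>s by (rule BF.bounded_at_mono)
    then show ?thesis using True by (simp add: c_def[abs_def])
  qed
  have Xr: "BF.bounded_at t (\<lambda>\<omega>. X \<omega> $ r)" for r
  proof -
    note [measurable] = X(1)
    have "\<bar>X \<omega> $ r\<bar> \<le> C" if "\<omega> \<in> space M" for \<omega>
      using X(2)[OF that] Finite_Cartesian_Product.norm_nth_le[of "X \<omega>" r] by simp
    then show ?thesis by (intro BF.bounded_atI) measurable
  qed
  let ?D = "\<lambda>e \<omega>. coord (fst e) (u e) \<omega> - coord (fst e) (s e) \<omega>"
  have row: "(\<Sum>e\<in>E. c r e \<omega> * ?D e \<omega>) = (I b \<omega> - I t \<omega> + (I0 b \<omega> - I0 t \<omega>)) $ r" for r \<omega>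
  proof -
    have "(\<Sum>e\<in>E. c r e \<omega> * ?D e \<omega>) = (\<Sum>e\<in>E. k r e \<omega> * ?D e \<omega>)"
      using su by (intro sum.cong) (force simp: c_def)+
    also have "\<dots> = (\<Sum>j\<in>UNIV. \<Sum>i<n0. h0 i \<omega> $ r $ j * (W0 (clamp t b (\<tau>0 (Suc i))) (fst \<omega>) - W0 (clamp t b (\<tau>0 i)) (fst \<omega>)) $ j)
       + (\<Sum>j\<in>UNIV. \<Sum>i<n. h i \<omega> $ r $ j * (W (clamp t b (\<tau> (Suc i))) (snd \<omega>) - W (clamp t b (\<tau> i)) (snd \<omega>)) $ j)"
      unfolding Esum sum_UNIV_Plus by (simp add: k_def s_def u_def \<theta>_def N_def)
    also have "\<dots> = (I b \<omega> - I t \<omega> + (I0 b \<omega> - I0 t \<omega>)) $ r"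
      unfolding I_def I0_def simple_integral_increment[OF t(2)]
      by (simp add: matrix_vector_mult_def sum.swap[of _ UNIV])
    finally show ?thesis .
  qed
  define \<phi> where "\<phi> = (\<lambda>r a \<omega> x. \<Sum>i<N a. c r (a, i) \<omega> * indicator {s (a, i)<..u (a, i)} x)"
  define Q where "Q = (\<lambda>r \<omega>. \<Sum>e\<in>E. \<Sum>e'\<in>E.
     (if fst e = fst e' then max 0 (min (u e) (u e') - max (s e) (s e')) else 0) * (c r e \<omega> * c r e' \<omega>))"
  have Q: "Q r \<omega> = (\<Sum>a\<in>UNIV. \<integral>x. (\<phi> r a \<omega> x)\<^sup>2 \<partial>lborel)" for r \<omega>
  proof -
    have "(\<integral>x. (\<phi> r a \<omega> x)\<^sup>2 \<partial>lborel) = (\<Sum>i<N a. \<Sum>i'<N a.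
        max 0 (min (u (a, i)) (u (a, i')) - max (s (a, i)) (s (a, i'))) * (c r (a, i) \<omega> * c r (a, i') \<omega>))" for a
      unfolding \<phi>_def by (rule integral_step_square)
    moreover have "Q r \<omega> = (\<Sum>a\<in>UNIV. \<Sum>i<N a. \<Sum>i'<N a.
        max 0 (min (u (a, i)) (u (a, i')) - max (s (a, i)) (s (a, i'))) * (c r (a, i) \<omega> * c r (a, i') \<omega>))"
      unfolding Q_def Esum
    proof (intro sum.cong refl)
      fix a :: "'d + 'd" and i
      have "(\<Sum>a'\<in>UNIV. \<Sum>i'<N a'. (if fst (a, i) = fst (a', i') then max 0 (min (u (a, i)) (u (a', i')) - max (s (a, i)) (s (a', i'))) else 0) * (c r (a, i) \<omega> * c r (a', i') \<omega>))
         = (\<Sum>a'\<in>UNIV. if a' = a then (\<Sum>i'<N a. max 0 (min (u (a, i)) (u (a, i')) - max (s (a, i)) (s (a, i'))) * (c r (a, i) \<omega> * c r (a, i') \<omega>)) else 0)"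
        by (intro sum.cong) auto
      then show "(\<Sum>a'\<in>UNIV. \<Sum>i'<N a'. (if fst (a, i) = fst (a', i') then max 0 (min (u (a, i)) (u (a', i')) - max (s (a, i)) (s (a', i'))) else 0) * (c r (a, i) \<omega> * c r (a', i') \<omega>))
         = (\<Sum>i'<N a. max 0 (min (u (a, i)) (u (a, i')) - max (s (a, i)) (s (a, i'))) * (c r (a, i) \<omega> * c r (a, i') \<omega>))"
        by (simp add: sum.delta)
    qed
    ultimately show ?thesis by simp
  qed
  have \<phi>_int: "integrable lborel (\<lambda>x. (\<phi> r a \<omega> x)\<^sup>2)" for r a \<omega>
    unfolding \<phi>_def by (rule integral_step_square)
  have step: "c r (a, i) \<omega> * indicator {s (a, i)<..u (a, i)} x
     = (if t < x \<and> x \<le> b \<and> \<theta> a i < x \<and> x \<le> \<theta> a (Suc i) then k r (a, i) \<omega> else 0)" for r a i \<omega> x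
    using t by (auto simp: c_def s_def u_def clamp_def indicator_def)
  have \<phi>_sq: "(\<Sum>r\<in>UNIV. \<Sum>a\<in>UNIV. (\<phi> r a \<omega> x)\<^sup>2)
     = indicator {t<..b} x * ((norm (simple_process n \<tau> h x \<omega>))\<^sup>2 + (norm (simple_process n0 \<tau>0 h0 x \<omega>))\<^sup>2)" for \<omega> x
  proof -
    have "\<phi> r (Inl j) \<omega> x = indicator {t<..b} x * (simple_process n0 \<tau>0 h0 x \<omega> $ r $ j)" for r j
      unfolding \<phi>_def step simple_process_def by (auto simp: N_def \<theta>_def k_def indicator_def intro!: sum.cong)
    moreover have "\<phi> r (Inr j) \<omega> x = indicator {t<..b} x * (simple_process n \<tau> h x \<omega> $ r $ j)" for r j
      unfolding \<phi>_def step simple_process_def by (auto simp: N_def \<theta>_def k_def indicator_def intro!: sum.cong)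
    ultimately show ?thesis
      unfolding sum_UNIV_Plus norm_vec_squared real_norm_def power2_abs
      by (auto simp: indicator_def sum.distrib)
  qed
  have Q_nn: "ennreal (\<Sum>r\<in>UNIV. Q r \<omega>)
    = (\<integral>\<^sup>+x\<in>{t..b}. ennreal ((norm (simple_process n \<tau> h x \<omega>))\<^sup>2) + ennreal ((norm (simple_process n0 \<tau>0 h0 x \<omega>))\<^sup>2) \<partial>lborel)" for \<omega>
  proof -
    have "(\<Sum>r\<in>UNIV. Q r \<omega>) = (\<integral>x. (\<Sum>r\<in>UNIV. \<Sum>a\<in>UNIV. (\<phi> r a \<omega> x)\<^sup>2) \<partial>lborel)"
      unfolding Q using \<phi>_int by (simp add: Bochner_Integration.integral_sum Bochner_Integration.integrable_sum)
    then have "ennreal (\<Sum>r\<in>UNIV. Q r \<omega>) = (\<integral>\<^sup>+x. ennreal (\<Sum>r\<in>UNIV. \<Sum>a\<in>UNIV. (\<phi> r a \<omega> x)\<^sup>2) \<partial>lborel)"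
      using \<phi>_int by (simp only:) (intro nn_integral_eq_integral[symmetric] Bochner_Integration.integrable_sum AE_I2 sum_nonneg; simp)
    also have "\<dots> = (\<integral>\<^sup>+x\<in>{t..b}. ennreal ((norm (simple_process n \<tau> h x \<omega>))\<^sup>2) + ennreal ((norm (simple_process n0 \<tau>0 h0 x \<omega>))\<^sup>2) \<partial>lborel)"
      unfolding \<phi>_sq
    proof (rule nn_integral_cong_AE)
      show "AE x in lborel. ennreal (indicator {t<..b} x * ((norm (simple_process n \<tau> h x \<omega>))\<^sup>2 + (norm (simple_process n0 \<tau>0 h0 x \<omega>))\<^sup>2))
         = (ennreal ((norm (simple_process n \<tau> h x \<omega>))\<^sup>2) + ennreal ((norm (simple_process n0 \<tau>0 h0 x \<omega>))\<^sup>2)) * indicator {t..b} x"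
        using AE_lborel_singleton[of t] by eventually_elim (auto simp: indicator_def)
    qed
    finally show ?thesis .
  qed
  have en: "integrable M (\<lambda>\<omega>. V \<omega> * (X \<omega> $ r + (I b \<omega> - I t \<omega> + (I0 b \<omega> - I0 t \<omega>)) $ r)\<^sup>2)"
    "integrable M (\<lambda>\<omega>. V \<omega> * (X \<omega> $ r)\<^sup>2 + V \<omega> * Q r \<omega>)"
    "(\<integral>\<omega>. V \<omega> * (X \<omega> $ r + (I b \<omega> - I t \<omega> + (I0 b \<omega> - I0 t \<omega>)) $ r)\<^sup>2 \<partial>M)
      = (\<integral>\<omega>. V \<omega> * (X \<omega> $ r)\<^sup>2 + V \<omega> * Q r \<omega> \<partial>M)" for r
    using BF.energy_identity[OF t(1), where E = E and s = s and u = u and a = fst and V = V and c = "c r" and X = "\<lambda>\<omega>. X \<omega> $ r",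
      OF su c V(1) Xr] unfolding row Q_def by simp_all
  let ?S = "\<lambda>\<omega>. X \<omega> + (I b \<omega> - I t \<omega>) + (I0 b \<omega> - I0 t \<omega>)"
  have Snorm: "V \<omega> * (norm (?S \<omega>))\<^sup>2 = (\<Sum>r\<in>UNIV. V \<omega> * (X \<omega> $ r + (I b \<omega> - I t \<omega> + (I0 b \<omega> - I0 t \<omega>)) $ r)\<^sup>2)" for \<omega>
    by (simp add: norm_vec_squared sum_distrib_left add.assoc)
  have Xnorm: "V \<omega> * ((norm (X \<omega>))\<^sup>2 + (\<Sum>r\<in>UNIV. Q r \<omega>)) = (\<Sum>r\<in>UNIV. V \<omega> * (X \<omega> $ r)\<^sup>2 + V \<omega> * Q r \<omega>)" for \<omega>
    by (simp add: norm_vec_squared sum_distrib_left distrib_left sum.distrib)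
  have Q0: "0 \<le> Q r \<omega>" for r \<omega> unfolding Q by (intro sum_nonneg integral_nonneg_AE) auto
  have "(\<integral>\<^sup>+\<omega>. ennreal (V \<omega>) * (ennreal ((norm (X \<omega>))\<^sup>2) +
      (\<integral>\<^sup>+s\<in>{t..b}. ennreal ((norm (simple_process n \<tau> h s \<omega>))\<^sup>2) + ennreal ((norm (simple_process n0 \<tau>0 h0 s \<omega>))\<^sup>2) \<partial>lborel)) \<partial>M)
    = (\<integral>\<^sup>+\<omega>. ennreal (V \<omega> * ((norm (X \<omega>))\<^sup>2 + (\<Sum>r\<in>UNIV. Q r \<omega>))) \<partial>M)"
    unfolding Q_nn[symmetric] by (simp add: ennreal_mult V(2) Q0 sum_nonneg)
  also have "\<dots> = ennreal (\<integral>\<omega>. V \<omega> * ((norm (X \<omega>))\<^sup>2 + (\<Sum>r\<in>UNIV. Q r \<omega>)) \<partial>M)"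
    using en(2) V(2) Q0 unfolding Xnorm by (intro nn_integral_eq_integral) (auto intro!: sum_nonneg AE_I2)
  also have "(\<integral>\<omega>. V \<omega> * ((norm (X \<omega>))\<^sup>2 + (\<Sum>r\<in>UNIV. Q r \<omega>)) \<partial>M) = (\<integral>\<omega>. V \<omega> * (norm (?S \<omega>))\<^sup>2 \<partial>M)"
    unfolding Xnorm Snorm using en by (subst (1 2) Bochner_Integration.integral_sum) auto
  also have "ennreal \<dots> = (\<integral>\<^sup>+\<omega>. ennreal (V \<omega> * (norm (?S \<omega>))\<^sup>2) \<partial>M)"
    using en(1) V(2) unfolding Snorm by (intro nn_integral_eq_integral[symmetric]) (auto intro!: sum_nonneg AE_I2)
  also have "\<dots> = (\<integral>\<^sup>+\<omega>. ennreal (V \<omega>) * ennreal ((norm (?S \<omega>))\<^sup>2) \<partial>M)"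
    by (simp add: ennreal_mult V(2))
  finally show ?thesis .
qed

end

section \<open>The energy estimate for stochastic integrals\<close>

lemma norm_add_squared_le: "(norm (x + y))\<^sup>2 \<le> 2 * (norm x)\<^sup>2 + 2 * (norm y)\<^sup>2"
  for x y :: "'a::real_normed_vector"
proof -
  have "(norm (x + y))\<^sup>2 \<le> (norm x + norm y)\<^sup>2"
    by (intro power_mono norm_triangle_ineq) auto
  also have "\<dots> \<le> 2 * (norm x)\<^sup>2 + 2 * (norm y)\<^sup>2"
    using sum_squares_bound[of "norm x" "norm y"] by (simp add: power2_sum)
  finally show ?thesis .
qed

lemma norm_add_squared_le_ennreal: 
  "ennreal ((norm (x + y))\<^sup>2) \<le> 2 * ennreal ((norm x)\<^sup>2) + 2 * ennreal ((norm y)\<^sup>2)"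
  for x y :: "'a::real_normed_vector"
proof -
  have "2 * ennreal ((norm x)\<^sup>2) + 2 * ennreal ((norm y)\<^sup>2) = ennreal (2 * (norm x)\<^sup>2 + 2 * (norm y)\<^sup>2)"
    by (simp add: ennreal_mult')
  then show ?thesis using norm_add_squared_le[of x y] by (simp only: ennreal_leI)
qed

lemma add_le_double_sum: "a \<le> 2 * p + 2 * x \<Longrightarrow> b \<le> 2 * q + 2 * y \<Longrightarrow> a + b \<le> 2 * (p + q) + 2 * (x + y)"
  for a b p q x y :: ennreal
proof -
  assume "a \<le> 2 * p + 2 * x" "b \<le> 2 * q + 2 * y"
  then have "a + b \<le> (2 * p + 2 * x) + (2 * q + 2 * y)" by (rule add_mono)
  then show ?thesis by (simp only: distrib_left add_ac)
qed

lemma ennreal_collect_errors: "2 * (2 * R + 8 * c * v) + 2 * c * d \<le> 4 * R + 16 * c * (v + d)"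
  for R c v d :: ennreal
proof -
  have 4: "(2::ennreal) * 2 = 4" and 16: "(2::ennreal) * 8 = 16" by simp_all
  have "2 * (2 * R + 8 * c * v) = 4 * R + 16 * c * v"
    unfolding distrib_left mult.assoc[symmetric] 4 16 ..
  moreover have "2 * c * d \<le> 16 * c * d" by (intro mult_right_mono) auto
  ultimately have "2 * (2 * R + 8 * c * v) + 2 * c * d \<le> (4 * R + 16 * c * v) + 16 * c * d"
    by (simp only: add_left_mono)
  then show ?thesis by (simp only: distrib_left add.assoc)
qed

text \<open>
  Cauchy--Schwarz against the indicator function of the interval.
\<close>

lemma norm_set_integral_squared_le:
  fixes g :: "real \<Rightarrow> 'a::{banach,second_countable_topology}"
  assumes g: "set_integrable lborel {t..b} g" and tb: "t \<le> b"
  shows "ennreal ((norm (LINT s:{t..b}|lborel. g s))\<^sup>2) \<le> ennreal (b - t) * (\<integral>\<^sup>+s\<in>{t..b}. ennreal ((norm (g s))\<^sup>2) \<partial>lborel)"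
proof -
  have m: "(\<lambda>s. indicator {t..b} s *\<^sub>R g s) \<in> borel_measurable lborel"
    using g unfolding set_integrable_def by (rule borel_measurable_integrable)
  have m': "(\<lambda>s. ennreal (norm (indicator {t..b} s *\<^sub>R g s))) \<in> borel_measurable lborel"
    using m by measurable
  have e: "ennreal (norm (indicator {t..b} s *\<^sub>R g s)) = ennreal (norm (indicator {t..b} s *\<^sub>R g s)) * indicator {t..b} s" for s
    by (simp add: indicator_def)
  have "ennreal (norm (LINT s:{t..b}|lborel. g s)) \<le> (\<integral>\<^sup>+s. ennreal (norm (indicator {t..b} s *\<^sub>R g s)) \<partial>lborel)"
    using g unfolding set_integrable_def set_lebesgue_integral_def by (rule integral_norm_bound_ennreal)
  then have "(ennreal (norm (LINT s:{t..b}|lborel. g s)))\<^sup>2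
      \<le> (\<integral>\<^sup>+s. ennreal (norm (indicator {t..b} s *\<^sub>R g s)) * indicator {t..b} s \<partial>lborel)\<^sup>2"
    unfolding e[symmetric] by (intro power_mono) auto
  also have "\<dots> \<le> (\<integral>\<^sup>+s. (ennreal (norm (indicator {t..b} s *\<^sub>R g s)))\<^sup>2 \<partial>lborel) * (\<integral>\<^sup>+s. (indicator {t..b} s)\<^sup>2 \<partial>lborel)"
    using m' by (intro Cauchy_Schwarz_nn_integral) auto
  also have "(\<integral>\<^sup>+s. (indicator {t..b} s)\<^sup>2 \<partial>lborel) = (\<integral>\<^sup>+s. indicator {t..b} s \<partial>(lborel :: real measure))"
    by (intro nn_integral_cong) (simp add: indicator_def)
  also have "\<dots> = ennreal (b - t)" using tb by simp
  also have "(\<integral>\<^sup>+s. (ennreal (norm (indicator {t..b} s *\<^sub>R g s)))\<^sup>2 \<partial>lborel) = (\<integral>\<^sup>+s\<in>{t..b}. ennreal ((norm (g s))\<^sup>2) \<partial>lborel)"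
    by (intro nn_integral_cong) (auto simp: indicator_def ennreal_power)
  finally show ?thesis by (simp add: ennreal_power mult.commute)
qed

lemma simple_process_measurable:
  fixes h :: "nat \<Rightarrow> 'w \<Rightarrow> real^'d::finite^'m::finite"
  assumes "\<And>i. i < n \<Longrightarrow> h i \<in> borel_measurable N"
  shows "(\<lambda>(\<omega>, s). simple_process n \<tau> h s \<omega>) \<in> borel_measurable (N \<Otimes>\<^sub>M lborel)"
proof -
  have "(\<lambda>p. if \<tau> i < snd p \<and> snd p \<le> \<tau> (Suc i) then h i (fst p) else 0) \<in> borel_measurable (N \<Otimes>\<^sub>M lborel)"
    if "i < n" for i
  proof -
    note [measurable] = assms[OF that]
    show ?thesis by measurable
  qed
  then show ?thesis unfolding simple_process_def case_prod_beta' by (intro borel_measurable_sum) auto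
qed

lemma nn_integral_mult_limit_le:
  fixes a :: ennreal
  assumes "\<And>k. a \<le> b + c * e k" and "e \<longlonglongrightarrow> 0" and "c < \<infinity>"
  shows "a \<le> b"
proof (rule LIMSEQ_le_const)
  have "(\<lambda>k. b + c * e k) \<longlonglongrightarrow> b + c * 0"
    using assms by (intro tendsto_add tendsto_const ennreal_tendsto_cmult) auto
  then show "(\<lambda>k. b + c * e k) \<longlonglongrightarrow> b" by simp
qed (use assms in auto)

context common_noise_brownian
begin

text \<open>
  Cutting off outside \<open>[0,T]\<close> turns progressive measurability at time \<open>T\<close> into joint measurability on the
  whole line, the form in which Tonelli's theorem is applied.
\<close>

lemma progressive_measurable:
  fixes X :: "real \<Rightarrow> 'a \<times> 'b \<Rightarrow> 'e::real_normed_vector"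
  assumes X: "progressive F T X"
  shows "(\<lambda>(\<omega>, s). indicator {0..T} s *\<^sub>R X s \<omega>) \<in> borel_measurable (M \<Otimes>\<^sub>M lborel)"
proof -
  let ?N = "restrict_space (M \<Otimes>\<^sub>M lborel) (space M \<times> {0..T})"
  have XT: "(\<lambda>(s, \<omega>). X s \<omega>) \<in> borel_measurable (restrict_space borel {0..T} \<Otimes>\<^sub>M F T)"
    using X T by (auto simp: progressive_def)
  have idF: "(\<lambda>\<omega>. \<omega>) \<in> M \<rightarrow>\<^sub>M F T"
    by (rule measurableI) (use subalgebra_F[of T] in \<open>auto simp: subalgebra_def\<close>)
  have "(\<lambda>p. (snd p, fst p)) \<in> ?N \<rightarrow>\<^sub>M restrict_space borel {0..T} \<Otimes>\<^sub>M F T"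
  proof (rule measurable_Pair)
    show "snd \<in> ?N \<rightarrow>\<^sub>M restrict_space borel {0..T}"
      by (intro measurable_restrict_space2 measurable_restrict_space1) (auto simp: space_restrict_space)
    have "fst \<in> ?N \<rightarrow>\<^sub>M M" by (intro measurable_restrict_space1) auto
    from measurable_compose[OF this idF] show "fst \<in> ?N \<rightarrow>\<^sub>M F T" by simp
  qed
  from measurable_compose[OF this XT]
  have "(\<lambda>p. X (snd p) (fst p)) \<in> borel_measurable ?N" by simp
  then have "(\<lambda>p. indicator (space M \<times> {0..T}) p *\<^sub>R X (snd p) (fst p)) \<in> borel_measurable (M \<Otimes>\<^sub>M lborel)"
    by (subst (asm) borel_measurable_restrict_space_iff) auto
  also have "?this \<longleftrightarrow> ?thesis"
    by (rule measurable_cong) (auto simp: space_pair_measure indicator_def)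
  finally show ?thesis .
qed

lemma progressive_adapted:
  assumes X: "progressive F T X" and t: "t \<in> {0..T}"
  shows "X t \<in> borel_measurable (F t)"
proof -
  have 1: "(\<lambda>(s, \<omega>). X s \<omega>) \<in> borel_measurable (restrict_space borel {0..t} \<Otimes>\<^sub>M F t)"
    using X t by (auto simp: progressive_def)
  have 2: "(\<lambda>\<omega>. (t, \<omega>)) \<in> F t \<rightarrow>\<^sub>M restrict_space borel {0..t} \<Otimes>\<^sub>M F t"
    using t by (intro measurable_Pair) (auto simp: space_restrict_space)
  from measurable_compose[OF 2 1] show ?thesis by simp
qed

text \<open>
  Limit of the energy identity along approximating simple integrands. The approximation errors are
  separated by \<open>|x + y|\<^sup>2 \<le> 2 |x|\<^sup>2 + 2 |y|\<^sup>2\<close>, once on each side; this costs the factor \<open>4\<close> and leaves only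
  integrals of nonnegative functions.
\<close>

lemma ito_energy:
  fixes Z Z0 :: "real \<Rightarrow> 'a \<times> 'b \<Rightarrow> real^'d^'m::finite" and X :: "'a \<times> 'b \<Rightarrow> real^'m"
  assumes J: "has_ito_integral M F T (\<lambda>t \<omega>. W t (snd \<omega>)) Z J"
    and J0: "has_ito_integral M F T (\<lambda>t \<omega>. W0 t (fst \<omega>)) Z0 J0"
    and Z: "progressive F T Z" and Z0: "progressive F T Z0"
    and t: "0 \<le> t" "t \<le> b" "b \<le> T"
    and V: "V \<in> borel_measurable (F t)" "\<And>\<omega>. 0 \<le> V \<omega>" "\<And>\<omega>. V \<omega> \<le> C"
    and X: "X \<in> borel_measurable (F t)" "\<And>\<omega>. norm (X \<omega>) \<le> C'"
  shows "(\<integral>\<^sup>+\<omega>. ennreal (V \<omega>) * (ennreal ((norm (X \<omega>))\<^sup>2) +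
      (\<integral>\<^sup>+s\<in>{t..b}. ennreal ((norm (Z s \<omega>))\<^sup>2) + ennreal ((norm (Z0 s \<omega>))\<^sup>2) \<partial>lborel)) \<partial>M)
    \<le> 4 * (\<integral>\<^sup>+\<omega>. ennreal (V \<omega>) * ennreal ((norm (X \<omega> + (J b \<omega> - J t \<omega>) + (J0 b \<omega> - J0 t \<omega>)))\<^sup>2) \<partial>M)"
    (is "?L \<le> 4 * ?R")
proof -
  obtain n \<tau> h where H: "\<And>k. simple_integrand F T (n k) (\<tau> k) (h k)"
    and HZ: "(\<lambda>k. \<integral>\<^sup>+\<omega>. (\<integral>\<^sup>+s\<in>{0..T}.
            ennreal ((norm (simple_process (n k) (\<tau> k) (h k) s \<omega> - Z s \<omega>))\<^sup>2) \<partial>lborel) \<partial>M) \<longlonglongrightarrow> 0"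
    and HJ: "\<And>t. t \<in> {0..T} \<Longrightarrow> (\<lambda>k. \<integral>\<^sup>+\<omega>. ennreal ((norm (simple_integral (\<lambda>t \<omega>. W t (snd \<omega>)) (n k) (\<tau> k) (h k) t \<omega> - J t \<omega>))\<^sup>2) \<partial>M)
          \<longlonglongrightarrow> 0"
    using J unfolding has_ito_integral_def by blast
  obtain n0 \<tau>0 h0 where H0: "\<And>k. simple_integrand F T (n0 k) (\<tau>0 k) (h0 k)"
    and HZ0: "(\<lambda>k. \<integral>\<^sup>+\<omega>. (\<integral>\<^sup>+s\<in>{0..T}.
            ennreal ((norm (simple_process (n0 k) (\<tau>0 k) (h0 k) s \<omega> - Z0 s \<omega>))\<^sup>2) \<partial>lborel) \<partial>M) \<longlonglongrightarrow> 0"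
    and HJ0: "\<And>t. t \<in> {0..T} \<Longrightarrow> (\<lambda>k. \<integral>\<^sup>+\<omega>. ennreal ((norm (simple_integral (\<lambda>t \<omega>. W0 t (fst \<omega>)) (n0 k) (\<tau>0 k) (h0 k) t \<omega> - J0 t \<omega>))\<^sup>2) \<partial>M)
          \<longlonglongrightarrow> 0"
    using J0 unfolding has_ito_integral_def by blast
  define P where "P = (\<lambda>k. simple_process (n k) (\<tau> k) (h k))"
  define P0 where "P0 = (\<lambda>k. simple_process (n0 k) (\<tau>0 k) (h0 k))"
  define I where "I = (\<lambda>k. simple_integral (\<lambda>t \<omega>. W t (snd \<omega>)) (n k) (\<tau> k) (h k))"
  define I0 where "I0 = (\<lambda>k. simple_integral (\<lambda>t \<omega>. W0 t (fst \<omega>)) (n0 k) (\<tau>0 k) (h0 k))"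
  have h_meas: "h k i \<in> borel_measurable M" if "i < n k" for k i
    using H[of k] that measurable_from_subalg[OF subalgebra_F] unfolding simple_integrand_def by blast
  have h0_meas: "h0 k i \<in> borel_measurable M" if "i < n0 k" for k i
    using H0[of k] that measurable_from_subalg[OF subalgebra_F] unfolding simple_integrand_def by blast
  have P_meas [measurable]: "(\<lambda>(\<omega>, s). P k s \<omega>) \<in> borel_measurable (M \<Otimes>\<^sub>M lborel)" 
    "(\<lambda>(\<omega>, s). P0 k s \<omega>) \<in> borel_measurable (M \<Otimes>\<^sub>M lborel)" for k
    unfolding P_def P0_def by (intro simple_process_measurable h_meas h0_meas; assumption)+
  have XI_meas: "I k r \<in> borel_measurable M" "I0 k r \<in> borel_measurable M" if "r \<in> {0..T}" for k r
  proof -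
    have w: "(\<lambda>\<omega>. W (min (\<tau> k i) r) (snd \<omega>)) \<in> borel_measurable M" if "i \<le> n k" for i
      using \<open>r \<in> {0..T}\<close> that H[of k] by (intro measurable_compose[OF snd_measurable W_meas(2)]) (auto simp: simple_integrand_def)
    have w0: "(\<lambda>\<omega>. W0 (min (\<tau>0 k i) r) (fst \<omega>)) \<in> borel_measurable M" if "i \<le> n0 k" for i
      using \<open>r \<in> {0..T}\<close> that H0[of k] by (intro measurable_compose[OF fst_measurable W_meas(1)]) (auto simp: simple_integrand_def)
    have mv: "(\<lambda>\<omega>. A \<omega> *v x \<omega>) \<in> borel_measurable M" 
      if "A \<in> borel_measurable M" "x \<in> borel_measurable M" for A :: "'a \<times> 'b \<Rightarrow> real^'d^'m" and x
      using that by (rule borel_measurable_continuous_Pair)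
        (auto simp: matrix_vector_mult_def intro!: continuous_intros)
    show "I k r \<in> borel_measurable M" "I0 k r \<in> borel_measurable M"
      unfolding I_def I0_def simple_integral_def
      by (intro borel_measurable_sum mv borel_measurable_diff w w0 h_meas h0_meas; simp)+
  qed
  define Z' where "Z' = (\<lambda>s \<omega>. indicator {0..T} s *\<^sub>R Z s \<omega>)"
  define Z0' where "Z0' = (\<lambda>s \<omega>. indicator {0..T} s *\<^sub>R Z0 s \<omega>)"
  have Z'_meas [measurable]: "(\<lambda>(\<omega>, s). Z' s \<omega>) \<in> borel_measurable (M \<Otimes>\<^sub>M lborel)"
    "(\<lambda>(\<omega>, s). Z0' s \<omega>) \<in> borel_measurable (M \<Otimes>\<^sub>M lborel)"
    unfolding Z'_def Z0'_def by (intro progressive_measurable Z Z0)+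
  have Z': "Z' s \<omega> = Z s \<omega>" "Z0' s \<omega> = Z0 s \<omega>" if "s \<in> {0..T}" for s \<omega>
    using that by (auto simp: Z'_def Z0'_def)
  define d where "d = (\<lambda>k \<omega>. \<integral>\<^sup>+s\<in>{0..T}. ennreal ((norm (P k s \<omega> - Z' s \<omega>))\<^sup>2) \<partial>lborel)"
  define d0 where "d0 = (\<lambda>k \<omega>. \<integral>\<^sup>+s\<in>{0..T}. ennreal ((norm (P0 k s \<omega> - Z0' s \<omega>))\<^sup>2) \<partial>lborel)"
  define v where "v = (\<lambda>k r \<omega>. ennreal ((norm (I k r \<omega> - J r \<omega>))\<^sup>2))"
  define v0 where "v0 = (\<lambda>k r \<omega>. ennreal ((norm (I0 k r \<omega> - J0 r \<omega>))\<^sup>2))"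
  have tT: "t \<in> {0..T}" "b \<in> {0..T}" using t by auto
  have J_meas [measurable]: "J t \<in> borel_measurable M" "J b \<in> borel_measurable M"
     "J0 t \<in> borel_measurable M" "J0 b \<in> borel_measurable M"
    using J J0 tT measurable_from_subalg[OF subalgebra_F] unfolding has_ito_integral_def by blast+
  note [measurable] = XI_meas[OF tT(1)] XI_meas[OF tT(2)]
    measurable_from_subalg[OF subalgebra_F X(1)] measurable_from_subalg[OF subalgebra_F V(1)]
  have d_meas [measurable]: "d k \<in> borel_measurable M" "d0 k \<in> borel_measurable M" for k
    unfolding d_def d0_def by measurable
  have v_meas [measurable]: "v k t \<in> borel_measurable M" "v k b \<in> borel_measurable M"
     "v0 k t \<in> borel_measurable M" "v0 k b \<in> borel_measurable M" for k
    unfolding v_def v0_def by measurable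
  define E where "E = (\<lambda>k \<omega>. d k \<omega> + d0 k \<omega> + (v k b \<omega> + v k t \<omega> + (v0 k b \<omega> + v0 k t \<omega>)))"
  have E_meas [measurable]: "E k \<in> borel_measurable M" for k unfolding E_def by measurable
  have d_lim: "(\<lambda>k. \<integral>\<^sup>+\<omega>. d k \<omega> \<partial>M) \<longlonglongrightarrow> 0" "(\<lambda>k. \<integral>\<^sup>+\<omega>. d0 k \<omega> \<partial>M) \<longlonglongrightarrow> 0"
  proof -
    have "d k \<omega> = (\<integral>\<^sup>+s\<in>{0..T}. ennreal ((norm (P k s \<omega> - Z s \<omega>))\<^sup>2) \<partial>lborel)"
      "d0 k \<omega> = (\<integral>\<^sup>+s\<in>{0..T}. ennreal ((norm (P0 k s \<omega> - Z0 s \<omega>))\<^sup>2) \<partial>lborel)" for k \<omega>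
      unfolding d_def d0_def by (intro nn_integral_cong; simp add: Z' split: split_indicator)+
    then show "(\<lambda>k. \<integral>\<^sup>+\<omega>. d k \<omega> \<partial>M) \<longlonglongrightarrow> 0" "(\<lambda>k. \<integral>\<^sup>+\<omega>. d0 k \<omega> \<partial>M) \<longlonglongrightarrow> 0"
      using HZ HZ0 by (simp_all add: P_def P0_def)
  qed
  have E_lim: "(\<lambda>k. \<integral>\<^sup>+\<omega>. E k \<omega> \<partial>M) \<longlonglongrightarrow> 0"
  proof -
    have "(\<integral>\<^sup>+\<omega>. E k \<omega> \<partial>M) = (\<integral>\<^sup>+\<omega>. d k \<omega> \<partial>M) + (\<integral>\<^sup>+\<omega>. d0 k \<omega> \<partial>M) + ((\<integral>\<^sup>+\<omega>. v k b \<omega> \<partial>M) + (\<integral>\<^sup>+\<omega>. v k t \<omega> \<partial>M)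
       + ((\<integral>\<^sup>+\<omega>. v0 k b \<omega> \<partial>M) + (\<integral>\<^sup>+\<omega>. v0 k t \<omega> \<partial>M)))" for k
      unfolding E_def by (simp add: nn_integral_add)
    moreover have "(\<lambda>k. (\<integral>\<^sup>+\<omega>. d k \<omega> \<partial>M) + (\<integral>\<^sup>+\<omega>. d0 k \<omega> \<partial>M) + ((\<integral>\<^sup>+\<omega>. v k b \<omega> \<partial>M) + (\<integral>\<^sup>+\<omega>. v k t \<omega> \<partial>M)
       + ((\<integral>\<^sup>+\<omega>. v0 k b \<omega> \<partial>M) + (\<integral>\<^sup>+\<omega>. v0 k t \<omega> \<partial>M)))) \<longlonglongrightarrow> 0 + 0 + (0 + 0 + (0 + 0))"
      by (intro tendsto_add d_lim) (simp_all add: v_def v0_def I_def I0_def HJ[OF tT(1)] HJ[OF tT(2)] HJ0[OF tT(1)] HJ0[OF tT(2)])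
    ultimately show ?thesis by simp
  qed
  let ?S = "\<lambda>\<omega>. X \<omega> + (J b \<omega> - J t \<omega>) + (J0 b \<omega> - J0 t \<omega>)"
  let ?Sk = "\<lambda>k \<omega>. X \<omega> + (I k b \<omega> - I k t \<omega>) + (I0 k b \<omega> - I0 k t \<omega>)"
  let ?z = "\<lambda>\<omega>. \<integral>\<^sup>+s\<in>{t..b}. ennreal ((norm (Z s \<omega>))\<^sup>2) + ennreal ((norm (Z0 s \<omega>))\<^sup>2) \<partial>lborel"
  let ?zk = "\<lambda>k \<omega>. \<integral>\<^sup>+s\<in>{t..b}. ennreal ((norm (P k s \<omega>))\<^sup>2) + ennreal ((norm (P0 k s \<omega>))\<^sup>2) \<partial>lborel"
  have Vb: "BF.bounded_at t V"
    using V by (intro BF.bounded_atI[of _ _ C]) auto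
  have z: "?z \<omega> \<le> 2 * ?zk k \<omega> + 2 * (d k \<omega> + d0 k \<omega>)" if "\<omega> \<in> space M" for k \<omega>
  proof -
    have [measurable]: "(\<lambda>s. P k s \<omega>) \<in> borel_measurable lborel" "(\<lambda>s. P0 k s \<omega>) \<in> borel_measurable lborel"
      "(\<lambda>s. Z' s \<omega>) \<in> borel_measurable lborel" "(\<lambda>s. Z0' s \<omega>) \<in> borel_measurable lborel"
      using measurable_Pair2[OF P_meas(1)[of k] that] measurable_Pair2[OF P_meas(2)[of k] that]
        measurable_Pair2[OF Z'_meas(1) that] measurable_Pair2[OF Z'_meas(2) that] by simp_all
    have "?z \<omega> \<le> (\<integral>\<^sup>+s. 2 * ((ennreal ((norm (P k s \<omega>))\<^sup>2) + ennreal ((norm (P0 k s \<omega>))\<^sup>2)) * indicator {t..b} s)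
      + 2 * (ennreal ((norm (P k s \<omega> - Z' s \<omega>))\<^sup>2) * indicator {0..T} s
           + ennreal ((norm (P0 k s \<omega> - Z0' s \<omega>))\<^sup>2) * indicator {0..T} s) \<partial>lborel)"
    proof (rule nn_integral_mono)
      fix s
      show "(ennreal ((norm (Z s \<omega>))\<^sup>2) + ennreal ((norm (Z0 s \<omega>))\<^sup>2)) * indicator {t..b} s
         \<le> 2 * ((ennreal ((norm (P k s \<omega>))\<^sup>2) + ennreal ((norm (P0 k s \<omega>))\<^sup>2)) * indicator {t..b} s)
      + 2 * (ennreal ((norm (P k s \<omega> - Z' s \<omega>))\<^sup>2) * indicator {0..T} s
           + ennreal ((norm (P0 k s \<omega> - Z0' s \<omega>))\<^sup>2) * indicator {0..T} s)"
      proof (cases "s \<in> {t..b}")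
        case True
        then have s: "s \<in> {0..T}" using t by auto
        have "ennreal ((norm (Z s \<omega>))\<^sup>2) \<le> 2 * ennreal ((norm (P k s \<omega>))\<^sup>2) + 2 * ennreal ((norm (P k s \<omega> - Z s \<omega>))\<^sup>2)"
          using norm_add_squared_le_ennreal[of "P k s \<omega>" "Z s \<omega> - P k s \<omega>"] by (simp add: norm_minus_commute)
        moreover have "ennreal ((norm (Z0 s \<omega>))\<^sup>2) \<le> 2 * ennreal ((norm (P0 k s \<omega>))\<^sup>2) + 2 * ennreal ((norm (P0 k s \<omega> - Z0 s \<omega>))\<^sup>2)"
          using norm_add_squared_le_ennreal[of "P0 k s \<omega>" "Z0 s \<omega> - P0 k s \<omega>"] by (simp add: norm_minus_commute)
        ultimately show ?thesis
          unfolding Z'[OF s] using True s by (simp only: indicator_simps mult_1_right add_le_double_sum)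
      qed simp
    qed
    also have "\<dots> = 2 * ?zk k \<omega> + 2 * (d k \<omega> + d0 k \<omega>)"
      unfolding d_def d0_def by (simp add: nn_integral_add nn_integral_cmult)
    finally show ?thesis .
  qed
  have S: "ennreal ((norm (?Sk k \<omega>))\<^sup>2) \<le> 2 * ennreal ((norm (?S \<omega>))\<^sup>2) + 8 * (v k b \<omega> + v k t \<omega> + (v0 k b \<omega> + v0 k t \<omega>))" for k \<omega>
  proof -
    let ?a = "I k b \<omega> - J b \<omega>" and ?b = "J t \<omega> - I k t \<omega>" and ?c = "I0 k b \<omega> - J0 b \<omega>" and ?d = "J0 t \<omega> - I0 k t \<omega>"
    have "?Sk k \<omega> = ?S \<omega> + ((?a + ?b) + (?c + ?d))" by (simp add: algebra_simps)
    then have "(norm (?Sk k \<omega>))\<^sup>2 \<le> 2 * (norm (?S \<omega>))\<^sup>2 + 2 * (norm ((?a + ?b) + (?c + ?d)))\<^sup>2"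
      by (simp only: norm_add_squared_le)
    also have "(norm ((?a + ?b) + (?c + ?d)))\<^sup>2 \<le> 2 * (norm (?a + ?b))\<^sup>2 + 2 * (norm (?c + ?d))\<^sup>2" by (rule norm_add_squared_le)
    also have "(norm (?a + ?b))\<^sup>2 \<le> 2 * (norm ?a)\<^sup>2 + 2 * (norm ?b)\<^sup>2" by (rule norm_add_squared_le)
    also have "(norm (?c + ?d))\<^sup>2 \<le> 2 * (norm ?c)\<^sup>2 + 2 * (norm ?d)\<^sup>2" by (rule norm_add_squared_le)
    finally have "ennreal ((norm (?Sk k \<omega>))\<^sup>2) \<le> ennreal (2 * (norm (?S \<omega>))\<^sup>2 + 8 * ((norm ?a)\<^sup>2 + (norm ?b)\<^sup>2 + ((norm ?c)\<^sup>2 + (norm ?d)\<^sup>2)))"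
      by (intro ennreal_leI) simp
    then show ?thesis by (simp add: v_def v0_def ennreal_mult' norm_minus_commute)
  qed
  have "?L \<le> 4 * ?R + (16 * ennreal C) * (\<integral>\<^sup>+\<omega>. E k \<omega> \<partial>M)" for k
  proof -
    have zk_meas [measurable]: "?zk k \<in> borel_measurable M" by measurable
    have "?L \<le> (\<integral>\<^sup>+\<omega>. 2 * (ennreal (V \<omega>) * (ennreal ((norm (X \<omega>))\<^sup>2) + ?zk k \<omega>)) + 2 * ennreal C * (d k \<omega> + d0 k \<omega>) \<partial>M)"
    proof (rule nn_integral_mono)
      fix \<omega> assume "\<omega> \<in> space M"
      have "ennreal (V \<omega>) * (ennreal ((norm (X \<omega>))\<^sup>2) + ?z \<omega>)
         \<le> ennreal (V \<omega>) * (2 * ennreal ((norm (X \<omega>))\<^sup>2) + (2 * ?zk k \<omega> + 2 * (d k \<omega> + d0 k \<omega>)))"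
        using z[OF \<open>\<omega> \<in> space M\<close>, of k] by (intro mult_left_mono add_mono) (auto simp: mult_2)
      also have "\<dots> = 2 * (ennreal (V \<omega>) * (ennreal ((norm (X \<omega>))\<^sup>2) + ?zk k \<omega>)) + 2 * ennreal (V \<omega>) * (d k \<omega> + d0 k \<omega>)"
        by (simp only: distrib_left mult_ac add_ac)
      also have "\<dots> \<le> 2 * (ennreal (V \<omega>) * (ennreal ((norm (X \<omega>))\<^sup>2) + ?zk k \<omega>)) + 2 * ennreal C * (d k \<omega> + d0 k \<omega>)"
        using V(3) by (intro add_left_mono mult_right_mono mult_left_mono ennreal_leI) auto
      finally show "ennreal (V \<omega>) * (ennreal ((norm (X \<omega>))\<^sup>2) + ?z \<omega>)
         \<le> 2 * (ennreal (V \<omega>) * (ennreal ((norm (X \<omega>))\<^sup>2) + ?zk k \<omega>)) + 2 * ennreal C * (d k \<omega> + d0 k \<omega>)" .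
    qed
    also have "\<dots> = 2 * (\<integral>\<^sup>+\<omega>. ennreal (V \<omega>) * (ennreal ((norm (X \<omega>))\<^sup>2) + ?zk k \<omega>) \<partial>M) + 2 * ennreal C * (\<integral>\<^sup>+\<omega>. d k \<omega> + d0 k \<omega> \<partial>M)"
      by (subst nn_integral_add, measurable, subst (1 2) nn_integral_cmult) measurable
    also have "(\<integral>\<^sup>+\<omega>. ennreal (V \<omega>) * (ennreal ((norm (X \<omega>))\<^sup>2) + ?zk k \<omega>) \<partial>M) = (\<integral>\<^sup>+\<omega>. ennreal (V \<omega>) * ennreal ((norm (?Sk k \<omega>))\<^sup>2) \<partial>M)"
      unfolding P_def P0_def I_def I0_def by (rule simple_integral_energy[OF H H0 t Vb V(2) X])
    also have "\<dots> \<le> (\<integral>\<^sup>+\<omega>. 2 * (ennreal (V \<omega>) * ennreal ((norm (?S \<omega>))\<^sup>2)) + 8 * ennreal C * (v k b \<omega> + v k t \<omega> + (v0 k b \<omega> + v0 k t \<omega>)) \<partial>M)"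
    proof (rule nn_integral_mono)
      fix \<omega>
      have "ennreal (V \<omega>) * ennreal ((norm (?Sk k \<omega>))\<^sup>2) \<le> ennreal (V \<omega>) * (2 * ennreal ((norm (?S \<omega>))\<^sup>2) + 8 * (v k b \<omega> + v k t \<omega> + (v0 k b \<omega> + v0 k t \<omega>)))"
        by (intro mult_left_mono S) auto
      also have "\<dots> = 2 * (ennreal (V \<omega>) * ennreal ((norm (?S \<omega>))\<^sup>2)) + 8 * ennreal (V \<omega>) * (v k b \<omega> + v k t \<omega> + (v0 k b \<omega> + v0 k t \<omega>))"
        by (simp only: distrib_left mult_ac add_ac)
      also have "\<dots> \<le> 2 * (ennreal (V \<omega>) * ennreal ((norm (?S \<omega>))\<^sup>2)) + 8 * ennreal C * (v k b \<omega> + v k t \<omega> + (v0 k b \<omega> + v0 k t \<omega>))"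
        using V(3) by (intro add_left_mono mult_right_mono mult_left_mono ennreal_leI) auto
      finally show "ennreal (V \<omega>) * ennreal ((norm (?Sk k \<omega>))\<^sup>2) \<le> 2 * (ennreal (V \<omega>) * ennreal ((norm (?S \<omega>))\<^sup>2)) + 8 * ennreal C * (v k b \<omega> + v k t \<omega> + (v0 k b \<omega> + v0 k t \<omega>))" .
    qed
    also have "\<dots> = 2 * ?R + 8 * ennreal C * (\<integral>\<^sup>+\<omega>. v k b \<omega> + v k t \<omega> + (v0 k b \<omega> + v0 k t \<omega>) \<partial>M)"
      by (subst nn_integral_add, measurable, subst (1 2) nn_integral_cmult) measurable
    finally have "?L \<le> 2 * (2 * ?R + 8 * ennreal C * (\<integral>\<^sup>+\<omega>. v k b \<omega> + v k t \<omega> + (v0 k b \<omega> + v0 k t \<omega>) \<partial>M)) + 2 * ennreal C * (\<integral>\<^sup>+\<omega>. d k \<omega> + d0 k \<omega> \<partial>M)"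
      by (simp add: mult_left_mono add_mono)
    also have "\<dots> \<le> 4 * ?R + 16 * ennreal C * ((\<integral>\<^sup>+\<omega>. v k b \<omega> + v k t \<omega> + (v0 k b \<omega> + v0 k t \<omega>) \<partial>M) + (\<integral>\<^sup>+\<omega>. d k \<omega> + d0 k \<omega> \<partial>M))"
      by (rule ennreal_collect_errors)
    also have "(\<integral>\<^sup>+\<omega>. v k b \<omega> + v k t \<omega> + (v0 k b \<omega> + v0 k t \<omega>) \<partial>M) + (\<integral>\<^sup>+\<omega>. d k \<omega> + d0 k \<omega> \<partial>M) = (\<integral>\<^sup>+\<omega>. E k \<omega> \<partial>M)"
      unfolding E_def by (subst nn_integral_add[symmetric], measurable) (simp add: add.commute)
    finally show ?thesis .
  qed
  then show ?thesis
    by (rule nn_integral_mult_limit_le[OF _ E_lim]) (simp add: ennreal_mult_less_top)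
qed

end

section \<open>A weighted a priori estimate for the backward equation\<close>

text \<open>
  Fatou's lemma for truncations that are eventually exact.
\<close>

lemma nn_integral_le_of_eventually_eq:
  assumes f: "\<And>n. f n \<in> borel_measurable N"
    and ev: "AE x in N. \<forall>\<^sub>F n in sequentially. f n x = g x"
    and bound: "\<And>n. (\<integral>\<^sup>+x. f n x \<partial>N) \<le> B"
  shows "(\<integral>\<^sup>+x. g x \<partial>N) \<le> B"
proof -
  have "(\<integral>\<^sup>+x. g x \<partial>N) = (\<integral>\<^sup>+x. liminf (\<lambda>n. f n x) \<partial>N)"
  proof (rule nn_integral_cong_AE, use ev in eventually_elim)
    case (elim x)
    then have "(\<lambda>n. f n x) \<longlonglongrightarrow> g x" by (rule tendsto_eventually)
    then show ?case by (simp add: lim_imp_Liminf)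
  qed
  also have "\<dots> \<le> liminf (\<lambda>n. \<integral>\<^sup>+x. f n x \<partial>N)" by (rule nn_integral_liminf[OF f])
  also have "\<dots> \<le> liminf (\<lambda>n. B)" by (rule Liminf_mono) (simp add: bound)
  finally show ?thesis by (simp add: Liminf_const)
qed

lemma ennreal_absorb:
  assumes "(a::ennreal) + z \<le> b + c * (g + z)" and "c \<le> 1" and "z < \<infinity>"
  shows "a \<le> b + g"
proof -
  have "c * (g + z) \<le> g + z" using mult_right_mono[OF assms(2), of "g + z"] by simp
  then have "a + z \<le> (b + g) + z" using assms(1) by (metis add.assoc add_left_mono order_trans)
  then show ?thesis using assms(3) by (auto simp: ennreal_add_left_cancel_le add.commute[of _ z])
qed

context common_noise_brownian
begin

lemma nn_integral_section_measurable [measurable]: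
  fixes G :: "real \<Rightarrow> 'a \<times> 'b \<Rightarrow> ennreal"
  assumes "(\<lambda>(\<omega>, s). G s \<omega>) \<in> borel_measurable (M \<Otimes>\<^sub>M lborel)"
  shows "(\<lambda>\<omega>. \<integral>\<^sup>+s\<in>{t..b}. G s \<omega> \<partial>lborel) \<in> borel_measurable M"
proof -
  have [measurable]: "{t..b} \<in> sets lborel" by simp
  show ?thesis using assms by measurable
qed

text \<open>
  By the equation, \<open>Y t\<close> plus the stochastic integrals over \<open>[t,b]\<close> equals \<open>Y b\<close> plus the integral of \<open>g\<close>.
  The energy estimate controls \<open>Y t\<close> and the energy of \<open>Z\<close> and \<open>Z0\<close> by this sum, and the integral of \<open>g\<close>
  contributes that same energy with the factor \<open>8 * L * (b - t)\<close>, so that it can be subtracted.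
\<close>

lemma weighted_estimate_short:
  fixes Z Z0 :: "real \<Rightarrow> 'a \<times> 'b \<Rightarrow> real^'d^'m::finite" and \<xi> :: "'a \<times> 'b \<Rightarrow> real^'m"
  assumes J: "has_ito_integral M F T (\<lambda>t \<omega>. W t (snd \<omega>)) Z J"
    and J0: "has_ito_integral M F T (\<lambda>t \<omega>. W0 t (fst \<omega>)) Z0 J0"
    and Z: "Z \<in> H2_space M F T" and Z0: "Z0 \<in> H2_space M F T"
    and Y: "\<And>t. t \<in> {0..T} \<Longrightarrow> Y t \<in> borel_measurable (F t)"
    and g: "AE \<omega> in M. set_integrable lborel {0..T} (g \<omega>)"
    and eq: "AE \<omega> in M. \<forall>t\<in>{0..T}.
               Y t \<omega> = \<xi> \<omega> + (LINT s:{t..T}|lborel. g \<omega> s) - (J T \<omega> - J t \<omega>) - (J0 T \<omega> - J0 t \<omega>)"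
    and G: "(\<lambda>(\<omega>, s). G s \<omega>) \<in> borel_measurable (M \<Otimes>\<^sub>M lborel)"
    and L: "0 \<le> L"
    and bound: "AE \<omega> in M. \<forall>s\<in>{0..T}. ennreal ((norm (g \<omega> s))\<^sup>2)
        \<le> ennreal L * (G s \<omega> + (ennreal ((norm (Z s \<omega>))\<^sup>2) + ennreal ((norm (Z0 s \<omega>))\<^sup>2)))"
    and t: "0 \<le> t" "t \<le> b" "b \<le> T" and small: "8 * L * (b - t) \<le> 1"
    and V: "V \<in> borel_measurable (F t)" "\<And>\<omega>. 0 \<le> V \<omega>"
  shows "(\<integral>\<^sup>+\<omega>. ennreal (V \<omega>) * ennreal ((norm (Y t \<omega>))\<^sup>2) \<partial>M)
    \<le> 8 * (\<integral>\<^sup>+\<omega>. ennreal (V \<omega>) * ennreal ((norm (Y b \<omega>))\<^sup>2) \<partial>M)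
      + (\<integral>\<^sup>+\<omega>. ennreal (V \<omega>) * (\<integral>\<^sup>+s\<in>{t..b}. G s \<omega> \<partial>lborel) \<partial>M)"
proof -
  have tT: "t \<in> {0..T}" "b \<in> {0..T}" using t by auto
  have progZ: "progressive F T Z" "progressive F T Z0" using Z Z0 by (auto simp: H2_space_def)
  define Z' where "Z' = (\<lambda>s \<omega>. indicator {0..T} s *\<^sub>R Z s \<omega>)"
  define Z0' where "Z0' = (\<lambda>s \<omega>. indicator {0..T} s *\<^sub>R Z0 s \<omega>)"
  have Z'_meas [measurable]: "(\<lambda>(\<omega>, s). Z' s \<omega>) \<in> borel_measurable (M \<Otimes>\<^sub>M lborel)"
    "(\<lambda>(\<omega>, s). Z0' s \<omega>) \<in> borel_measurable (M \<Otimes>\<^sub>M lborel)"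
    unfolding Z'_def Z0'_def by (intro progressive_measurable progZ)+
  have Z': "Z' s \<omega> = Z s \<omega>" "Z0' s \<omega> = Z0 s \<omega>" if "s \<in> {0..T}" for s \<omega>
    using that by (auto simp: Z'_def Z0'_def)
  note [measurable] = G Y[OF tT(1)] V(1) measurable_from_subalg[OF subalgebra_F Y[OF tT(1)]]
    measurable_from_subalg[OF subalgebra_F Y[OF tT(2)]] measurable_from_subalg[OF subalgebra_F V(1)]
  define z where "z = (\<lambda>\<omega>. \<integral>\<^sup>+s\<in>{t..b}. ennreal ((norm (Z s \<omega>))\<^sup>2) + ennreal ((norm (Z0 s \<omega>))\<^sup>2) \<partial>lborel)"
  have z_eq: "z \<omega> = (\<integral>\<^sup>+s\<in>{t..b}. ennreal ((norm (Z' s \<omega>))\<^sup>2) + ennreal ((norm (Z0' s \<omega>))\<^sup>2) \<partial>lborel)" for \<omega>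
    unfolding z_def using t by (intro nn_integral_cong) (auto simp: Z' split: split_indicator)
  have z_meas [measurable]: "z \<in> borel_measurable M" unfolding z_eq by measurable
  define \<Gamma> where "\<Gamma> = (\<lambda>\<omega>. \<integral>\<^sup>+s\<in>{t..b}. G s \<omega> \<partial>lborel)"
  have \<Gamma>_meas [measurable]: "\<Gamma> \<in> borel_measurable M"
    unfolding \<Gamma>_def by (rule nn_integral_section_measurable[OF G])
  have sec [measurable]: "(\<lambda>s. G s \<omega>) \<in> borel_measurable lborel"
    "(\<lambda>s. Z' s \<omega>) \<in> borel_measurable lborel" "(\<lambda>s. Z0' s \<omega>) \<in> borel_measurable lborel" if "\<omega> \<in> space M" for \<omega>
    using measurable_Pair2[OF G that] measurable_Pair2[OF Z'_meas(1) that] measurable_Pair2[OF Z'_meas(2) that] by simp_all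
  have z_fin: "(\<integral>\<^sup>+\<omega>. z \<omega> \<partial>M) < \<infinity>"
  proof -
    have "z \<omega> \<le> (\<integral>\<^sup>+s\<in>{0..T}. ennreal ((norm (Z' s \<omega>))\<^sup>2) \<partial>lborel) + (\<integral>\<^sup>+s\<in>{0..T}. ennreal ((norm (Z0' s \<omega>))\<^sup>2) \<partial>lborel)"
      if "\<omega> \<in> space M" for \<omega>
    proof -
      note sec[OF that, measurable]
      have "z \<omega> \<le> (\<integral>\<^sup>+s. ennreal ((norm (Z' s \<omega>))\<^sup>2) * indicator {0..T} s + ennreal ((norm (Z0' s \<omega>))\<^sup>2) * indicator {0..T} s \<partial>lborel)"
        unfolding z_eq using t by (intro nn_integral_mono) (auto split: split_indicator)
      then show ?thesis by (subst (asm) nn_integral_add) measurable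
    qed
    then have "(\<integral>\<^sup>+\<omega>. z \<omega> \<partial>M) \<le> (\<integral>\<^sup>+\<omega>. (\<integral>\<^sup>+s\<in>{0..T}. ennreal ((norm (Z' s \<omega>))\<^sup>2) \<partial>lborel) + (\<integral>\<^sup>+s\<in>{0..T}. ennreal ((norm (Z0' s \<omega>))\<^sup>2) \<partial>lborel) \<partial>M)"
      by (rule nn_integral_mono)
    also have "\<dots> = (\<integral>\<^sup>+\<omega>. (\<integral>\<^sup>+s\<in>{0..T}. ennreal ((norm (Z' s \<omega>))\<^sup>2) \<partial>lborel) \<partial>M) + (\<integral>\<^sup>+\<omega>. (\<integral>\<^sup>+s\<in>{0..T}. ennreal ((norm (Z0' s \<omega>))\<^sup>2) \<partial>lborel) \<partial>M)"
      by (rule nn_integral_add) measurable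
    also have "(\<integral>\<^sup>+\<omega>. (\<integral>\<^sup>+s\<in>{0..T}. ennreal ((norm (Z' s \<omega>))\<^sup>2) \<partial>lborel) \<partial>M) = (\<integral>\<^sup>+\<omega>. (\<integral>\<^sup>+s\<in>{0..T}. ennreal ((norm (Z s \<omega>))\<^sup>2) \<partial>lborel) \<partial>M)"
      by (intro nn_integral_cong) (auto simp: Z' split: split_indicator)
    also have "(\<integral>\<^sup>+\<omega>. (\<integral>\<^sup>+s\<in>{0..T}. ennreal ((norm (Z0' s \<omega>))\<^sup>2) \<partial>lborel) \<partial>M) = (\<integral>\<^sup>+\<omega>. (\<integral>\<^sup>+s\<in>{0..T}. ennreal ((norm (Z0 s \<omega>))\<^sup>2) \<partial>lborel) \<partial>M)"
      by (intro nn_integral_cong) (auto simp: Z' split: split_indicator)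
    finally show ?thesis using Z Z0 by (auto simp: H2_space_def order.strict_trans1)
  qed
  let ?D = "\<lambda>\<omega>. (J b \<omega> - J t \<omega>) + (J0 b \<omega> - J0 t \<omega>)"
  have step: "AE \<omega> in M. ennreal ((norm (Y t \<omega> + ?D \<omega>))\<^sup>2) \<le> 2 * ennreal ((norm (Y b \<omega>))\<^sup>2) + 2 * (ennreal (b - t) * (ennreal L * (\<Gamma> \<omega> + z \<omega>)))"
    using g eq bound AE_space
  proof eventually_elim
    case (elim \<omega>)
    note sec[OF elim(4), measurable]
    have int: "set_integrable lborel {t..b} (g \<omega>)" "set_integrable lborel {b..T} (g \<omega>)"
      using t by (auto intro: set_integrable_subset[OF elim(1)])
    have "(LINT s:{t..T}|lborel. g \<omega> s) = (LINT s:{t..b}|lborel. g \<omega> s) + (LINT s:{b..T}|lborel. g \<omega> s)"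
    proof -
      have "(LINT s:{t..T}|lborel. g \<omega> s) = (LINT s:{t..b} \<union> {b..T}|lborel. g \<omega> s)" using t by (simp add: ivl_disj_un_two_touch)
      also have "\<dots> = (LINT s:{t..b}|lborel. g \<omega> s) + (LINT s:{b..T}|lborel. g \<omega> s)"
        by (rule set_integral_Un_AE[OF _ _ _ int]) (use AE_lborel_singleton[of b] in \<open>auto elim: eventually_mono\<close>)
      finally show ?thesis .
    qed
    then have "Y t \<omega> + ?D \<omega> = Y b \<omega> + (LINT s:{t..b}|lborel. g \<omega> s)"
      unfolding elim(2)[rule_format, OF tT(1)] elim(2)[rule_format, OF tT(2)]
      by (simp only:) (simp add: algebra_simps)
    then have "ennreal ((norm (Y t \<omega> + ?D \<omega>))\<^sup>2) \<le> 2 * ennreal ((norm (Y b \<omega>))\<^sup>2) + 2 * ennreal ((norm (LINT s:{t..b}|lborel. g \<omega> s))\<^sup>2)"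
      by (simp only: norm_add_squared_le_ennreal)
    also have "ennreal ((norm (LINT s:{t..b}|lborel. g \<omega> s))\<^sup>2) \<le> ennreal (b - t) * (\<integral>\<^sup>+s\<in>{t..b}. ennreal ((norm (g \<omega> s))\<^sup>2) \<partial>lborel)"
      by (rule norm_set_integral_squared_le[OF int(1) t(2)])
    also have "(\<integral>\<^sup>+s\<in>{t..b}. ennreal ((norm (g \<omega> s))\<^sup>2) \<partial>lborel)
        \<le> (\<integral>\<^sup>+s. ennreal L * (G s \<omega> * indicator {t..b} s + (ennreal ((norm (Z' s \<omega>))\<^sup>2) + ennreal ((norm (Z0' s \<omega>))\<^sup>2)) * indicator {t..b} s) \<partial>lborel)"
      using elim(3) t by (intro nn_integral_mono) (auto simp: Z' split: split_indicator)
    also have "\<dots> = ennreal L * (\<Gamma> \<omega> + z \<omega>)"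
      unfolding \<Gamma>_def z_eq by (subst nn_integral_cmult, measurable, subst nn_integral_add) measurable
    finally show ?case by (simp add: mult_left_mono add_left_mono)
  qed
  \<comment> \<open>Truncation at level \<open>n\<close> makes the weighted energy of \<open>Z\<close> and \<open>Z0\<close> finite, so that it can be subtracted,
    and \<open>Y t\<close> bounded where the weight does not vanish.\<close>
  define VN where "VN = (\<lambda>(n::nat) \<omega>. if norm (Y t \<omega>) \<le> n \<and> V \<omega> \<le> n then V \<omega> else 0)"
  define XN where "XN = (\<lambda>(n::nat) \<omega>. if norm (Y t \<omega>) \<le> n then Y t \<omega> else 0)"
  have VN: "VN n \<in> borel_measurable (F t)" "0 \<le> VN n \<omega>" "VN n \<omega> \<le> n" "VN n \<omega> \<le> V \<omega>" for n \<omega>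
    using V(2) by (auto simp: VN_def)
  have XN: "XN n \<in> borel_measurable (F t)" "norm (XN n \<omega>) \<le> n" for n \<omega>
    by (auto simp: XN_def)
  note VN_meas [measurable] = measurable_from_subalg[OF subalgebra_F VN(1)]
  define B where "B = 8 * (\<integral>\<^sup>+\<omega>. ennreal (V \<omega>) * ennreal ((norm (Y b \<omega>))\<^sup>2) \<partial>M) + (\<integral>\<^sup>+\<omega>. ennreal (V \<omega>) * \<Gamma> \<omega> \<partial>M)"
  have trunc: "(\<integral>\<^sup>+\<omega>. ennreal (VN n \<omega>) * ennreal ((norm (Y t \<omega>))\<^sup>2) \<partial>M) \<le> B" for n
  proof -
    let ?a = "\<integral>\<^sup>+\<omega>. ennreal (VN n \<omega>) * ennreal ((norm (Y t \<omega>))\<^sup>2) \<partial>M"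
    let ?z = "\<integral>\<^sup>+\<omega>. ennreal (VN n \<omega>) * z \<omega> \<partial>M"
    let ?\<Gamma> = "\<integral>\<^sup>+\<omega>. ennreal (VN n \<omega>) * \<Gamma> \<omega> \<partial>M"
    let ?b = "\<integral>\<^sup>+\<omega>. ennreal (VN n \<omega>) * ennreal ((norm (Y b \<omega>))\<^sup>2) \<partial>M"
    have "?z \<le> (\<integral>\<^sup>+\<omega>. ennreal n * z \<omega> \<partial>M)" by (intro nn_integral_mono mult_right_mono ennreal_leI VN(3)) auto
    also have "\<dots> < \<infinity>" using z_fin by (simp add: nn_integral_cmult ennreal_mult_less_top)
    finally have zfin: "?z < \<infinity>" .
    have "?a + ?z = (\<integral>\<^sup>+\<omega>. ennreal (VN n \<omega>) * (ennreal ((norm (XN n \<omega>))\<^sup>2) + z \<omega>) \<partial>M)"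
    proof -
      have "?a + ?z = (\<integral>\<^sup>+\<omega>. ennreal (VN n \<omega>) * ennreal ((norm (Y t \<omega>))\<^sup>2) + ennreal (VN n \<omega>) * z \<omega> \<partial>M)"
        by (rule nn_integral_add[symmetric]) measurable
      also have "\<dots> = (\<integral>\<^sup>+\<omega>. ennreal (VN n \<omega>) * (ennreal ((norm (XN n \<omega>))\<^sup>2) + z \<omega>) \<partial>M)"
        by (intro nn_integral_cong) (auto simp: VN_def XN_def distrib_left)
      finally show ?thesis .
    qed
    also have "\<dots> \<le> 4 * (\<integral>\<^sup>+\<omega>. ennreal (VN n \<omega>) * ennreal ((norm (XN n \<omega> + (J b \<omega> - J t \<omega>) + (J0 b \<omega> - J0 t \<omega>)))\<^sup>2) \<partial>M)"
      unfolding z_def by (rule ito_energy[OF J J0 progZ t VN(1-3) XN])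
    also have "(\<integral>\<^sup>+\<omega>. ennreal (VN n \<omega>) * ennreal ((norm (XN n \<omega> + (J b \<omega> - J t \<omega>) + (J0 b \<omega> - J0 t \<omega>)))\<^sup>2) \<partial>M)
      \<le> (\<integral>\<^sup>+\<omega>. 2 * (ennreal (VN n \<omega>) * ennreal ((norm (Y b \<omega>))\<^sup>2)) + 2 * ennreal (b - t) * ennreal L * (ennreal (VN n \<omega>) * \<Gamma> \<omega> + ennreal (VN n \<omega>) * z \<omega>) \<partial>M)"
    proof (rule nn_integral_mono_AE, use step in eventually_elim)
      case (elim \<omega>)
      show ?case
      proof (cases "VN n \<omega> = 0")
        case False
        then have "XN n \<omega> = Y t \<omega>" by (auto simp: VN_def XN_def split: if_splits)
        then have "ennreal (VN n \<omega>) * ennreal ((norm (XN n \<omega> + (J b \<omega> - J t \<omega>) + (J0 b \<omega> - J0 t \<omega>)))\<^sup>2)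
          \<le> ennreal (VN n \<omega>) * (2 * ennreal ((norm (Y b \<omega>))\<^sup>2) + 2 * (ennreal (b - t) * (ennreal L * (\<Gamma> \<omega> + z \<omega>))))"
          using elim by (intro mult_left_mono) (auto simp: add.assoc)
        also have "\<dots> = 2 * (ennreal (VN n \<omega>) * ennreal ((norm (Y b \<omega>))\<^sup>2)) + 2 * ennreal (b - t) * ennreal L * (ennreal (VN n \<omega>) * \<Gamma> \<omega> + ennreal (VN n \<omega>) * z \<omega>)"
          by (simp only: distrib_left mult_ac add_ac)
        finally show ?thesis .
      qed simp
    qed
    also have "\<dots> = 2 * ?b + 2 * ennreal (b - t) * ennreal L * (?\<Gamma> + ?z)"
      by (subst nn_integral_add, measurable, subst (1 2) nn_integral_cmult, measurable, subst nn_integral_add) measurable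
    finally have "?a + ?z \<le> 4 * (2 * ?b + 2 * ennreal (b - t) * ennreal L * (?\<Gamma> + ?z))" by (simp add: mult_left_mono)
    also have "\<dots> = 8 * ?b + (8 * ennreal (b - t) * ennreal L) * (?\<Gamma> + ?z)"
    proof -
      have 8: "(4::ennreal) * 2 = 8" by simp
      show ?thesis unfolding distrib_left[of 4] mult.assoc[symmetric] 8 ..
    qed
    finally have "?a \<le> 8 * ?b + ?\<Gamma>"
    proof (rule ennreal_absorb)
      have "0 \<le> 8 * L" "0 \<le> b - t" using t L by auto
      then have "ennreal (8 * L * (b - t)) = ennreal 8 * ennreal L * ennreal (b - t)"
        using L by (simp only: ennreal_mult zero_le_numeral)
      then have "8 * ennreal (b - t) * ennreal L = ennreal (8 * L * (b - t))"
        by (simp only: ennreal_numeral mult_ac)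
      also have "\<dots> \<le> 1" using small by simp
      finally show "8 * ennreal (b - t) * ennreal L \<le> 1" .
    qed (rule zfin)
    also have "\<dots> \<le> B"
      unfolding B_def by (intro add_mono mult_left_mono nn_integral_mono mult_right_mono ennreal_leI VN(4)) auto
    finally show ?thesis .
  qed
  have "(\<integral>\<^sup>+\<omega>. ennreal (V \<omega>) * ennreal ((norm (Y t \<omega>))\<^sup>2) \<partial>M) \<le> B"
  proof (rule nn_integral_le_of_eventually_eq[OF _ _ trunc])
    show "AE \<omega> in M. \<forall>\<^sub>F n in sequentially. ennreal (VN n \<omega>) * ennreal ((norm (Y t \<omega>))\<^sup>2) = ennreal (V \<omega>) * ennreal ((norm (Y t \<omega>))\<^sup>2)"
    proof (rule AE_I2)
      fix \<omega>
      show "\<forall>\<^sub>F n in sequentially. ennreal (VN n \<omega>) * ennreal ((norm (Y t \<omega>))\<^sup>2) = ennreal (V \<omega>) * ennreal ((norm (Y t \<omega>))\<^sup>2)"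
        using eventually_ge_at_top[of "nat \<lceil>max (norm (Y t \<omega>)) (V \<omega>)\<rceil>"]
      proof eventually_elim
        case (elim n)
        then have "max (norm (Y t \<omega>)) (V \<omega>) \<le> n" by linarith
        then show ?case by (simp add: VN_def)
      qed
    qed
  qed measurable
  then show ?thesis by (simp add: B_def \<Gamma>_def)
qed

text \<open>
  A weight known at time \<open>t\<close> is known at all later times, so the short-time estimate can be iterated up
  to \<open>T\<close>; each step costs a factor \<open>8\<close>.
\<close>

lemma weighted_estimate:
  fixes Z Z0 :: "real \<Rightarrow> 'a \<times> 'b \<Rightarrow> real^'d^'m::finite" and \<xi> :: "'a \<times> 'b \<Rightarrow> real^'m"
  assumes J: "has_ito_integral M F T (\<lambda>t \<omega>. W t (snd \<omega>)) Z J"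
    and J0: "has_ito_integral M F T (\<lambda>t \<omega>. W0 t (fst \<omega>)) Z0 J0"
    and Z: "Z \<in> H2_space M F T" and Z0: "Z0 \<in> H2_space M F T"
    and Y: "\<And>t. t \<in> {0..T} \<Longrightarrow> Y t \<in> borel_measurable (F t)"
    and g: "AE \<omega> in M. set_integrable lborel {0..T} (g \<omega>)"
    and eq: "AE \<omega> in M. \<forall>t\<in>{0..T}.
               Y t \<omega> = \<xi> \<omega> + (LINT s:{t..T}|lborel. g \<omega> s) - (J T \<omega> - J t \<omega>) - (J0 T \<omega> - J0 t \<omega>)"
    and G: "(\<lambda>(\<omega>, s). G s \<omega>) \<in> borel_measurable (M \<Otimes>\<^sub>M lborel)"
    and L: "0 \<le> L"
    and bound: "AE \<omega> in M. \<forall>s\<in>{0..T}. ennreal ((norm (g \<omega> s))\<^sup>2)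
        \<le> ennreal L * (G s \<omega> + (ennreal ((norm (Z s \<omega>))\<^sup>2) + ennreal ((norm (Z0 s \<omega>))\<^sup>2)))"
  obtains K :: real where "1 \<le> K" and "\<And>t V. t \<in> {0..T} \<Longrightarrow> V \<in> borel_measurable (F t) \<Longrightarrow> (\<And>\<omega>. 0 \<le> V \<omega>) \<Longrightarrow>
    (\<integral>\<^sup>+\<omega>. ennreal (V \<omega>) * ennreal ((norm (Y t \<omega>))\<^sup>2) \<partial>M)
    \<le> ennreal K * ((\<integral>\<^sup>+\<omega>. ennreal (V \<omega>) * ennreal ((norm (\<xi> \<omega>))\<^sup>2) \<partial>M)
      + (\<integral>\<^sup>+\<omega>. ennreal (V \<omega>) * (\<integral>\<^sup>+s\<in>{t..T}. G s \<omega> \<partial>lborel) \<partial>M))"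
proof -
  define h where "h = 1 / (8 * (L + 1))"
  have h: "0 < h" using L by (simp add: h_def)
  have Lh: "8 * L * h \<le> 1" using L by (simp add: h_def field_simps)
  note short = weighted_estimate_short[OF J J0 Z Z0 Y g eq G L bound]
  have iter: "(\<integral>\<^sup>+\<omega>. ennreal (V \<omega>) * ennreal ((norm (Y t \<omega>))\<^sup>2) \<partial>M)
    \<le> ennreal (8 ^ n) * ((\<integral>\<^sup>+\<omega>. ennreal (V \<omega>) * ennreal ((norm (\<xi> \<omega>))\<^sup>2) \<partial>M)
      + (\<integral>\<^sup>+\<omega>. ennreal (V \<omega>) * (\<integral>\<^sup>+s\<in>{t..T}. G s \<omega> \<partial>lborel) \<partial>M))"
    if "t \<in> {0..T}" "T - t \<le> n * h" "V \<in> borel_measurable (F t)" "\<And>\<omega>. 0 \<le> V \<omega>" for n t V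
    using that
  proof (induction n arbitrary: t)
    case 0
    then have "t = T" by auto
    have "(\<integral>\<^sup>+\<omega>. ennreal (V \<omega>) * ennreal ((norm (Y t \<omega>))\<^sup>2) \<partial>M) = (\<integral>\<^sup>+\<omega>. ennreal (V \<omega>) * ennreal ((norm (\<xi> \<omega>))\<^sup>2) \<partial>M)"
    proof (rule nn_integral_cong_AE, use eq in eventually_elim)
      case (elim \<omega>)
      have "(LINT s:{T..T}|lborel. g \<omega> s) = 0"
        unfolding set_lebesgue_integral_def
        by (rule integral_eq_zero_AE, use AE_lborel_singleton[of T] in eventually_elim) (simp add: indicator_def)
      then have "Y t \<omega> = \<xi> \<omega>" using elim \<open>t \<in> {0..T}\<close> \<open>t = T\<close> by simp
      then show ?case by simp
    qed
    then show ?case by simp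
  next
    case (Suc n)
    define b where "b = min (t + h) T"
    have b: "0 \<le> t" "t \<le> b" "b \<le> T" "b - t \<le> h" "b \<in> {0..T}" using Suc.prems(1) h by (auto simp: b_def)
    have "8 * L * (b - t) \<le> 8 * L * h" using b L by (intro mult_left_mono) auto
    then have small: "8 * L * (b - t) \<le> 1" using Lh by linarith
    have bn: "T - b \<le> n * h" using Suc.prems(2) h by (auto simp: b_def algebra_simps min_def)
    let ?X = "\<integral>\<^sup>+\<omega>. ennreal (V \<omega>) * ennreal ((norm (\<xi> \<omega>))\<^sup>2) \<partial>M"
    let ?G = "\<lambda>t b. \<integral>\<^sup>+\<omega>. ennreal (V \<omega>) * (\<integral>\<^sup>+s\<in>{t..b}. G s \<omega> \<partial>lborel) \<partial>M"
    have VF: "V \<in> borel_measurable (F b)" using Suc.prems(3) b BF.F_measurable_mono by blast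
    note [measurable] = BF.F_measurable[OF VF] G
    have split: "?G t b + ?G b T = ?G t T"
    proof -
      have "?G t b + ?G b T = (\<integral>\<^sup>+\<omega>. ennreal (V \<omega>) * (\<integral>\<^sup>+s\<in>{t..b}. G s \<omega> \<partial>lborel) + ennreal (V \<omega>) * (\<integral>\<^sup>+s\<in>{b..T}. G s \<omega> \<partial>lborel) \<partial>M)"
        by (rule nn_integral_add[symmetric]) measurable
      also have "\<dots> = ?G t T"
      proof (rule nn_integral_cong)
        fix \<omega> assume "\<omega> \<in> space M"
        then have [measurable]: "(\<lambda>s. G s \<omega>) \<in> borel_measurable lborel" using measurable_Pair2[OF G] by simp
        have "(\<integral>\<^sup>+s\<in>{t..b}. G s \<omega> \<partial>lborel) + (\<integral>\<^sup>+s\<in>{b..T}. G s \<omega> \<partial>lborel) = (\<integral>\<^sup>+s. G s \<omega> * indicator {t..b} s + G s \<omega> * indicator {b..T} s \<partial>lborel)"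
          by (rule nn_integral_add[symmetric]) measurable
        also have "\<dots> = (\<integral>\<^sup>+s\<in>{t..T}. G s \<omega> \<partial>lborel)"
          by (rule nn_integral_cong_AE, use AE_lborel_singleton[of b] in eventually_elim) (use b in \<open>auto split: split_indicator\<close>)
        finally show "ennreal (V \<omega>) * (\<integral>\<^sup>+s\<in>{t..b}. G s \<omega> \<partial>lborel) + ennreal (V \<omega>) * (\<integral>\<^sup>+s\<in>{b..T}. G s \<omega> \<partial>lborel) = ennreal (V \<omega>) * (\<integral>\<^sup>+s\<in>{t..T}. G s \<omega> \<partial>lborel)"
          by (simp add: distrib_left[symmetric])
      qed
      finally show ?thesis .
    qed
    have one: "1 \<le> (8::ennreal) * ennreal (8 ^ n)"
    proof -
      have "(8::ennreal) * ennreal (8 ^ n) = ennreal (8 ^ Suc n)" by (simp add: ennreal_mult')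
      moreover have "ennreal 1 \<le> ennreal (8 ^ Suc n)" by (intro ennreal_leI one_le_power) auto
      ultimately show ?thesis by simp
    qed
    have "(\<integral>\<^sup>+\<omega>. ennreal (V \<omega>) * ennreal ((norm (Y t \<omega>))\<^sup>2) \<partial>M) \<le> 8 * (\<integral>\<^sup>+\<omega>. ennreal (V \<omega>) * ennreal ((norm (Y b \<omega>))\<^sup>2) \<partial>M) + ?G t b"
      using short[OF _ b(1-3) small Suc.prems(3,4)] by simp
    also have "(\<integral>\<^sup>+\<omega>. ennreal (V \<omega>) * ennreal ((norm (Y b \<omega>))\<^sup>2) \<partial>M) \<le> ennreal (8 ^ n) * (?X + ?G b T)"
      by (rule Suc.IH[OF b(5) bn VF Suc.prems(4)])
    also have "8 * (ennreal (8 ^ n) * (?X + ?G b T)) + ?G t b \<le> 8 * ennreal (8 ^ n) * (?X + ?G b T) + 8 * ennreal (8 ^ n) * ?G t b"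
      using mult_right_mono[OF one, of "?G t b"] by (simp add: mult.assoc add_left_mono)
    also have "\<dots> = 8 * ennreal (8 ^ n) * (?X + (?G t b + ?G b T))" by (simp only: distrib_left add_ac)
    also have "\<dots> = ennreal (8 ^ Suc n) * (?X + ?G t T)" by (simp add: split ennreal_mult')
    finally show ?case by (simp add: mult_left_mono add_right_mono)
  qed
  define n where "n = nat \<lceil>T / h\<rceil>"
  have "T / h \<le> n" unfolding n_def by linarith
  then have n: "T \<le> n * h" using h by (simp add: field_simps)
  show thesis
    by (rule that[of "8 ^ n"]) (use iter[of _ n] n in \<open>auto intro: one_le_power\<close>)
qed

end

section \<open>Gronwall, Young and pathwise maximal inequalities\<close>

lemma nn_integral_exp_backward:
  fixes c \<kappa> t T :: real
  assumes "0 \<le> c" "0 < \<kappa>" "t \<le> T"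
  shows "(\<integral>\<^sup>+s\<in>{t..T}. ennreal (c * exp (2 * \<kappa> * (T - s))) \<partial>lborel)
    = ennreal (c / (2 * \<kappa>) * (exp (2 * \<kappa> * (T - t)) - 1))"
proof -
  have "(\<integral>\<^sup>+s\<in>{t..T}. ennreal (c * exp (2 * \<kappa> * (T - s))) \<partial>lborel)
      = ennreal (- c / (2 * \<kappa>) * exp (2 * \<kappa> * (T - T)) - (- c / (2 * \<kappa>) * exp (2 * \<kappa> * (T - t))))"
    using assms by (intro nn_integral_FTC_Icc) (auto intro!: derivative_eq_intros)
  also have "- c / (2 * \<kappa>) * exp (2 * \<kappa> * (T - T)) - (- c / (2 * \<kappa>) * exp (2 * \<kappa> * (T - t)))
      = c / (2 * \<kappa>) * (exp (2 * \<kappa> * (T - t)) - 1)"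
    by (simp add: right_diff_distrib)
  finally show ?thesis .
qed

text \<open>
  The integral inequality is stated for measurable majorants \<open>b\<close> of \<open>a\<close>, because \<open>a\<close> itself may fail to
  be measurable. Inserting the majorant \<open>c * exp (2 * \<kappa> * (T - t))\<close> halves the share of the a priori
  bound \<open>B\<close> in the constant \<open>c\<close>, so that only the contribution of \<open>D\<close> survives the iteration.
\<close>

lemma gronwall_backward:
  fixes a :: "real \<Rightarrow> ennreal" and B D \<kappa> :: real
  assumes \<kappa>: "0 < \<kappa>" and D: "0 \<le> D" and B: "0 \<le> B"
    and bdd: "\<And>t. t \<in> {0..T} \<Longrightarrow> a t \<le> ennreal B"
    and self: "\<And>t b. t \<in> {0..T} \<Longrightarrow> b \<in> borel_measurable borel \<Longrightarrow> (\<And>s. s \<in> {0..T} \<Longrightarrow> a s \<le> b s) \<Longrightarrow>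
      a t \<le> ennreal D + ennreal \<kappa> * (\<integral>\<^sup>+s\<in>{t..T}. b s \<partial>lborel)"
    and t: "t \<in> {0..T}"
  shows "a t \<le> ennreal (2 * D * exp (2 * \<kappa> * T))"
proof -
  have iter: "a t \<le> ennreal ((2 * D + B / 2 ^ n) * exp (2 * \<kappa> * (T - t)))" if "t \<in> {0..T}" for n t
    using that
  proof (induction n arbitrary: t)
    case 0
    have "B * 1 \<le> (2 * D + B) * exp (2 * \<kappa> * (T - t))"
      using 0 \<kappa> D B by (intro mult_mono) auto
    then have "ennreal B \<le> ennreal ((2 * D + B) * exp (2 * \<kappa> * (T - t)))" by (intro ennreal_leI) simp
    with bdd[OF 0] have "a t \<le> ennreal ((2 * D + B) * exp (2 * \<kappa> * (T - t)))" by (rule order_trans)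
    then show ?case by simp
  next
    case (Suc n)
    let ?c = "2 * D + B / 2 ^ n"
    let ?e = "exp (2 * \<kappa> * (T - t))"
    have c: "0 \<le> ?c" using D B by simp
    have e: "1 \<le> ?e" using Suc.prems \<kappa> by simp
    have I: "(\<integral>\<^sup>+s\<in>{t..T}. ennreal (?c * exp (2 * \<kappa> * (T - s))) \<partial>lborel) = ennreal (?c / (2 * \<kappa>) * (?e - 1))"
      using Suc.prems \<kappa> c by (intro nn_integral_exp_backward) auto
    have "a t \<le> ennreal D + ennreal \<kappa> * (\<integral>\<^sup>+s\<in>{t..T}. ennreal (?c * exp (2 * \<kappa> * (T - s))) \<partial>lborel)"
      by (intro self Suc) measurable
    also have "\<dots> = ennreal (D + \<kappa> * (?c / (2 * \<kappa>) * (?e - 1)))"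
      unfolding I using \<kappa> D c e by (simp add: ennreal_plus[symmetric] ennreal_mult'[symmetric] del: ennreal_plus)
    also have "\<kappa> * (?c / (2 * \<kappa>) * (?e - 1)) = ?c / 2 * (?e - 1)" using \<kappa> by simp
    also have "D + ?c / 2 * (?e - 1) \<le> (2 * D + B / 2 ^ Suc n) * ?e"
    proof -
      have alg: "D + (2 * D + r) / 2 * (e - 1) \<le> (2 * D + r / 2) * e" if "0 \<le> e" "0 \<le> r" for e r :: real
        using mult_nonneg_nonneg[OF D that(1)] that by (simp add: field_simps)
      show ?thesis using alg[of ?e "B / 2 ^ n"] B by (simp add: mult.commute[of _ 2])
    qed
    finally show ?case by (simp add: ennreal_leI)
  qed
  have "a t \<le> ennreal ((2 * D + 0) * exp (2 * \<kappa> * (T - t)))"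
  proof (rule LIMSEQ_le_const)
    show "(\<lambda>n. ennreal ((2 * D + B / 2 ^ n) * exp (2 * \<kappa> * (T - t)))) \<longlonglongrightarrow> ennreal ((2 * D + 0) * exp (2 * \<kappa> * (T - t)))"
      by (intro tendsto_intros LIMSEQ_divide_realpow_zero) auto
  qed (use iter[OF t] in auto)
  also have "\<dots> \<le> ennreal (2 * D * exp (2 * \<kappa> * T))"
    using t \<kappa> D by (intro ennreal_leI) (auto intro!: mult_left_mono)
  finally show ?thesis .
qed

text \<open>
  A truncation of \<open>x powr (q - 1)\<close> which grows so slowly that \<open>x * truncated_power q N x\<close> is of linear growth.
\<close>

definition truncated_power :: "real \<Rightarrow> real \<Rightarrow> real \<Rightarrow> real" where
  "truncated_power q N x = min x N powr (q - 1)"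

lemma truncated_power_measurable [measurable]: "truncated_power q N \<in> borel_measurable borel"
  unfolding truncated_power_def by measurable

text \<open>
  If \<open>y \<le> \<epsilon> x\<close>, the first term dominates. Otherwise \<open>x \<le> y / \<epsilon>\<close>, and monotonicity of the truncated power
  gives the second term.
\<close>

lemma truncated_power_young:
  assumes q: "1 \<le> q" and N: "0 \<le> N" and \<epsilon>: "0 < \<epsilon>" "\<epsilon> \<le> 1" and xy: "0 \<le> x" "0 \<le> y"
  shows "truncated_power q N x * y
    \<le> \<epsilon> * (x * truncated_power q N x) + (1 / \<epsilon>) powr (q - 1) * (y * truncated_power q N y)"
proof (cases "y \<le> \<epsilon> * x")
  case True
  have "truncated_power q N x * y \<le> truncated_power q N x * (\<epsilon> * x)"
    using True by (intro mult_left_mono) (auto simp: truncated_power_def)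
  moreover have "0 \<le> (1 / \<epsilon>) powr (q - 1) * (y * truncated_power q N y)"
    using xy by (simp add: truncated_power_def)
  ultimately show ?thesis by (simp add: mult_ac)
next
  case False
  then have "x \<le> 1 / \<epsilon> * y" using \<epsilon> by (simp add: field_simps)
  moreover have "N \<le> 1 / \<epsilon> * N" using N \<epsilon> by (simp add: field_simps mult_left_le)
  ultimately have "min x N \<le> 1 / \<epsilon> * min y N" using \<epsilon> by (auto simp: min_def split: if_splits)
  then have "truncated_power q N x \<le> (1 / \<epsilon> * min y N) powr (q - 1)"
    unfolding truncated_power_def using q N xy by (intro powr_mono2) auto
  also have "\<dots> = (1 / \<epsilon>) powr (q - 1) * truncated_power q N y"
    unfolding truncated_power_def using \<epsilon> xy N by (intro powr_mult)
  finally have "truncated_power q N x * y \<le> (1 / \<epsilon>) powr (q - 1) * truncated_power q N y * y"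
    using xy by (intro mult_right_mono)
  moreover have "0 \<le> \<epsilon> * (x * truncated_power q N x)" using xy \<epsilon> by (simp add: truncated_power_def)
  ultimately show ?thesis by (simp add: mult_ac)
qed

text \<open>
  The truncation is inactive at a level above both arguments.
\<close>

lemma power_young:
  fixes x y q \<epsilon> :: real
  assumes q: "1 < q" and \<epsilon>: "0 < \<epsilon>" "\<epsilon> \<le> 1" and xy: "0 \<le> x" "0 \<le> y"
  shows "x powr (q - 1) * y \<le> \<epsilon> * x powr q + (1 / \<epsilon>) powr (q - 1) * y powr q"
proof -
  have "x * x powr (q - 1) = x powr q" "y * y powr (q - 1) = y powr q"
    using xy powr_mult_base[of x "q - 1"] powr_mult_base[of y "q - 1"] by auto
  then show ?thesis
    using truncated_power_young[of q "max x y" \<epsilon> x y] assms by (simp add: truncated_power_def)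
qed

lemma powr_diff_le:
  fixes a b q :: real
  assumes q: "1 < q" and ab: "0 \<le> b" "b \<le> a"
  shows "a powr q - b powr q \<le> q / (q - 1) * (a * (a powr (q - 1) - b powr (q - 1)))"
proof -
  have "a * b powr (q - 1) \<le> a powr q / q + (b powr (q - 1)) powr (q / (q - 1)) / (q / (q - 1))"
    using ab q by (intro Youngs_inequality) (auto simp: field_simps)
  also have "(b powr (q - 1)) powr (q / (q - 1)) = b powr q" using q by (simp add: powr_powr)
  finally have "q * (a * b powr (q - 1)) \<le> a powr q + (q - 1) * b powr q"
    using q by (simp add: field_simps)
  moreover have "a * a powr (q - 1) = a powr q" using ab powr_mult_base[of a "q - 1"] by simp
  ultimately have "(q - 1) * (a powr q - b powr q) \<le> q * (a * (a powr (q - 1) - b powr (q - 1)))"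
    by (simp add: algebra_simps)
  then show ?thesis using q by (simp add: field_simps)
qed

primrec running_max :: "(nat \<Rightarrow> real) \<Rightarrow> nat \<Rightarrow> real" where
  "running_max x 0 = x 0"
| "running_max x (Suc k) = max (running_max x k) (x (Suc k))"

text \<open>
  The increments of the \<open>(q - 1)\<close>-st power of the running maximum, started from \<open>0\<close> before time \<open>0\<close>.
\<close>

definition running_increment :: "real \<Rightarrow> (nat \<Rightarrow> real) \<Rightarrow> nat \<Rightarrow> real" where
  "running_increment q x k = (case k of 0 \<Rightarrow> x 0 powr (q - 1)
     | Suc j \<Rightarrow> running_max x (Suc j) powr (q - 1) - running_max x j powr (q - 1))"

lemma running_max_ge: "k \<le> n \<Longrightarrow> x k \<le> running_max x n"
  by (induction n) (auto simp: le_Suc_eq max_def)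

lemma running_max_attained: "\<exists>k\<le>n. running_max x n = x k"
  by (induction n) (auto simp: max_def le_Suc_eq)

lemma running_max_nonneg: "(\<And>k. 0 \<le> x k) \<Longrightarrow> 0 \<le> running_max x n"
  using running_max_ge[of 0 n x] order_trans by blast

lemma running_increment_nonneg: "1 < q \<Longrightarrow> (\<And>k. 0 \<le> x k) \<Longrightarrow> 0 \<le> running_increment q x k"
  by (cases k) (auto simp: running_increment_def running_max_nonneg intro!: powr_mono2)

lemma sum_running_increment: "(\<Sum>k\<le>n. running_increment q x k) = running_max x n powr (q - 1)"
  by (induction n) (auto simp: running_increment_def)

text \<open>
  A pathwise form of Doob's maximal inequality. The running maximum grows only at those \<open>k\<close> at which
  it equals \<open>x k\<close>, and there its \<open>q\<close>-th power grows at most by \<open>q / (q - 1) * x k\<close> times the growth of its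
  \<open>(q - 1)\<close>-st power.
\<close>

lemma running_max_powr_le:
  assumes q: "1 < q" and x: "\<And>k. 0 \<le> x k"
  shows "running_max x n powr q \<le> q / (q - 1) * (\<Sum>k\<le>n. x k * running_increment q x k)"
proof (induction n)
  case 0
  have "x 0 powr q = 1 * (x 0 * x 0 powr (q - 1))" using x[of 0] powr_mult_base[of "x 0" "q - 1"] by simp
  also have "\<dots> \<le> q / (q - 1) * (x 0 * x 0 powr (q - 1))" using q x by (intro mult_right_mono) auto
  finally show ?case by (simp add: running_increment_def)
next
  case (Suc n)
  have "running_max x (Suc n) powr q - running_max x n powr q
    \<le> q / (q - 1) * (x (Suc n) * running_increment q x (Suc n))"
  proof (cases "x (Suc n) \<le> running_max x n")
    case True
    then show ?thesis by (simp add: running_increment_def max_def)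
  next
    case False
    then show ?thesis using powr_diff_le[OF q running_max_nonneg[of x n, OF x], of "x (Suc n)"]
      by (simp add: running_increment_def max_def)
  qed
  then show ?case using Suc by (simp add: distrib_left)
qed

text \<open>
  The grid of mesh \<open>1 / (n + 1)\<close>, stopped at \<open>T\<close>.
\<close>

definition grid :: "real \<Rightarrow> nat \<Rightarrow> nat \<Rightarrow> real" where
  "grid T n k = min T (real k / real (Suc n))"

lemma grid_in: "0 \<le> T \<Longrightarrow> grid T n k \<in> {0..T}" by (simp add: grid_def)

lemma grid_tendsto:
  assumes s: "s \<in> {0..T}"
  shows "(\<lambda>n. grid T n (nat \<lfloor>s * real (Suc n)\<rfloor>)) \<longlonglongrightarrow> s"
proof -
  have near: "\<bar>grid T n (nat \<lfloor>s * real (Suc n)\<rfloor>) - s\<bar> \<le> 1 / real (Suc n)" for n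
  proof -
    define k where "k = nat \<lfloor>s * real (Suc n)\<rfloor>"
    have "real k = of_int \<lfloor>s * real (Suc n)\<rfloor>" unfolding k_def using s by simp
    then have "real k \<le> s * real (Suc n)" "s * real (Suc n) \<le> real k + 1" by linarith+
    then have "real k / real (Suc n) \<le> s" "s \<le> real k / real (Suc n) + 1 / real (Suc n)"
      by (simp_all add: add_divide_distrib[symmetric] pos_le_divide_eq pos_divide_le_eq del: of_nat_Suc)
    then show ?thesis using s unfolding k_def[symmetric] grid_def by auto
  qed
  have "(\<lambda>n. 1 / real (Suc n)) \<longlonglongrightarrow> 0" by (rule LIMSEQ_Suc[OF lim_const_over_n])
  then have "(\<lambda>n. grid T n (nat \<lfloor>s * real (Suc n)\<rfloor>) - s) \<longlonglongrightarrow> 0"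
    by (rule Lim_null_comparison[rotated]) (use near in auto)
  then show ?thesis by (simp add: LIM_zero_iff)
qed

lemma ennreal_mult_le_add:
  fixes v y a b :: real
  assumes "v * y \<le> a + b" "0 \<le> v" "0 \<le> y" "0 \<le> a" "0 \<le> b"
  shows "ennreal v * ennreal y \<le> ennreal a + ennreal b"
  using assms by (simp add: ennreal_mult[symmetric] ennreal_plus[symmetric] ennreal_leI del: ennreal_plus)

section \<open>Higher moments from weighted bounds\<close>

text \<open>
  A nonnegative process that is dominated, under all weights known at time \<open>t\<close>, by \<open>\<zeta>\<close> and the future of
  a process \<open>G\<close>. The last assumption says that, whenever Young's inequality is applied, \<open>G s\<close> behaves
  like \<open>\<phi> s\<close> plus twice \<open>A s\<close>. In the application one copy of \<open>A s\<close> is \<open>A s\<close> itself and the other is its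
  conditional mean given the common noise, which is not a function of \<open>A s\<close>.
\<close>

locale weighted_bound = prob_space M
  for M :: "'w measure" and F :: "real \<Rightarrow> 'w measure" and T K R :: real
    and A :: "real \<Rightarrow> 'w \<Rightarrow> real" and \<zeta> :: "'w \<Rightarrow> real" and \<phi> :: "real \<Rightarrow> 'w \<Rightarrow> real"
    and G :: "real \<Rightarrow> 'w \<Rightarrow> ennreal" +
  assumes T: "0 < T" and K: "1 \<le> K" and R: "0 \<le> R"
    and subalg: "subalgebra M (F t)" and mono: "s \<le> t \<Longrightarrow> sets (F s) \<subseteq> sets (F t)"
    and A: "t \<in> {0..T} \<Longrightarrow> A t \<in> borel_measurable (F t)" "0 \<le> A t \<omega>"
    and A_mean: "t \<in> {0..T} \<Longrightarrow> (\<integral>\<^sup>+\<omega>. ennreal (A t \<omega>) \<partial>M) \<le> ennreal R"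
    and \<zeta>: "\<zeta> \<in> borel_measurable M" "0 \<le> \<zeta> \<omega>"
    and \<phi>: "(\<lambda>(\<omega>, s). \<phi> s \<omega>) \<in> borel_measurable (M \<Otimes>\<^sub>M lborel)" "0 \<le> \<phi> s \<omega>"
    and G: "(\<lambda>(\<omega>, s). G s \<omega>) \<in> borel_measurable (M \<Otimes>\<^sub>M lborel)"
    and weighted: "t \<in> {0..T} \<Longrightarrow> V \<in> borel_measurable (F t) \<Longrightarrow> (\<And>\<omega>. 0 \<le> V \<omega>) \<Longrightarrow>
      (\<integral>\<^sup>+\<omega>. ennreal (V \<omega>) * ennreal (A t \<omega>) \<partial>M)
        \<le> ennreal K * ((\<integral>\<^sup>+\<omega>. ennreal (V \<omega>) * ennreal (\<zeta> \<omega>) \<partial>M)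
          + (\<integral>\<^sup>+\<omega>. ennreal (V \<omega>) * (\<integral>\<^sup>+s\<in>{t..T}. G s \<omega> \<partial>lborel) \<partial>M))"
    and G_young: "s \<in> {0..T} \<Longrightarrow> (X :: 'w \<Rightarrow> real) \<in> borel_measurable M \<Longrightarrow> (\<And>\<omega>. 0 \<le> X \<omega>) \<Longrightarrow>
      v \<in> borel_measurable borel \<Longrightarrow> \<alpha> \<in> borel_measurable borel \<Longrightarrow> \<beta> \<in> borel_measurable borel \<Longrightarrow>
      (\<And>x. 0 \<le> x \<Longrightarrow> 0 \<le> v x) \<Longrightarrow> (\<And>x. 0 \<le> x \<Longrightarrow> 0 \<le> \<alpha> x) \<Longrightarrow> (\<And>x. 0 \<le> x \<Longrightarrow> 0 \<le> \<beta> x) \<Longrightarrow>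
      (\<And>x y :: real. 0 \<le> x \<Longrightarrow> 0 \<le> y \<Longrightarrow> v x * y \<le> \<alpha> x + \<beta> y) \<Longrightarrow>
      (\<integral>\<^sup>+\<omega>. ennreal (v (X \<omega>)) * G s \<omega> \<partial>M)
        \<le> 3 * (\<integral>\<^sup>+\<omega>. ennreal (\<alpha> (X \<omega>)) \<partial>M) + (\<integral>\<^sup>+\<omega>. ennreal (\<beta> (\<phi> s \<omega>)) \<partial>M)
          + 2 * (\<integral>\<^sup>+\<omega>. ennreal (\<beta> (A s \<omega>)) \<partial>M)"
begin

abbreviation data_moment :: "(real \<Rightarrow> real) \<Rightarrow> ennreal" where
  "data_moment \<beta> \<equiv> (\<integral>\<^sup>+\<omega>. ennreal (\<beta> (\<zeta> \<omega>)) \<partial>M) + (\<integral>\<^sup>+s\<in>{0..T}. (\<integral>\<^sup>+\<omega>. ennreal (\<beta> (\<phi> s \<omega>)) \<partial>M) \<partial>lborel)"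

abbreviation future :: "real \<Rightarrow> 'w \<Rightarrow> ennreal" where
  "future t \<omega> \<equiv> \<integral>\<^sup>+s\<in>{t..T}. G s \<omega> \<partial>lborel"

lemma \<phi>_slice: "\<phi> s \<in> borel_measurable M"
  using measurable_Pair1[OF \<phi>(1), of s] by simp

lemma \<phi>_moment_measurable:
  assumes [measurable]: "\<beta> \<in> borel_measurable borel"
  shows "(\<lambda>s. \<integral>\<^sup>+\<omega>. ennreal (\<beta> (\<phi> s \<omega>)) \<partial>M) \<in> borel_measurable lborel"
proof -
  have [measurable]: "(\<lambda>(s, \<omega>). \<phi> s \<omega>) \<in> borel_measurable (lborel \<Otimes>\<^sub>M M)"
    using measurable_pair_swap[OF \<phi>(1)] by (simp add: case_prod_beta')
  show ?thesis by measurable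
qed

lemma A_measurable: "t \<in> {0..T} \<Longrightarrow> A t \<in> borel_measurable M"
  by (rule measurable_from_subalg[OF subalg A(1)])

text \<open>
  Young's inequality under the expectation at each time, followed by Tonelli's theorem. The measurable
  bound \<open>b\<close> stands in for the moments of \<open>A\<close>, as functions of time.
\<close>

lemma young_estimate:
  fixes v \<alpha> \<beta> :: "real \<Rightarrow> real" and b :: "real \<Rightarrow> ennreal"
  assumes t: "t \<in> {0..T}" and X: "X \<in> borel_measurable M" "\<And>\<omega>. 0 \<le> X \<omega>"
    and meas: "v \<in> borel_measurable borel" "\<alpha> \<in> borel_measurable borel" "\<beta> \<in> borel_measurable borel"
    and nonneg: "\<And>x. 0 \<le> x \<Longrightarrow> 0 \<le> v x" "\<And>x. 0 \<le> x \<Longrightarrow> 0 \<le> \<alpha> x" "\<And>x. 0 \<le> x \<Longrightarrow> 0 \<le> \<beta> x"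
    and young: "\<And>x y. 0 \<le> x \<Longrightarrow> 0 \<le> y \<Longrightarrow> v x * y \<le> \<alpha> x + \<beta> y"
    and b: "b \<in> borel_measurable borel" "\<And>s. s \<in> {0..T} \<Longrightarrow> (\<integral>\<^sup>+\<omega>. ennreal (\<beta> (A s \<omega>)) \<partial>M) \<le> b s"
  shows "(\<integral>\<^sup>+\<omega>. ennreal (v (X \<omega>)) * ennreal (\<zeta> \<omega>) \<partial>M) + (\<integral>\<^sup>+\<omega>. ennreal (v (X \<omega>)) * future t \<omega> \<partial>M)
    \<le> ennreal (1 + 3 * T) * (\<integral>\<^sup>+\<omega>. ennreal (\<alpha> (X \<omega>)) \<partial>M)
      + data_moment \<beta>
      + 2 * (\<integral>\<^sup>+s\<in>{t..T}. b s \<partial>lborel)"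
proof -
  interpret L: pair_sigma_finite M "lborel :: real measure" ..
  note [measurable] = X(1) meas b(1) \<zeta>(1) \<phi>(1) G
  note [measurable] = \<phi>_moment_measurable[OF meas(3)]
  have le: "ennreal (v x) * ennreal y \<le> ennreal (\<alpha> x) + ennreal (\<beta> y)" if "0 \<le> x" "0 \<le> y" for x y
    using young[OF that] nonneg that by (intro ennreal_mult_le_add) auto
  let ?\<alpha> = "\<integral>\<^sup>+\<omega>. ennreal (\<alpha> (X \<omega>)) \<partial>M"
  have 1: "(\<integral>\<^sup>+\<omega>. ennreal (v (X \<omega>)) * ennreal (\<zeta> \<omega>) \<partial>M) \<le> ?\<alpha> + (\<integral>\<^sup>+\<omega>. ennreal (\<beta> (\<zeta> \<omega>)) \<partial>M)"
    by (subst nn_integral_add[symmetric]; (intro nn_integral_mono le X \<zeta>)?; measurable)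
  have "(\<integral>\<^sup>+\<omega>. ennreal (v (X \<omega>)) * future t \<omega> \<partial>M)
      = (\<integral>\<^sup>+\<omega>. (\<integral>\<^sup>+s. ennreal (v (X \<omega>)) * (G s \<omega> * indicator {t..T} s) \<partial>lborel) \<partial>M)"
  proof (rule nn_integral_cong)
    fix \<omega> assume "\<omega> \<in> space M"
    then have [measurable]: "(\<lambda>s. G s \<omega>) \<in> borel_measurable lborel" using measurable_Pair2[OF G] by simp
    show "ennreal (v (X \<omega>)) * future t \<omega>
       = (\<integral>\<^sup>+s. ennreal (v (X \<omega>)) * (G s \<omega> * indicator {t..T} s) \<partial>lborel)"
      by (rule nn_integral_cmult[symmetric]) measurable
  qed
  also have "\<dots> = (\<integral>\<^sup>+s. (\<integral>\<^sup>+\<omega>. ennreal (v (X \<omega>)) * (G s \<omega> * indicator {t..T} s) \<partial>M) \<partial>lborel)"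
    by (rule L.Fubini'[symmetric]) measurable
  also have "\<dots> \<le> (\<integral>\<^sup>+s. 3 * ?\<alpha> * indicator {t..T} s + (\<integral>\<^sup>+\<omega>. ennreal (\<beta> (\<phi> s \<omega>)) \<partial>M) * indicator {0..T} s + 2 * (b s * indicator {t..T} s) \<partial>lborel)"
  proof (rule nn_integral_mono)
    fix s
    show "(\<integral>\<^sup>+\<omega>. ennreal (v (X \<omega>)) * (G s \<omega> * indicator {t..T} s) \<partial>M)
      \<le> 3 * ?\<alpha> * indicator {t..T} s + (\<integral>\<^sup>+\<omega>. ennreal (\<beta> (\<phi> s \<omega>)) \<partial>M) * indicator {0..T} s + 2 * (b s * indicator {t..T} s)"
    proof (cases "s \<in> {t..T}")
      case True
      then have s: "s \<in> {0..T}" using t by auto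
      have "(\<integral>\<^sup>+\<omega>. ennreal (v (X \<omega>)) * G s \<omega> \<partial>M) \<le> 3 * ?\<alpha> + (\<integral>\<^sup>+\<omega>. ennreal (\<beta> (\<phi> s \<omega>)) \<partial>M)
          + 2 * (\<integral>\<^sup>+\<omega>. ennreal (\<beta> (A s \<omega>)) \<partial>M)"
        by (rule G_young[where v = v and \<alpha> = \<alpha> and \<beta> = \<beta> and X = X]) (fact s X meas nonneg young)+
      also have "\<dots> \<le> 3 * ?\<alpha> + (\<integral>\<^sup>+\<omega>. ennreal (\<beta> (\<phi> s \<omega>)) \<partial>M) + 2 * b s"
        by (intro add_left_mono mult_left_mono b s) auto
      finally show ?thesis using True s by (simp only: indicator_simps mult_1_right)
    qed simp
  qed
  also have "\<dots> = 3 * ?\<alpha> * ennreal (T - t) + (\<integral>\<^sup>+s\<in>{0..T}. (\<integral>\<^sup>+\<omega>. ennreal (\<beta> (\<phi> s \<omega>)) \<partial>M) \<partial>lborel) + 2 * (\<integral>\<^sup>+s\<in>{t..T}. b s \<partial>lborel)"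
  proof -
    have "(\<integral>\<^sup>+s. 3 * ?\<alpha> * indicator {t..T} s \<partial>lborel) = 3 * ?\<alpha> * ennreal (T - t)"
      using t by (subst nn_integral_cmult_indicator) auto
    moreover have "(\<integral>\<^sup>+s. 2 * (b s * indicator {t..T} s) \<partial>lborel) = 2 * (\<integral>\<^sup>+s\<in>{t..T}. b s \<partial>lborel)"
      by (rule nn_integral_cmult) measurable
    moreover have "(\<integral>\<^sup>+s. 3 * ?\<alpha> * indicator {t..T} s + (\<integral>\<^sup>+\<omega>. ennreal (\<beta> (\<phi> s \<omega>)) \<partial>M) * indicator {0..T} s + 2 * (b s * indicator {t..T} s) \<partial>lborel)
      = (\<integral>\<^sup>+s. 3 * ?\<alpha> * indicator {t..T} s + (\<integral>\<^sup>+\<omega>. ennreal (\<beta> (\<phi> s \<omega>)) \<partial>M) * indicator {0..T} s \<partial>lborel)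
        + (\<integral>\<^sup>+s. 2 * (b s * indicator {t..T} s) \<partial>lborel)"
      by (rule nn_integral_add) measurable
    moreover have "(\<integral>\<^sup>+s. 3 * ?\<alpha> * indicator {t..T} s + (\<integral>\<^sup>+\<omega>. ennreal (\<beta> (\<phi> s \<omega>)) \<partial>M) * indicator {0..T} s \<partial>lborel)
      = (\<integral>\<^sup>+s. 3 * ?\<alpha> * indicator {t..T} s \<partial>lborel) + (\<integral>\<^sup>+s\<in>{0..T}. (\<integral>\<^sup>+\<omega>. ennreal (\<beta> (\<phi> s \<omega>)) \<partial>M) \<partial>lborel)"
      by (rule nn_integral_add) measurable
    ultimately show ?thesis by (simp only:)
  qed
  also have "3 * ?\<alpha> * ennreal (T - t) \<le> 3 * ?\<alpha> * ennreal T"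
    using t by (intro mult_left_mono ennreal_leI) auto
  finally have 2: "(\<integral>\<^sup>+\<omega>. ennreal (v (X \<omega>)) * future t \<omega> \<partial>M)
     \<le> 3 * ?\<alpha> * ennreal T + (\<integral>\<^sup>+s\<in>{0..T}. (\<integral>\<^sup>+\<omega>. ennreal (\<beta> (\<phi> s \<omega>)) \<partial>M) \<partial>lborel) + 2 * (\<integral>\<^sup>+s\<in>{t..T}. b s \<partial>lborel)"
    by (simp only: add_right_mono)
  have "ennreal (1 + 3 * T) * ?\<alpha> = ?\<alpha> + 3 * ?\<alpha> * ennreal T"
  proof -
    have "ennreal (1 + 3 * T) = 1 + 3 * ennreal T" using T by (simp add: ennreal_plus ennreal_mult')
    then show ?thesis by (simp only: distrib_right mult_1_left, simp only: mult_ac)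
  qed
  then show ?thesis using add_mono[OF 1 2] by (simp only: add_ac)
qed

end

lemma ennreal_absorb_half:
  fixes a x :: ennreal
  assumes "a \<le> ennreal (1 / 2) * a + x" and "a < \<infinity>"
  shows "a \<le> 2 * x"
proof (cases x)
  case (real r)
  obtain y where y: "a = ennreal y" "0 \<le> y" using assms(2) by (cases a) auto
  have "ennreal (1 / 2) * ennreal y = ennreal (1 / 2 * y)" by (rule ennreal_mult'[symmetric]) simp
  then have "ennreal (1 / 2) * a + x = ennreal (1 / 2 * y + r)"
    unfolding y(1) real(2) using y(2) real(1) by (subst ennreal_plus) (auto simp del: ennreal_half)
  then have "ennreal y \<le> ennreal (1 / 2 * y + r)" using assms(1) y by simp
  then have "y \<le> 1 / 2 * y + r" using y(2) real by (subst (asm) ennreal_le_iff) auto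
  then have "ennreal y \<le> ennreal (2 * r)" by (intro ennreal_leI) simp
  then show ?thesis using y real by (simp add: ennreal_mult')
qed (simp add: ennreal_mult_top)

context weighted_bound
begin

text \<open>
  With this \<open>\<epsilon>\<close>, the terms on the right of the weighted bound that repeat the left-hand side add up to
  half of it.
\<close>

lemma absorption_constant:
  assumes "1 \<le> c"
  defines "\<epsilon> \<equiv> 1 / (2 * (c * (1 + 3 * T)))"
  shows "0 < \<epsilon>" "\<epsilon> \<le> 1" "c * ((1 + 3 * T) * \<epsilon>) = 1 / 2"
proof -
  have "1 * 1 \<le> c * (1 + 3 * T)" using assms T by (intro mult_mono) auto
  then show "0 < \<epsilon>" "\<epsilon> \<le> 1" "c * ((1 + 3 * T) * \<epsilon>) = 1 / 2"
    using assms T by (auto simp: \<epsilon>_def field_simps)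
qed

text \<open>
  The weighted bound is tested with the truncated power \<open>v\<close> of \<open>A t\<close>. After absorption, the moment
  \<open>E[A\<^sub>t v(A\<^sub>t)]\<close> satisfies a linear integral inequality whose constants are free of the truncation level,
  whereas its finiteness comes from the truncation.
\<close>

lemma moment_bound:
  assumes q: "1 < q"
    and data: "data_moment (\<lambda>x. x powr q) = ennreal c0"
    and c0: "0 \<le> c0"
  obtains Q where "0 \<le> Q" "\<And>t. t \<in> {0..T} \<Longrightarrow> (\<integral>\<^sup>+\<omega>. ennreal (A t \<omega> powr q) \<partial>M) \<le> ennreal Q"
proof -
  define \<epsilon> where "\<epsilon> = 1 / (2 * (K * (1 + 3 * T)))"
  note \<epsilon> = absorption_constant[OF K, folded \<epsilon>_def]
  define e where "e = (1 / \<epsilon>) powr (q - 1)"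
  have e: "0 < e" using \<epsilon> by (simp add: e_def)
  define D where "D = 2 * (K * (e * c0))"
  define \<kappa> where "\<kappa> = 2 * (K * (2 * e))"
  have \<kappa>: "0 < \<kappa>" and D: "0 \<le> D" using K e c0 by (auto simp: \<kappa>_def D_def)
  have trunc: "(\<integral>\<^sup>+\<omega>. ennreal (A t \<omega> * truncated_power q (real N) (A t \<omega>)) \<partial>M) \<le> ennreal (2 * D * exp (2 * \<kappa> * T))"
    if t: "t \<in> {0..T}" for t N
  proof -
    define v where "v = truncated_power q (real N)"
    define a where "a = (\<lambda>t. \<integral>\<^sup>+\<omega>. ennreal (A t \<omega> * v (A t \<omega>)) \<partial>M)"
    have v_meas [measurable]: "v \<in> borel_measurable borel" by (simp add: v_def)
    have v0: "0 \<le> v x" for x by (simp add: v_def truncated_power_def)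
    have young: "v x * y \<le> \<epsilon> * (x * v x) + e * (y * v y)" if "0 \<le> x" "0 \<le> y" for x y
      unfolding v_def e_def using q \<epsilon> that by (intro truncated_power_young) auto
    have bdd: "a t \<le> ennreal (real N powr (q - 1) * R)" if t: "t \<in> {0..T}" for t
    proof -
      note [measurable] = A_measurable[OF t]
      have "a t \<le> (\<integral>\<^sup>+\<omega>. ennreal (real N powr (q - 1)) * ennreal (A t \<omega>) \<partial>M)"
        unfolding a_def
      proof (rule nn_integral_mono)
        fix \<omega>
        have "v (A t \<omega>) \<le> real N powr (q - 1)"
          unfolding v_def truncated_power_def using A(2) q by (intro powr_mono2) auto
        then have "A t \<omega> * v (A t \<omega>) \<le> real N powr (q - 1) * A t \<omega>"
          using A(2)[of t \<omega>] by (subst mult.commute) (rule mult_right_mono)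
        then show "ennreal (A t \<omega> * v (A t \<omega>)) \<le> ennreal (real N powr (q - 1)) * ennreal (A t \<omega>)"
          by (simp add: ennreal_mult'[symmetric] ennreal_leI)
      qed
      also have "\<dots> = ennreal (real N powr (q - 1)) * (\<integral>\<^sup>+\<omega>. ennreal (A t \<omega>) \<partial>M)" by (rule nn_integral_cmult) measurable
      also have "\<dots> \<le> ennreal (real N powr (q - 1)) * ennreal R" by (intro mult_left_mono A_mean t) auto
      finally show ?thesis by (simp add: ennreal_mult')
    qed
    have self: "a t \<le> ennreal D + ennreal \<kappa> * (\<integral>\<^sup>+s\<in>{t..T}. b s \<partial>lborel)"
      if t: "t \<in> {0..T}" and b: "b \<in> borel_measurable borel" "\<And>s. s \<in> {0..T} \<Longrightarrow> a s \<le> b s" for t b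
    proof -
      note [measurable] = A_measurable[OF t] b(1) \<zeta>(1)
      have \<beta>: "(\<integral>\<^sup>+\<omega>. ennreal (e * (y \<omega> * v (y \<omega>))) \<partial>M) \<le> ennreal e * (\<integral>\<^sup>+\<omega>. ennreal (y \<omega> powr q) \<partial>M)"
        if "y \<in> borel_measurable M" "\<And>\<omega>. 0 \<le> y \<omega>" for y
      proof -
        note [measurable] = that(1)
        have "y \<omega> * v (y \<omega>) \<le> y \<omega> powr q" for \<omega>
        proof -
          have "v (y \<omega>) \<le> y \<omega> powr (q - 1)"
            unfolding v_def truncated_power_def using q that(2)[of \<omega>] by (intro powr_mono2) auto
          then have "y \<omega> * v (y \<omega>) \<le> y \<omega> * y \<omega> powr (q - 1)" using that(2) by (intro mult_left_mono)
          then show ?thesis using powr_mult_base[of "y \<omega>" "q - 1"] that(2)[of \<omega>] by simp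
        qed
        then have "(\<integral>\<^sup>+\<omega>. ennreal (e * (y \<omega> * v (y \<omega>))) \<partial>M) \<le> (\<integral>\<^sup>+\<omega>. ennreal e * ennreal (y \<omega> powr q) \<partial>M)"
          using e by (intro nn_integral_mono) (simp add: ennreal_mult'[symmetric] ennreal_leI)
        then show ?thesis by (simp add: nn_integral_cmult)
      qed
      have \<beta>_data: "data_moment (\<lambda>y. e * (y * v (y)))
         \<le> ennreal (e * c0)"
      proof -
        have "(\<integral>\<^sup>+s\<in>{0..T}. (\<integral>\<^sup>+\<omega>. ennreal (e * (\<phi> s \<omega> * v (\<phi> s \<omega>))) \<partial>M) \<partial>lborel)
          \<le> (\<integral>\<^sup>+s. ennreal e * ((\<integral>\<^sup>+\<omega>. ennreal (\<phi> s \<omega> powr q) \<partial>M) * indicator {0..T} s) \<partial>lborel)"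
          using \<beta>[OF \<phi>_slice \<phi>(2)] by (intro nn_integral_mono) (auto split: split_indicator)
        also have "\<dots> = ennreal e * (\<integral>\<^sup>+s\<in>{0..T}. (\<integral>\<^sup>+\<omega>. ennreal (\<phi> s \<omega> powr q) \<partial>M) \<partial>lborel)"
          by (intro nn_integral_cmult borel_measurable_times_ennreal \<phi>_moment_measurable) simp_all
        finally have "data_moment (\<lambda>y. e * (y * v (y)))
          \<le> ennreal e * (\<integral>\<^sup>+\<omega>. ennreal (\<zeta> \<omega> powr q) \<partial>M) + ennreal e * (\<integral>\<^sup>+s\<in>{0..T}. (\<integral>\<^sup>+\<omega>. ennreal (\<phi> s \<omega> powr q) \<partial>M) \<partial>lborel)"
          by (intro add_mono \<beta> \<zeta>)
        also have "\<dots> = ennreal (e * c0)"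
          unfolding distrib_left[symmetric] data using e by (simp add: ennreal_mult')
        finally show ?thesis .
      qed
      have b': "(\<lambda>s. ennreal e * b s) \<in> borel_measurable borel"
        "(\<integral>\<^sup>+\<omega>. ennreal (e * (A s \<omega> * v (A s \<omega>))) \<partial>M) \<le> ennreal e * b s" if "s \<in> {0..T}" for s
      proof -
        note [measurable] = A_measurable[OF that]
        have "(\<integral>\<^sup>+\<omega>. ennreal (e * (A s \<omega> * v (A s \<omega>))) \<partial>M) = ennreal e * a s"
          unfolding a_def using e A(2) v0 by (subst nn_integral_cmult[symmetric]) (auto simp: ennreal_mult')
        then show "(\<integral>\<^sup>+\<omega>. ennreal (e * (A s \<omega> * v (A s \<omega>))) \<partial>M) \<le> ennreal e * b s"
          using b(2)[OF that] by (simp add: mult_left_mono)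
      qed measurable
      have "a t = (\<integral>\<^sup>+\<omega>. ennreal (v (A t \<omega>)) * ennreal (A t \<omega>) \<partial>M)"
        unfolding a_def using A(2) v0 by (intro nn_integral_cong) (simp add: ennreal_mult' mult.commute)
      also have "\<dots> \<le> ennreal K * ((\<integral>\<^sup>+\<omega>. ennreal (v (A t \<omega>)) * ennreal (\<zeta> \<omega>) \<partial>M)
          + (\<integral>\<^sup>+\<omega>. ennreal (v (A t \<omega>)) * future t \<omega> \<partial>M))"
        by (rule weighted[OF t measurable_compose[OF A(1)[OF t] v_meas] v0])
      also have "\<dots> \<le> ennreal K * (ennreal (1 + 3 * T) * (\<integral>\<^sup>+\<omega>. ennreal (\<epsilon> * (A t \<omega> * v (A t \<omega>))) \<partial>M)
        + data_moment (\<lambda>y. e * (y * v (y)))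
        + 2 * (\<integral>\<^sup>+s\<in>{t..T}. ennreal e * b s \<partial>lborel))"
        by (intro mult_left_mono young_estimate[where \<alpha> = "\<lambda>x. \<epsilon> * (x * v x)" and \<beta> = "\<lambda>y. e * (y * v y)"] t young b'(1)[OF t] b'(2) A(2) v0 A_measurable)
           (use e \<epsilon> v0 in auto)
      also have "\<dots> \<le> ennreal K * (ennreal (1 + 3 * T) * (ennreal \<epsilon> * a t) + ennreal (e * c0) + 2 * (ennreal e * (\<integral>\<^sup>+s\<in>{t..T}. b s \<partial>lborel)))"
      proof -
        have "(\<integral>\<^sup>+\<omega>. ennreal (\<epsilon> * (A t \<omega> * v (A t \<omega>))) \<partial>M) = ennreal \<epsilon> * a t"
          unfolding a_def using \<epsilon> A(2) v0 by (subst nn_integral_cmult[symmetric]) (auto simp: ennreal_mult')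
        moreover have "(\<integral>\<^sup>+s\<in>{t..T}. ennreal e * b s \<partial>lborel) = ennreal e * (\<integral>\<^sup>+s\<in>{t..T}. b s \<partial>lborel)"
          by (subst nn_integral_cmult[symmetric]) (auto simp: mult.assoc)
        ultimately show ?thesis using \<beta>_data by (intro mult_left_mono add_mono) auto
      qed
      also have "\<dots> = ennreal (1 / 2) * a t + (ennreal (K * (e * c0)) + ennreal (K * (2 * e)) * (\<integral>\<^sup>+s\<in>{t..T}. b s \<partial>lborel))"
      proof -
        have "ennreal K * (ennreal (1 + 3 * T) * (ennreal \<epsilon> * a t)) = ennreal (K * ((1 + 3 * T) * \<epsilon>)) * a t"
          using K T \<epsilon> by (simp add: ennreal_mult mult.assoc del: ennreal_plus)
        moreover have "ennreal K * (2 * (ennreal e * (\<integral>\<^sup>+s\<in>{t..T}. b s \<partial>lborel))) = ennreal (K * (2 * e)) * (\<integral>\<^sup>+s\<in>{t..T}. b s \<partial>lborel)"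
          using K e by (simp add: ennreal_mult mult.assoc)
        moreover have "ennreal K * ennreal (e * c0) = ennreal (K * (e * c0))"
          using K e c0 by (simp add: ennreal_mult)
        ultimately show ?thesis unfolding \<epsilon>(3) by (simp only: distrib_left add.assoc)
      qed
      finally have "a t \<le> ennreal (1 / 2) * a t + (ennreal (K * (e * c0)) + ennreal (K * (2 * e)) * (\<integral>\<^sup>+s\<in>{t..T}. b s \<partial>lborel))" .
      moreover have "a t < \<infinity>" using bdd[OF t] by (simp add: order.strict_trans1)
      ultimately have "a t \<le> 2 * (ennreal (K * (e * c0)) + ennreal (K * (2 * e)) * (\<integral>\<^sup>+s\<in>{t..T}. b s \<partial>lborel))"
        by (rule ennreal_absorb_half)
      also have "\<dots> = ennreal D + ennreal \<kappa> * (\<integral>\<^sup>+s\<in>{t..T}. b s \<partial>lborel)"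
      proof -
        have "ennreal D = 2 * ennreal (K * (e * c0))" "ennreal \<kappa> = 2 * ennreal (K * (2 * e))"
          unfolding D_def \<kappa>_def by (subst ennreal_mult', simp, simp)+
        then show ?thesis by (simp only: distrib_left mult.assoc)
      qed
      finally show ?thesis .
    qed
    have "a t \<le> ennreal (2 * D * exp (2 * \<kappa> * T))"
      by (rule gronwall_backward[OF \<kappa> D _ bdd self t]) (use R in auto)
    then show ?thesis by (simp add: a_def v_def)
  qed
  show thesis
  proof
    show "0 \<le> 2 * D * exp (2 * \<kappa> * T)" using D by simp
    fix t assume t: "t \<in> {0..T}"
    note [measurable] = A_measurable[OF t]
    show "(\<integral>\<^sup>+\<omega>. ennreal (A t \<omega> powr q) \<partial>M) \<le> ennreal (2 * D * exp (2 * \<kappa> * T))"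
    proof (rule nn_integral_le_of_eventually_eq[OF _ _ trunc[OF t]])
      show "AE \<omega> in M. \<forall>\<^sub>F N in sequentially. ennreal (A t \<omega> * truncated_power q (real N) (A t \<omega>)) = ennreal (A t \<omega> powr q)"
      proof (rule AE_I2)
        fix \<omega>
        show "\<forall>\<^sub>F N in sequentially. ennreal (A t \<omega> * truncated_power q (real N) (A t \<omega>)) = ennreal (A t \<omega> powr q)"
          using eventually_ge_at_top[of "nat \<lceil>A t \<omega>\<rceil>"]
        proof eventually_elim
          case (elim N)
          then have "A t \<omega> \<le> real N" by linarith
          then have "A t \<omega> * truncated_power q (real N) (A t \<omega>) = A t \<omega> powr q"
            using powr_mult_base[of "A t \<omega>" "q - 1"] A(2)[of t \<omega>] by (simp add: truncated_power_def)
          then show ?case by simp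
        qed
      qed
    qed measurable
  qed
qed

text \<open>
  The \<open>k\<close>-th increment of the power of the running maximum is known at time \<open>\<tau> k\<close> and is an admissible
  weight there. The pathwise maximal inequality sums up the resulting bounds. The weights add up to the
  \<open>(q - 1)\<close>-st power of the maximum \<open>S\<close>, and Young's inequality splits this off against the moments
  that are already bounded. The moment of \<open>S\<close> on the right is absorbed, being finite on a finite grid.
\<close>

lemma running_max_bound:
  assumes q: "1 < q"
    and data: "data_moment (\<lambda>x. x powr q) = ennreal c0"
    and c0: "0 \<le> c0"
  obtains Q where "0 \<le> Q" "\<And>\<tau> n. (\<And>k. \<tau> k \<in> {0..T}) \<Longrightarrow> incseq \<tau> \<Longrightarrow>
    (\<integral>\<^sup>+\<omega>. ennreal (running_max (\<lambda>k. A (\<tau> k) \<omega>) n powr q) \<partial>M) \<le> ennreal Q"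
proof -
  obtain Q where Q: "0 \<le> Q" "\<And>t. t \<in> {0..T} \<Longrightarrow> (\<integral>\<^sup>+\<omega>. ennreal (A t \<omega> powr q) \<partial>M) \<le> ennreal Q"
    using moment_bound[OF q data c0] by blast
  define c where "c = q / (q - 1)"
  have c: "1 \<le> c" using q by (simp add: c_def)
  have "1 * 1 \<le> c * K" using c K by (intro mult_mono) auto
  then have cK: "1 \<le> c * K" by simp
  define \<epsilon> where "\<epsilon> = 1 / (2 * (c * K * (1 + 3 * T)))"
  note \<epsilon> = absorption_constant[OF cK, folded \<epsilon>_def]
  define e where "e = (1 / \<epsilon>) powr (q - 1)"
  have e: "0 < e" using \<epsilon> by (simp add: e_def)
  \<comment> \<open>\<open>e * c0\<close> bounds the data and \<open>e * Q\<close> the moments of \<open>A\<close> after Young's inequality; the factor \<open>2\<close> in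
    front is the price of absorption.\<close>
  define Q' where "Q' = 2 * (c * K * (e * c0 + 2 * (e * Q * T)))"
  have "(\<integral>\<^sup>+\<omega>. ennreal (running_max (\<lambda>k. A (\<tau> k) \<omega>) n powr q) \<partial>M) \<le> ennreal Q'"
    if \<tau>: "\<And>k. \<tau> k \<in> {0..T}" and inc: "incseq \<tau>" for \<tau> n
  proof -
    define x where "x = (\<lambda>\<omega> k. A (\<tau> k) \<omega>)"
    define S where "S = (\<lambda>\<omega>. running_max (x \<omega>) n)"
    define V where "V = (\<lambda>k \<omega>. running_increment q (x \<omega>) k)"
    have x0: "0 \<le> x \<omega> k" for \<omega> k by (simp add: x_def A(2))
    have S0: "0 \<le> S \<omega>" for \<omega> unfolding S_def by (rule running_max_nonneg) (rule x0)
    have V0: "0 \<le> V k \<omega>" for k \<omega> unfolding V_def by (rule running_increment_nonneg[OF q]) (rule x0)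
    have Fm: "X \<in> borel_measurable (F u)" if "X \<in> borel_measurable (F s)" "s \<le> u" for X :: "'w \<Rightarrow> real" and s u
      by (rule measurable_from_subalg[OF _ that(1)]) (use subalg mono[OF that(2)] in \<open>auto simp: subalgebra_def\<close>)
    have max_meas: "(\<lambda>\<omega>. running_max (x \<omega>) k) \<in> borel_measurable (F (\<tau> k))" for k
    proof (induction k)
      case 0
      then show ?case using A(1)[OF \<tau>[of 0]] by (simp add: x_def)
    next
      case (Suc k)
      have "(\<lambda>\<omega>. running_max (x \<omega>) k) \<in> borel_measurable (F (\<tau> (Suc k)))"
        "(\<lambda>\<omega>. x \<omega> (Suc k)) \<in> borel_measurable (F (\<tau> (Suc k)))"
        using Fm[OF Suc] incseqD[OF inc, of k "Suc k"] A(1)[OF \<tau>, of "Suc k"] by (auto simp: x_def)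
      then show ?case unfolding running_max.simps by (intro borel_measurable_max)
    qed
    have V_meas: "V k \<in> borel_measurable (F (\<tau> k))" for k
    proof (cases k)
      case 0
      have [measurable]: "A (\<tau> 0) \<in> borel_measurable (F (\<tau> 0))" by (rule A(1)[OF \<tau>])
      show ?thesis unfolding 0 V_def running_increment_def x_def by simp
    next
      case (Suc j)
      have [measurable]: "(\<lambda>\<omega>. running_max (x \<omega>) j) \<in> borel_measurable (F (\<tau> (Suc j)))"
        "(\<lambda>\<omega>. running_max (x \<omega>) (Suc j)) \<in> borel_measurable (F (\<tau> (Suc j)))"
        using Fm[OF max_meas[of j]] incseqD[OF inc, of j "Suc j"] max_meas[of "Suc j"] by auto
      show ?thesis unfolding Suc V_def running_increment_def nat.case by measurable
    qed
    note VM [measurable] = measurable_from_subalg[OF subalg V_meas]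
    have AM [measurable]: "A (\<tau> k) \<in> borel_measurable M" for k by (rule A_measurable[OF \<tau>])
    have SM [measurable]: "S \<in> borel_measurable M"
      unfolding S_def by (rule measurable_from_subalg[OF subalg max_meas])
    note [measurable] = \<zeta>(1) G
    let ?S = "\<integral>\<^sup>+\<omega>. ennreal (S \<omega> powr q) \<partial>M"
    have future_meas [measurable]: "future t \<in> borel_measurable M" for t
    proof -
      have [measurable]: "{t..T} \<in> sets lborel" by simp
      show ?thesis by measurable
    qed
    have fin: "?S < \<infinity>"
    proof -
      have "?S \<le> (\<integral>\<^sup>+\<omega>. (\<Sum>k\<le>n. ennreal (A (\<tau> k) \<omega> powr q)) \<partial>M)"
      proof (rule nn_integral_mono)
        fix \<omega>
        obtain k where k: "k \<le> n" "S \<omega> = x \<omega> k" unfolding S_def using running_max_attained by blast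
        then show "ennreal (S \<omega> powr q) \<le> (\<Sum>k\<le>n. ennreal (A (\<tau> k) \<omega> powr q))"
          unfolding k(2) x_def by (intro member_le_sum) auto
      qed
      also have "\<dots> = (\<Sum>k\<le>n. \<integral>\<^sup>+\<omega>. ennreal (A (\<tau> k) \<omega> powr q) \<partial>M)" by (rule nn_integral_sum) measurable
      also have "\<dots> < \<infinity>" using le_less_trans[OF Q(2)[OF \<tau>] ennreal_less_top] by simp
      finally show ?thesis .
    qed
    have sumV: "(\<Sum>k\<le>n. ennreal (V k \<omega>)) = ennreal (S \<omega> powr (q - 1))" for \<omega>
      using sum_running_increment[of q "x \<omega>" n] V0 by (simp add: V_def S_def sum_ennreal)
    have "?S \<le> (\<integral>\<^sup>+\<omega>. ennreal c * (\<Sum>k\<le>n. ennreal (V k \<omega>) * ennreal (A (\<tau> k) \<omega>)) \<partial>M)"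
    proof (rule nn_integral_mono)
      fix \<omega>
      have "S \<omega> powr q \<le> c * (\<Sum>k\<le>n. V k \<omega> * A (\<tau> k) \<omega>)"
        using running_max_powr_le[OF q, of "x \<omega>" n] x0 by (simp add: S_def V_def c_def x_def mult.commute)
      then have "ennreal (S \<omega> powr q) \<le> ennreal (c * (\<Sum>k\<le>n. V k \<omega> * A (\<tau> k) \<omega>))" by (rule ennreal_leI)
      also have "\<dots> = ennreal c * (\<Sum>k\<le>n. ennreal (V k \<omega>) * ennreal (A (\<tau> k) \<omega>))"
        using c V0 A(2) by (simp add: ennreal_mult' sum_nonneg sum_ennreal[symmetric] del: sum_ennreal)
      finally show "ennreal (S \<omega> powr q) \<le> \<dots>" .
    qed
    also have "\<dots> = ennreal c * (\<Sum>k\<le>n. \<integral>\<^sup>+\<omega>. ennreal (V k \<omega>) * ennreal (A (\<tau> k) \<omega>) \<partial>M)"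
      by (subst nn_integral_cmult, measurable, subst nn_integral_sum) measurable
    also have "\<dots> \<le> ennreal c * (\<Sum>k\<le>n. ennreal K * ((\<integral>\<^sup>+\<omega>. ennreal (V k \<omega>) * ennreal (\<zeta> \<omega>) \<partial>M)
          + (\<integral>\<^sup>+\<omega>. ennreal (V k \<omega>) * future 0 \<omega> \<partial>M)))"
    proof (intro mult_left_mono sum_mono)
      fix k
      have "(\<integral>\<^sup>+\<omega>. ennreal (V k \<omega>) * future (\<tau> k) \<omega> \<partial>M) \<le> (\<integral>\<^sup>+\<omega>. ennreal (V k \<omega>) * future 0 \<omega> \<partial>M)"
        using \<tau>[of k] by (intro nn_integral_mono mult_left_mono) (auto split: split_indicator)
      then show "(\<integral>\<^sup>+\<omega>. ennreal (V k \<omega>) * ennreal (A (\<tau> k) \<omega>) \<partial>M) \<le> ennreal K * ((\<integral>\<^sup>+\<omega>. ennreal (V k \<omega>) * ennreal (\<zeta> \<omega>) \<partial>M)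
          + (\<integral>\<^sup>+\<omega>. ennreal (V k \<omega>) * future 0 \<omega> \<partial>M))"
        by (intro order_trans[OF weighted[OF \<tau> V_meas V0]] mult_left_mono add_left_mono) auto
    qed auto
    also have "\<dots> = ennreal (c * K) * ((\<integral>\<^sup>+\<omega>. ennreal (S \<omega> powr (q - 1)) * ennreal (\<zeta> \<omega>) \<partial>M)
          + (\<integral>\<^sup>+\<omega>. ennreal (S \<omega> powr (q - 1)) * future 0 \<omega> \<partial>M))"
    proof -
      have "(\<Sum>k\<le>n. \<integral>\<^sup>+\<omega>. ennreal (V k \<omega>) * y \<omega> \<partial>M) = (\<integral>\<^sup>+\<omega>. ennreal (S \<omega> powr (q - 1)) * y \<omega> \<partial>M)"
        if [measurable]: "y \<in> borel_measurable M" for y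
        unfolding sumV[symmetric] sum_distrib_right by (rule nn_integral_sum[symmetric]) measurable
      then show ?thesis
        using c K by (simp add: sum_distrib_left[symmetric] sum.distrib ennreal_mult mult.assoc)
    qed
    also have "\<dots> \<le> ennreal (c * K) * (ennreal (1 + 3 * T) * (\<integral>\<^sup>+\<omega>. ennreal (\<epsilon> * S \<omega> powr q) \<partial>M)
        + data_moment (\<lambda>y. e * y powr q)
        + 2 * (\<integral>\<^sup>+s\<in>{0..T}. ennreal (e * Q) \<partial>lborel))"
    proof (intro mult_left_mono young_estimate[where v = "\<lambda>x. x powr (q - 1)" and \<alpha> = "\<lambda>x. \<epsilon> * x powr q" and \<beta> = "\<lambda>y. e * y powr q"] S0 SM)
      show "x powr (q - 1) * y \<le> \<epsilon> * x powr q + e * y powr q" if "0 \<le> x" "0 \<le> y" for x y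
        unfolding e_def by (rule power_young[OF q \<epsilon>(1,2) that])
      fix s assume s: "s \<in> {0..T}"
      note [measurable] = A_measurable[OF s]
      have "(\<integral>\<^sup>+\<omega>. ennreal (e * A s \<omega> powr q) \<partial>M) = ennreal e * (\<integral>\<^sup>+\<omega>. ennreal (A s \<omega> powr q) \<partial>M)"
        using e by (subst nn_integral_cmult[symmetric]) (auto simp: ennreal_mult')
      also have "\<dots> \<le> ennreal e * ennreal Q" by (intro mult_left_mono Q(2) s) auto
      finally show "(\<integral>\<^sup>+\<omega>. ennreal (e * A s \<omega> powr q) \<partial>M) \<le> ennreal (e * Q)" using e by (simp add: ennreal_mult')
    qed (use T \<epsilon> e in auto)
    also have "\<dots> = ennreal (1 / 2) * ?S + ennreal (c * K * (e * c0 + 2 * (e * Q * T)))"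
    proof -
      have 1: "ennreal (c * K) * (ennreal (1 + 3 * T) * (\<integral>\<^sup>+\<omega>. ennreal (\<epsilon> * S \<omega> powr q) \<partial>M)) = ennreal (1 / 2) * ?S"
      proof -
        have "(\<integral>\<^sup>+\<omega>. ennreal (\<epsilon> * S \<omega> powr q) \<partial>M) = ennreal \<epsilon> * ?S"
          using \<epsilon> by (subst nn_integral_cmult[symmetric]) (auto simp: ennreal_mult')
        moreover have "ennreal (c * K) * (ennreal (1 + 3 * T) * ennreal \<epsilon>) = ennreal (1 / 2)"
          unfolding \<epsilon>(3)[symmetric] using cK T \<epsilon>(1) by (simp add: ennreal_mult del: ennreal_plus)
        ultimately show ?thesis by (simp only: mult.assoc[symmetric])
      qed
      have pull: "(\<integral>\<^sup>+\<omega>. ennreal (e * y \<omega> powr q) \<partial>M) = ennreal e * (\<integral>\<^sup>+\<omega>. ennreal (y \<omega> powr q) \<partial>M)"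
        if [measurable]: "y \<in> borel_measurable M" for y
        using e by (subst nn_integral_cmult[symmetric]) (auto simp: ennreal_mult')
      have "(\<integral>\<^sup>+s\<in>{0..T}. (\<integral>\<^sup>+\<omega>. ennreal (e * \<phi> s \<omega> powr q) \<partial>M) \<partial>lborel)
          = ennreal e * (\<integral>\<^sup>+s\<in>{0..T}. (\<integral>\<^sup>+\<omega>. ennreal (\<phi> s \<omega> powr q) \<partial>M) \<partial>lborel)"
        unfolding pull[OF \<phi>_slice] mult.assoc
        by (intro nn_integral_cmult borel_measurable_times_ennreal \<phi>_moment_measurable) simp_all
      note \<phi>_pull = this
      have 2: "data_moment (\<lambda>y. e * y powr q) = ennreal (e * c0)"
        unfolding \<phi>_pull pull[OF \<zeta>(1)] distrib_left[symmetric] data using e by (simp add: ennreal_mult')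
      have 3: "2 * (\<integral>\<^sup>+s\<in>{0..T}. ennreal (e * Q) \<partial>lborel) = ennreal (2 * (e * Q * T))"
        using T e Q(1) by (subst nn_integral_cmult_indicator) (auto simp: ennreal_mult)
      have "0 \<le> e * c0" "0 \<le> 2 * (e * Q * T)" using e c0 Q(1) T by auto
      then have "ennreal (c * K * (e * c0 + 2 * (e * Q * T))) = ennreal (c * K) * (ennreal (e * c0) + ennreal (2 * (e * Q * T)))"
        using cK by (subst ennreal_mult) (auto simp: ennreal_plus)
      then show ?thesis unfolding 2 3 by (simp only: distrib_left 1 add.assoc)
    qed
    finally have "?S \<le> 2 * ennreal (c * K * (e * c0 + 2 * (e * Q * T)))"
      by (rule ennreal_absorb_half[OF _ fin])
    then show ?thesis by (simp add: S_def x_def Q'_def ennreal_mult')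
  qed
  moreover have "0 \<le> Q'" using cK e c0 Q(1) T by (auto simp: Q'_def intro!: mult_nonneg_nonneg add_nonneg_nonneg)
  ultimately show thesis using that by blast
qed

text \<open>
  Every value of a continuous path is a limit of values on refining grids, so the supremum is at most
  the lower limit of the grid maxima, and Fatou's lemma applies.
\<close>

lemma sup_bound:
  assumes q: "1 < q"
    and data: "data_moment (\<lambda>x. x powr q) < \<infinity>"
    and cont: "AE \<omega> in M. continuous_on {0..T} (\<lambda>t. A t \<omega>)"
  shows "(\<integral>\<^sup>+\<omega>. (SUP t\<in>{0..T}. ennreal (A t \<omega> powr q)) \<partial>M) < \<infinity>"
proof -
  obtain c0 where c0: "data_moment (\<lambda>x. x powr q) = ennreal c0" "0 \<le> c0"
    using data by (cases "data_moment (\<lambda>x. x powr q)"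
        rule: ennreal_cases) auto
  obtain Q where Q: "0 \<le> Q" "\<And>\<tau> n. (\<And>k. \<tau> k \<in> {0..T}) \<Longrightarrow> incseq \<tau> \<Longrightarrow>
    (\<integral>\<^sup>+\<omega>. ennreal (running_max (\<lambda>k. A (\<tau> k) \<omega>) n powr q) \<partial>M) \<le> ennreal Q"
    using running_max_bound[OF q c0] by blast
  have grid: "grid T n k \<in> {0..T}" for n k using T by (intro grid_in) simp
  have inc: "incseq (grid T n)" for n
    unfolding grid_def by (intro incseq_SucI min.mono divide_right_mono) auto
  define S where "S = (\<lambda>n \<omega>. running_max (\<lambda>k. A (grid T n k) \<omega>) (nat \<lfloor>T * real (Suc n)\<rfloor>))"
  have S_meas: "(\<lambda>\<omega>. ennreal (S n \<omega> powr q)) \<in> borel_measurable M" for n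
  proof -
    have "(\<lambda>\<omega>. running_max (\<lambda>k. A (grid T n k) \<omega>) j) \<in> borel_measurable M" for j
    proof (induction j)
      case 0 then show ?case using A_measurable[OF grid] by simp
    next
      case (Suc j) then show ?case using A_measurable[OF grid] by (auto intro: borel_measurable_max)
    qed
    then show ?thesis unfolding S_def by measurable
  qed
  have "(\<integral>\<^sup>+\<omega>. (SUP t\<in>{0..T}. ennreal (A t \<omega> powr q)) \<partial>M) \<le> (\<integral>\<^sup>+\<omega>. liminf (\<lambda>n. ennreal (S n \<omega> powr q)) \<partial>M)"
  proof (rule nn_integral_mono_AE, use cont in eventually_elim)
    case (elim \<omega>)
    show ?case
    proof (rule SUP_least)
      fix t assume t: "t \<in> {0..T}"
      define k where "k = (\<lambda>n. nat \<lfloor>t * real (Suc n)\<rfloor>)"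
      have k_le: "k n \<le> nat \<lfloor>T * real (Suc n)\<rfloor>" for n
        unfolding k_def using t by (intro nat_mono floor_mono mult_right_mono) auto
      have lim: "(\<lambda>n. grid T n (k n)) \<longlonglongrightarrow> t"
        unfolding k_def by (rule grid_tendsto[OF t])
      have "(\<lambda>n. A (grid T n (k n)) \<omega>) \<longlonglongrightarrow> A t \<omega>"
        by (rule continuous_on_tendsto_compose[OF elim lim t]) (use grid in auto)
      then have "(\<lambda>n. ennreal (A (grid T n (k n)) \<omega> powr q)) \<longlonglongrightarrow> ennreal (A t \<omega> powr q)"
        using q A(2) by (intro tendsto_ennrealI tendsto_powr2 tendsto_const) auto
      then have "ennreal (A t \<omega> powr q) = liminf (\<lambda>n. ennreal (A (grid T n (k n)) \<omega> powr q))"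
        by (rule lim_imp_Liminf[OF trivial_limit_sequentially, symmetric])
      also have "\<dots> \<le> liminf (\<lambda>n. ennreal (S n \<omega> powr q))"
      proof (rule Liminf_mono, rule always_eventually, rule allI)
        fix n
        have "A (grid T n (k n)) \<omega> \<le> S n \<omega>" unfolding S_def
          using running_max_ge[OF k_le, of "\<lambda>k. A (grid T n k) \<omega>"] .
        then show "ennreal (A (grid T n (k n)) \<omega> powr q) \<le> ennreal (S n \<omega> powr q)"
          using q A(2) by (intro ennreal_leI powr_mono2) auto
      qed
      finally show "ennreal (A t \<omega> powr q) \<le> liminf (\<lambda>n. ennreal (S n \<omega> powr q))" .
    qed
  qed
  also have "\<dots> \<le> liminf (\<lambda>n. \<integral>\<^sup>+\<omega>. ennreal (S n \<omega> powr q) \<partial>M)" by (rule nn_integral_liminf[OF S_meas])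
  also have "\<dots> \<le> liminf (\<lambda>n. ennreal Q)"
    unfolding S_def by (intro Liminf_mono always_eventually allI Q(2) grid inc)
  also have "\<dots> < \<infinity>" by (simp add: Liminf_const)
  finally show ?thesis .
qed

end

section \<open>Conditional laws and jointly measurable versions\<close>

lemma (in complete_measure) measurable_cong_AE_complete:
  assumes f: "f \<in> M \<rightarrow>\<^sub>M N" and eq: "AE x in M. f x = g x" and g: "g \<in> space M \<rightarrow> space N"
  shows "g \<in> M \<rightarrow>\<^sub>M N"
proof (rule measurableI)
  fix B assume B: "B \<in> sets N"
  have "AE x in M. x \<in> f -` B \<inter> space M \<longleftrightarrow> x \<in> g -` B \<inter> space M"
    using eq by eventually_elim auto
  then show "g -` B \<inter> space M \<in> sets M"
    by (rule in_sets_AE) (use measurable_sets[OF f B] in auto)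
qed (use g in auto)

text \<open>
  The coupling of \<open>\<mu>\<close> with the constant \<open>0\<close> has the second moment of \<open>\<mu>\<close> as its cost.
\<close>

lemma W2_dirac_squared_le:
  fixes \<mu> :: "(real^'m::finite) measure"
  assumes \<mu>: "prob_space \<mu>" "sets \<mu> = sets borel"
  shows "ennreal ((W2 \<mu> (return borel 0))\<^sup>2) \<le> (\<integral>\<^sup>+x. ennreal ((norm x)\<^sup>2) \<partial>\<mu>)"
proof -
  interpret prob_space \<mu> by fact
  define \<pi> where "\<pi> = distr \<mu> (borel \<Otimes>\<^sub>M borel) (\<lambda>x. (x, 0 :: real^'m))"
  have idm [measurable]: "(\<lambda>x. x) \<in> \<mu> \<rightarrow>\<^sub>M borel" by (rule measurable_ident_sets[OF \<mu>(2)])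
  have pm: "(\<lambda>x. (x, 0 :: real^'m)) \<in> \<mu> \<rightarrow>\<^sub>M borel \<Otimes>\<^sub>M borel" by measurable
  have "\<pi> \<in> couplings \<mu> (return borel 0)"
    unfolding couplings_def
  proof (intro CollectI conjI)
    show "prob_space \<pi>" unfolding \<pi>_def by (rule prob_space_distr[OF pm])
    show "sets \<pi> = sets (borel \<Otimes>\<^sub>M borel)" by (simp add: \<pi>_def)
    have "distr \<pi> borel fst = distr \<mu> borel (\<lambda>x. x)"
      unfolding \<pi>_def by (subst distr_distr[OF _ pm]) (auto simp: comp_def)
    also have "\<dots> = distr \<mu> \<mu> (\<lambda>x. x)" by (rule distr_cong) (auto simp: \<mu>(2))
    finally show "distr \<pi> borel fst = \<mu>" by simp
    have "distr \<pi> borel snd = distr \<mu> borel (\<lambda>x. 0)"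
      unfolding \<pi>_def by (subst distr_distr[OF _ pm]) (auto simp: comp_def)
    then show "distr \<pi> borel snd = return borel 0" by simp
  qed
  then have "(INF \<pi>\<in>couplings \<mu> (return borel 0). \<integral>\<^sup>+(x, y). ennreal ((norm (x - y))\<^sup>2) \<partial>\<pi>)
      \<le> (\<integral>\<^sup>+(x, y). ennreal ((norm (x - y))\<^sup>2) \<partial>\<pi>)"
    by (rule INF_lower)
  also have "\<dots> = (\<integral>\<^sup>+x. ennreal ((norm x)\<^sup>2) \<partial>\<mu>)"
    unfolding \<pi>_def by (subst nn_integral_distr[OF pm]) (auto simp: case_prod_beta')
  finally show ?thesis
    unfolding W2_def by (auto simp: ennreal_enn2real_if)
qed

lemma dirac_in_P2: "return borel (0 :: real^'m::finite) \<in> P2"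
  unfolding P2_def by (auto intro: prob_space_return simp: nn_integral_return)

lemma continuous_on_set_integral_left:
  fixes g :: "real \<Rightarrow> 'a::euclidean_space"
  assumes "set_integrable lborel {a..b} g"
  shows "continuous_on {a..b} (\<lambda>t. LINT s:{t..b}|lborel. g s)"
proof -
  have "continuous_on {a..b} (\<lambda>t. integral {t..b} g)"
    by (rule indefinite_integral_continuous_1') (rule set_borel_integral_eq_integral(1)[OF assms])
  moreover have "(LINT s:{t..b}|lborel. g s) = integral {t..b} g" if "t \<in> {a..b}" for t
    using that by (intro set_borel_integral_eq_integral(2) set_integrable_subset[OF assms]) auto
  ultimately show ?thesis by (subst continuous_on_cong[OF refl, of _ _ "\<lambda>t. integral {t..b} g"]) auto
qed

lemma completion_ex_borel_measurable_vec:
  fixes g :: "'w \<Rightarrow> real^'m::finite"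
  assumes g: "g \<in> borel_measurable (completion N)"
  shows "\<exists>g'\<in>borel_measurable N. AE x in N. g x = g' x"
proof -
  have "\<exists>g'\<in>borel_measurable N. AE x in N. g x $ i = g' x" for i
    using borel_measurable_vec_nth[OF g] by (rule completion_ex_borel_measurable_real)
  then obtain h where h: "\<And>i. h i \<in> borel_measurable N" "\<And>i. AE x in N. g x $ i = h i x" by metis
  have meas: "(\<lambda>x. (\<chi> i. h i x) :: real^'m) \<in> borel_measurable N"
  proof (subst borel_measurable_euclidean_space, rule ballI)
    fix b :: "real^'m" assume "b \<in> Basis"
    then obtain i where "b = axis i 1" by (auto simp: Basis_vec_def)
    then show "(\<lambda>x. (\<chi> i. h i x) \<bullet> b) \<in> borel_measurable N" by (simp add: inner_axis h)
  qed
  have eq: "AE x in N. g x = (\<chi> i. h i x)"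
  proof -
    have "AE x in N. \<forall>i. g x $ i = h i x" using h(2) by (simp add: AE_all_countable)
    then show ?thesis by eventually_elim (simp add: vec_eq_iff)
  qed
  show ?thesis
    by (rule bexI[of _ "\<lambda>x. (\<chi> i. h i x) :: real^'m"]) (rule eq, rule meas)
qed

context common_noise_brownian
begin

lemma AE_sections:
  assumes "AE \<omega> in M0 \<Otimes>\<^sub>M M1. Q \<omega>"
  shows "AE x in M0. AE y in M1. Q (x, y)"
  using assms by (rule P.AE_pair)

lemma AE_fst:
  assumes "AE x in M0. Q x"
  shows "AE \<omega> in M. Q (fst \<omega>)"
proof -
  obtain N where N: "{x \<in> space M0. \<not> Q x} \<subseteq> N" "emeasure M0 N = 0" "N \<in> sets M0"
    using assms by (auto elim: AE_E)
  have "emeasure (M0 \<Otimes>\<^sub>M M1) (N \<times> space M1) = 0"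
    using N by (simp add: M1.emeasure_pair_measure_Times)
  then have "AE \<omega> in M0 \<Otimes>\<^sub>M M1. Q (fst \<omega>)"
    using N by (intro AE_I[of _ _ "N \<times> space M1"]) (auto simp: space_pair_measure)
  then show ?thesis unfolding M_eq by (rule AE_completion)
qed

lemma AE_M_iff: "(AE \<omega> in M. Q \<omega>) \<longleftrightarrow> (AE \<omega> in M0 \<Otimes>\<^sub>M M1. Q \<omega>)"
  unfolding M_eq by (rule AE_completion_iff)

lemma nn_integral_M: "(\<integral>\<^sup>+\<omega>. h \<omega> \<partial>M) = (\<integral>\<^sup>+\<omega>. h \<omega> \<partial>(M0 \<Otimes>\<^sub>M M1))"
  unfolding M_eq by (rule nn_integral_completion)

lemma M_measurable: "h \<in> M0 \<Otimes>\<^sub>M M1 \<rightarrow>\<^sub>M N \<Longrightarrow> h \<in> M \<rightarrow>\<^sub>M N"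
  unfolding M_eq by (rule measurable_completion)

text \<open>
  For fixed common noise \<open>x\<close>, the inner integral averages \<open>B(x, y')\<close> over a copy \<open>y'\<close> independent of \<open>y\<close>.
  The pointwise inequality between \<open>X(x, y)\<close> and \<open>B(x, y')\<close> is integrated over \<open>x\<close>, \<open>y\<close> and \<open>y'\<close>; each
  of the two terms on the right depends on one of the copies only.
\<close>

lemma decoupling_inequality:
  fixes X B :: "'a \<times> 'b \<Rightarrow> real" and v \<alpha> \<beta> :: "real \<Rightarrow> real"
  assumes X: "X \<in> borel_measurable M" "\<And>\<omega>. 0 \<le> X \<omega>"
    and B: "B \<in> borel_measurable (M0 \<Otimes>\<^sub>M M1)" "\<And>\<omega>. 0 \<le> B \<omega>"
    and meas: "v \<in> borel_measurable borel" "\<alpha> \<in> borel_measurable borel" "\<beta> \<in> borel_measurable borel"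
    and nonneg: "\<And>x. 0 \<le> x \<Longrightarrow> 0 \<le> v x" "\<And>x. 0 \<le> x \<Longrightarrow> 0 \<le> \<alpha> x" "\<And>x. 0 \<le> x \<Longrightarrow> 0 \<le> \<beta> x"
    and young: "\<And>x y. 0 \<le> x \<Longrightarrow> 0 \<le> y \<Longrightarrow> v x * y \<le> \<alpha> x + \<beta> y"
  shows "(\<integral>\<^sup>+\<omega>. ennreal (v (X \<omega>)) * (\<integral>\<^sup>+y. ennreal (B (fst \<omega>, y)) \<partial>M1) \<partial>M)
    \<le> (\<integral>\<^sup>+\<omega>. ennreal (\<alpha> (X \<omega>)) \<partial>M) + (\<integral>\<^sup>+\<omega>. ennreal (\<beta> (B \<omega>)) \<partial>M)"
proof -
  obtain X0 where X0: "X0 \<in> borel_measurable (M0 \<Otimes>\<^sub>M M1)" "AE \<omega> in M0 \<Otimes>\<^sub>M M1. X \<omega> = X0 \<omega>"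
    using X(1) completion_ex_borel_measurable_real unfolding M_eq by blast
  define X' where "X' = (\<lambda>\<omega>. max 0 (X0 \<omega>))"
  have X': "X' \<in> borel_measurable (M0 \<Otimes>\<^sub>M M1)" "AE \<omega> in M0 \<Otimes>\<^sub>M M1. X \<omega> = X' \<omega>" "0 \<le> X' \<omega>" for \<omega>
  proof -
    show "AE \<omega> in M0 \<Otimes>\<^sub>M M1. X \<omega> = X' \<omega>"
      using X0(2)
    proof eventually_elim
      case (elim \<omega>)
      then show ?case using X(2)[of \<omega>] by (simp add: X'_def)
    qed
  qed (use X0(1) in \<open>auto simp: X'_def\<close>)
  note [measurable] = X'(1) B(1) meas
  have le: "ennreal (v x) * ennreal y \<le> ennreal (\<alpha> x) + ennreal (\<beta> y)" if "0 \<le> x" "0 \<le> y" for x y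
    using young[OF that] nonneg that by (intro ennreal_mult_le_add) auto
  have Xeq: "(\<integral>\<^sup>+\<omega>. ennreal (v (X \<omega>)) * c \<omega> \<partial>(M0 \<Otimes>\<^sub>M M1)) = (\<integral>\<^sup>+\<omega>. ennreal (v (X' \<omega>)) * c \<omega> \<partial>(M0 \<Otimes>\<^sub>M M1))"
    "(\<integral>\<^sup>+\<omega>. ennreal (\<alpha> (X \<omega>)) \<partial>(M0 \<Otimes>\<^sub>M M1)) = (\<integral>\<^sup>+\<omega>. ennreal (\<alpha> (X' \<omega>)) \<partial>(M0 \<Otimes>\<^sub>M M1))" for c
    using X'(2) by (auto intro!: nn_integral_cong_AE elim!: eventually_mono)
  have [measurable]: "(\<lambda>x. \<integral>\<^sup>+y. ennreal (B (x, y)) \<partial>M1) \<in> borel_measurable M0" by measurable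
  have meas': "(\<lambda>\<omega>. ennreal (v (X' \<omega>)) * (\<integral>\<^sup>+y. ennreal (B (fst \<omega>, y)) \<partial>M1)) \<in> borel_measurable (M0 \<Otimes>\<^sub>M M1)"
    by (intro borel_measurable_times_ennreal measurable_compose[OF measurable_fst]) measurable
  have "(\<integral>\<^sup>+\<omega>. ennreal (v (X' \<omega>)) * (\<integral>\<^sup>+y. ennreal (B (fst \<omega>, y)) \<partial>M1) \<partial>(M0 \<Otimes>\<^sub>M M1))
    = (\<integral>\<^sup>+x. \<integral>\<^sup>+y. ennreal (v (X' (x, y))) * (\<integral>\<^sup>+y'. ennreal (B (x, y')) \<partial>M1) \<partial>M1 \<partial>M0)"
    using M1.nn_integral_fst[OF meas'] by simp
  also have "\<dots> \<le> (\<integral>\<^sup>+x. (\<integral>\<^sup>+y. ennreal (\<alpha> (X' (x, y))) \<partial>M1) + (\<integral>\<^sup>+y. ennreal (\<beta> (B (x, y))) \<partial>M1) \<partial>M0)"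
  proof (rule nn_integral_mono)
    fix x assume x: "x \<in> space M0"
    have [measurable]: "(\<lambda>y. X' (x, y)) \<in> borel_measurable M1" "(\<lambda>y. B (x, y)) \<in> borel_measurable M1"
      using x by measurable
    have "(\<integral>\<^sup>+y. ennreal (v (X' (x, y))) * (\<integral>\<^sup>+y'. ennreal (B (x, y')) \<partial>M1) \<partial>M1)
        \<le> (\<integral>\<^sup>+y. ennreal (\<alpha> (X' (x, y))) + (\<integral>\<^sup>+y'. ennreal (\<beta> (B (x, y'))) \<partial>M1) \<partial>M1)"
    proof (rule nn_integral_mono)
      fix y
      have "ennreal (v (X' (x, y))) * (\<integral>\<^sup>+y'. ennreal (B (x, y')) \<partial>M1)
          = (\<integral>\<^sup>+y'. ennreal (v (X' (x, y))) * ennreal (B (x, y')) \<partial>M1)"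
        by (rule nn_integral_cmult[symmetric]) measurable
      also have "\<dots> \<le> (\<integral>\<^sup>+y'. ennreal (\<alpha> (X' (x, y))) + ennreal (\<beta> (B (x, y'))) \<partial>M1)"
        by (intro nn_integral_mono le X' B)
      also have "\<dots> = ennreal (\<alpha> (X' (x, y))) + (\<integral>\<^sup>+y'. ennreal (\<beta> (B (x, y'))) \<partial>M1)"
        by (subst nn_integral_add) (auto simp: M1.emeasure_space_1)
      finally show "ennreal (v (X' (x, y))) * (\<integral>\<^sup>+y'. ennreal (B (x, y')) \<partial>M1)
          \<le> ennreal (\<alpha> (X' (x, y))) + (\<integral>\<^sup>+y'. ennreal (\<beta> (B (x, y'))) \<partial>M1)" .
    qed
    also have "\<dots> = (\<integral>\<^sup>+y. ennreal (\<alpha> (X' (x, y))) \<partial>M1) + (\<integral>\<^sup>+y. ennreal (\<beta> (B (x, y))) \<partial>M1)"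
      by (subst nn_integral_add) (auto simp: M1.emeasure_space_1)
    finally show "(\<integral>\<^sup>+y. ennreal (v (X' (x, y))) * (\<integral>\<^sup>+y'. ennreal (B (x, y')) \<partial>M1) \<partial>M1)
       \<le> (\<integral>\<^sup>+y. ennreal (\<alpha> (X' (x, y))) \<partial>M1) + (\<integral>\<^sup>+y. ennreal (\<beta> (B (x, y))) \<partial>M1)" .
  qed
  also have "\<dots> = (\<integral>\<^sup>+x. (\<integral>\<^sup>+y. ennreal (\<alpha> (X' (x, y))) \<partial>M1) \<partial>M0) + (\<integral>\<^sup>+x. (\<integral>\<^sup>+y. ennreal (\<beta> (B (x, y))) \<partial>M1) \<partial>M0)"
    by (rule nn_integral_add) measurable
  also have "\<dots> = (\<integral>\<^sup>+\<omega>. ennreal (\<alpha> (X' \<omega>)) \<partial>(M0 \<Otimes>\<^sub>M M1)) + (\<integral>\<^sup>+\<omega>. ennreal (\<beta> (B \<omega>)) \<partial>(M0 \<Otimes>\<^sub>M M1))"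
    by (subst (1 2) M1.nn_integral_fst[symmetric]) measurable
  finally show ?thesis unfolding nn_integral_M Xeq .
qed

text \<open>
  \<open>Y s\<close> is measurable with respect to the completed product only. Its sections are measurable for
  almost every \<open>x\<close>, but with an exceptional set that depends on \<open>s\<close>. Versions that are measurable with
  respect to the product itself are chosen at the countably many grid times, and continuity of the
  paths carries measurability of sections, and with it the statement on conditional laws, over to
  all times simultaneously. The lower limit of the versions is jointly measurable.
\<close>

lemma measurable_version:
  fixes Y :: "real \<Rightarrow> 'a \<times> 'b \<Rightarrow> real^'m::finite"
  assumes Y: "\<And>t. t \<in> {0..T} \<Longrightarrow> Y t \<in> borel_measurable M"
    and cont: "AE \<omega> in M. continuous_on {0..T} (\<lambda>t. Y t \<omega>)"
    and complete: "complete_measure M1"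
    and sup: "(\<integral>\<^sup>+\<omega>. (SUP t\<in>{0..T}. ennreal ((norm (Y t \<omega>))\<^sup>2)) \<partial>M) < \<infinity>"
  obtains A :: "real \<Rightarrow> 'a \<times> 'b \<Rightarrow> ennreal"
  where "(\<lambda>(s, \<omega>). A s \<omega>) \<in> borel_measurable (lborel \<Otimes>\<^sub>M (M0 \<Otimes>\<^sub>M M1))"
    and "AE \<omega> in M. \<forall>s\<in>{0..T}. A s \<omega> = ennreal ((norm (Y s \<omega>))\<^sup>2)"
    and "AE x in M0. \<forall>s\<in>{0..T}. cond_law M1 (Y s) x \<in> P2 \<and>
       ennreal ((W2 (cond_law M1 (Y s) x) (return borel 0))\<^sup>2) \<le> (\<integral>\<^sup>+y. A s (x, y) \<partial>M1)"
proof -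
  interpret C1: complete_measure M1 by fact
  have T0: "0 \<le> T" using T by simp
  define r where "r = (\<lambda>n s. nat \<lfloor>s * real (Suc n)\<rfloor>)"
  have "\<exists>g'\<in>borel_measurable (M0 \<Otimes>\<^sub>M M1). AE \<omega> in M0 \<Otimes>\<^sub>M M1. Y (grid T n k) \<omega> = g' \<omega>" for n k
    using Y[OF grid_in[OF T0, of n k]] unfolding M_eq by (rule completion_ex_borel_measurable_vec)
  then obtain Y' where Y'_meas [measurable]: "\<And>n k. Y' n k \<in> borel_measurable (M0 \<Otimes>\<^sub>M M1)"
    and Y'_eq: "\<And>n k. AE \<omega> in M0 \<Otimes>\<^sub>M M1. Y (grid T n k) \<omega> = Y' n k \<omega>" by metis
  define A where "A = (\<lambda>s \<omega>. liminf (\<lambda>n. ennreal ((norm (Y' n (r n s) \<omega>))\<^sup>2)))"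
  define S where "S = (\<lambda>\<omega>. SUP (n, k). ennreal ((norm (Y' n k \<omega>))\<^sup>2))"
  have good: "AE \<omega> in M0 \<Otimes>\<^sub>M M1. continuous_on {0..T} (\<lambda>t. Y t \<omega>) \<and> (\<forall>n k. Y (grid T n k) \<omega> = Y' n k \<omega>)"
    using cont Y'_eq unfolding AE_M_iff by (simp add: AE_all_countable)
  have lim: "(\<lambda>n. Y' n (r n s) \<omega>) \<longlonglongrightarrow> Y s \<omega>"
    if "continuous_on {0..T} (\<lambda>t. Y t \<omega>) \<and> (\<forall>n k. Y (grid T n k) \<omega> = Y' n k \<omega>)" "s \<in> {0..T}" for \<omega> s
  proof -
    have "(\<lambda>n. Y (grid T n (r n s)) \<omega>) \<longlonglongrightarrow> Y s \<omega>"
      unfolding r_def using that(1)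
      by (intro continuous_on_tendsto_compose[OF _ grid_tendsto[OF that(2)] that(2)]) (use grid_in[OF T0] in auto)
    then show ?thesis using that(1) by simp
  qed
  have A_eq: "A s \<omega> = ennreal ((norm (Y s \<omega>))\<^sup>2)"
    if "continuous_on {0..T} (\<lambda>t. Y t \<omega>) \<and> (\<forall>n k. Y (grid T n k) \<omega> = Y' n k \<omega>)" "s \<in> {0..T}" for \<omega> s
    unfolding A_def by (intro lim_imp_Liminf tendsto_ennrealI tendsto_intros lim that) simp
  have A_meas: "(\<lambda>(s, \<omega>). A s \<omega>) \<in> borel_measurable (lborel \<Otimes>\<^sub>M (M0 \<Otimes>\<^sub>M M1))"
  proof -
    have "(\<lambda>p. ennreal ((norm (Y' n (r n (fst p)) (snd p)))\<^sup>2)) \<in> borel_measurable (lborel \<Otimes>\<^sub>M (M0 \<Otimes>\<^sub>M M1))" for n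
    proof (rule measurable_compose_countable[where f = "\<lambda>k p. ennreal ((norm (Y' n k (snd p)))\<^sup>2)" and g = "\<lambda>p. r n (fst p)"])
      show "(\<lambda>p. r n (fst p)) \<in> lborel \<Otimes>\<^sub>M (M0 \<Otimes>\<^sub>M M1) \<rightarrow>\<^sub>M count_space UNIV"
        unfolding r_def by measurable
    qed measurable
    then show ?thesis unfolding A_def case_prod_beta' by (rule borel_measurable_liminf)
  qed
  have S_meas [measurable]: "S \<in> borel_measurable (M0 \<Otimes>\<^sub>M M1)"
    unfolding S_def by (intro borel_measurable_SUP) auto
  have A_le: "A s \<omega> \<le> S \<omega>" for s \<omega>
  proof -
    have "ennreal ((norm (Y' n (r n s) \<omega>))\<^sup>2) \<le> S \<omega>" for n
      unfolding S_def by (rule SUP_upper2[of "(n, r n s)"]) auto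
    then have "A s \<omega> \<le> liminf (\<lambda>n. S \<omega>)"
      unfolding A_def by (intro Liminf_mono always_eventually allI)
    then show ?thesis by (simp add: Liminf_const)
  qed
  have "(\<integral>\<^sup>+\<omega>. S \<omega> \<partial>(M0 \<Otimes>\<^sub>M M1)) \<le> (\<integral>\<^sup>+\<omega>. (SUP t\<in>{0..T}. ennreal ((norm (Y t \<omega>))\<^sup>2)) \<partial>(M0 \<Otimes>\<^sub>M M1))"
  proof (rule nn_integral_mono_AE, use good in eventually_elim)
    case (elim \<omega>)
    then show ?case unfolding S_def
      by (intro SUP_least) (auto intro!: SUP_upper2[OF grid_in[OF T0]] simp: case_prod_beta')
  qed
  also have "\<dots> < \<infinity>" using sup by (simp add: nn_integral_M)
  finally have S_fin: "(\<integral>\<^sup>+x. (\<integral>\<^sup>+y. S (x, y) \<partial>M1) \<partial>M0) < \<infinity>"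
    by (subst M1.nn_integral_fst) measurable
  have "AE x in M0. (\<integral>\<^sup>+y. S (x, y) \<partial>M1) \<noteq> \<infinity>"
    by (rule nn_integral_PInf_AE) (use S_fin in auto)
  then have "AE x in M0. \<forall>s\<in>{0..T}. cond_law M1 (Y s) x \<in> P2 \<and>
       ennreal ((W2 (cond_law M1 (Y s) x) (return borel 0))\<^sup>2) \<le> (\<integral>\<^sup>+y. A s (x, y) \<partial>M1)"
    using AE_sections[OF good] AE_space
  proof (eventually_elim, intro ballI)
    fix x s assume fin: "(\<integral>\<^sup>+y. S (x, y) \<partial>M1) \<noteq> \<infinity>" and s: "s \<in> {0..T}" and x: "x \<in> space M0"
      and g: "AE y in M1. continuous_on {0..T} (\<lambda>t. Y t (x, y)) \<and> (\<forall>n k. Y (grid T n k) (x, y) = Y' n k (x, y))"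
    have [measurable]: "(\<lambda>y. Y' n k (x, y)) \<in> borel_measurable M1" for n k using x by measurable
    have "(\<lambda>y. lim (\<lambda>n. Y' n (r n s) (x, y))) \<in> borel_measurable M1" by (rule borel_measurable_lim_metric) measurable
    moreover have "AE y in M1. lim (\<lambda>n. Y' n (r n s) (x, y)) = Y s (x, y)"
      using g by eventually_elim (intro limI lim s)
    ultimately have Ys: "(\<lambda>y. Y s (x, y)) \<in> borel_measurable M1"
      by (rule C1.measurable_cong_AE_complete) auto
    have int: "(\<integral>\<^sup>+z. ennreal ((norm z)\<^sup>2) \<partial>cond_law M1 (Y s) x) = (\<integral>\<^sup>+y. A s (x, y) \<partial>M1)"
    proof -
      have "(\<integral>\<^sup>+z. ennreal ((norm z)\<^sup>2) \<partial>cond_law M1 (Y s) x) = (\<integral>\<^sup>+y. ennreal ((norm (Y s (x, y)))\<^sup>2) \<partial>M1)"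
        unfolding cond_law_def by (rule nn_integral_distr[OF Ys]) simp
      also have "\<dots> = (\<integral>\<^sup>+y. A s (x, y) \<partial>M1)"
        by (rule nn_integral_cong_AE, use g in eventually_elim) (rule A_eq[OF _ s, symmetric])
      finally show ?thesis .
    qed
    have pr: "prob_space (cond_law M1 (Y s) x)" unfolding cond_law_def by (rule M1.prob_space_distr[OF Ys])
    have se: "sets (cond_law M1 (Y s) x) = sets borel" by (simp add: cond_law_def)
    have "(\<integral>\<^sup>+y. A s (x, y) \<partial>M1) \<le> (\<integral>\<^sup>+y. S (x, y) \<partial>M1)" by (intro nn_integral_mono A_le)
    also have "\<dots> < \<infinity>" using fin by (simp add: less_top)
    finally show "cond_law M1 (Y s) x \<in> P2 \<and>
       ennreal ((W2 (cond_law M1 (Y s) x) (return borel 0))\<^sup>2) \<le> (\<integral>\<^sup>+y. A s (x, y) \<partial>M1)"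
      using pr se int W2_dirac_squared_le[OF pr se] by (simp add: P2_def)
  qed
  moreover have "AE \<omega> in M. \<forall>s\<in>{0..T}. A s \<omega> = ennreal ((norm (Y s \<omega>))\<^sup>2)"
    unfolding AE_M_iff using good by eventually_elim (simp add: A_eq)
  ultimately show thesis using that A_meas by blast
qed

end

section \<open>Integrability of the solution\<close>

lemma square_sum_bound:
  fixes c a0 y z w u g :: real
  assumes "g \<le> a0 + \<bar>c\<bar> * (y + z + w + u)" and "0 \<le> g"
  shows "g\<^sup>2 \<le> 5 * (1 + c\<^sup>2) * (a0\<^sup>2 + y\<^sup>2 + u\<^sup>2 + (z\<^sup>2 + w\<^sup>2))"
proof -
  have five: "(a + b + d + e + h)\<^sup>2 \<le> 5 * (a\<^sup>2 + b\<^sup>2 + d\<^sup>2 + e\<^sup>2 + h\<^sup>2)" for a b d e h :: real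
  proof -
    have "5 * (a\<^sup>2 + b\<^sup>2 + d\<^sup>2 + e\<^sup>2 + h\<^sup>2) - (a + b + d + e + h)\<^sup>2
      = (a - b)\<^sup>2 + (a - d)\<^sup>2 + (a - e)\<^sup>2 + (a - h)\<^sup>2 + (b - d)\<^sup>2 + (b - e)\<^sup>2 + (b - h)\<^sup>2 + (d - e)\<^sup>2 + (d - h)\<^sup>2 + (e - h)\<^sup>2"
      by (simp add: power2_eq_square algebra_simps)
    also have "\<dots> \<ge> 0" by (intro add_nonneg_nonneg) auto
    finally show ?thesis by simp
  qed
  have "g\<^sup>2 \<le> (a0 + \<bar>c\<bar> * y + \<bar>c\<bar> * z + \<bar>c\<bar> * w + \<bar>c\<bar> * u)\<^sup>2"
    using assms by (intro power_mono) (auto simp: distrib_left)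
  also have "\<dots> \<le> 5 * (a0\<^sup>2 + (\<bar>c\<bar> * y)\<^sup>2 + (\<bar>c\<bar> * z)\<^sup>2 + (\<bar>c\<bar> * w)\<^sup>2 + (\<bar>c\<bar> * u)\<^sup>2)" by (rule five)
  also have "\<dots> = 5 * (a0\<^sup>2 + c\<^sup>2 * (y\<^sup>2 + u\<^sup>2 + (z\<^sup>2 + w\<^sup>2)))" by (simp add: power_mult_distrib algebra_simps)
  also have "\<dots> \<le> 5 * ((1 + c\<^sup>2) * a0\<^sup>2 + (1 + c\<^sup>2) * (y\<^sup>2 + u\<^sup>2 + (z\<^sup>2 + w\<^sup>2)))"
    by (intro mult_left_mono add_mono) (auto simp: distrib_right)
  finally show ?thesis by (simp add: algebra_simps)
qed

theorem proposition4:
  fixes T p C\<^sub>f :: real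
    and M0 :: "'a measure" and M1 :: "'b measure"
    and W0 :: "real \<Rightarrow> 'a \<Rightarrow> real^'d::finite" and W :: "real \<Rightarrow> 'b \<Rightarrow> real^'d"
    and M :: "('a \<times> 'b) measure" and F :: "real \<Rightarrow> ('a \<times> 'b) measure"
    and f :: "'a \<times> 'b \<Rightarrow> real \<Rightarrow> real^'m::finite \<Rightarrow> real^'d^'m \<Rightarrow> real^'d^'m \<Rightarrow> (real^'m) measure
               \<Rightarrow> real^'m"
    and \<xi> :: "'a \<times> 'b \<Rightarrow> real^'m"
    and Y :: "real \<Rightarrow> 'a \<times> 'b \<Rightarrow> real^'m"
    and Z Z0 :: "real \<Rightarrow> 'a \<times> 'b \<Rightarrow> real^'d^'m"
  assumes T: "T > 0" and p: "p \<ge> 2"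
    and M0: "prob_space M0" "complete_measure M0"
    and M1: "prob_space M1" "complete_measure M1"
    and W0: "brownian_motion M0 T W0"
    and W: "brownian_motion M1 T W"
    and M: "M = common_noise_space M0 M1"
    and F: "F = common_noise_filtration M0 M1 T W0 W"
    and f_progressive:
      "\<And>y z z' \<mu>. \<mu> \<in> P2 \<Longrightarrow> progressive F T (\<lambda>t \<omega>. f \<omega> t y z z' \<mu>)"
    and f_lipschitz:
      "AE \<omega> in M. \<forall>t\<in>{0..T}. \<forall>y y' z z' w w'. \<forall>\<mu>\<in>P2. \<forall>\<nu>\<in>P2.
         norm (f \<omega> t y z w \<mu> - f \<omega> t y' z' w' \<nu>)
           \<le> C\<^sub>f * (norm (y - y') + norm (z - z') + norm (w - w') + W2 \<mu> \<nu>)"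
    and f_zero_2:
      "(\<integral>\<^sup>+\<omega>. (\<integral>\<^sup>+s\<in>{0..T}. ennreal ((norm (f \<omega> s 0 0 0 (return borel 0)))\<^sup>2) \<partial>lborel) \<partial>M) < \<infinity>"
    and \<xi>: "\<xi> \<in> borel_measurable (F T)"
    and \<xi>_2: "integrable M (\<lambda>\<omega>. (norm (\<xi> \<omega>))\<^sup>2)"
    and \<xi>_p: "integrable M (\<lambda>\<omega>. norm (\<xi> \<omega>) powr p)"
    and f_zero_p:
      "(\<integral>\<^sup>+\<omega>. (\<integral>\<^sup>+s\<in>{0..T}. ennreal (norm (f \<omega> s 0 0 0 (return borel 0)) powr p) \<partial>lborel) \<partial>M) < \<infinity>"
    and solution: "mkv_bsde_solution M0 M1 T W0 W f \<xi> Y Z Z0"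
  shows "Y \<in> S_space M F T p"
proof (cases "p = 2")
  case True
  then show ?thesis using solution by (simp add: mkv_bsde_solution_def Let_def M F)
next
  case False
  interpret common_noise_brownian T M0 M1 W0 W M F
    by (rule common_noise_brownian.intro[OF T M0(1) M1(1) W0 W M F])
  define q where "q = p / 2"
  have q: "1 < q" using p False by (simp add: q_def)
  define g where "g = (\<lambda>\<omega> s. f \<omega> s (Y s \<omega>) (Z s \<omega>) (Z0 s \<omega>) (cond_law M1 (Y s) (fst \<omega>)))"
  note sol = solution[unfolded mkv_bsde_solution_def Let_def, folded M F]
  have Y_S: "Y \<in> S_space M F T 2" and Z: "Z \<in> H2_space M F T" and Z0: "Z0 \<in> H2_space M F T"
    and g_int: "AE \<omega> in M. set_integrable lborel {0..T} (g \<omega>)"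
    using sol unfolding g_def by blast+
  obtain J J0 where J: "has_ito_integral M F T (\<lambda>t \<omega>. W t (snd \<omega>)) Z J"
    and J0: "has_ito_integral M F T (\<lambda>t \<omega>. W0 t (fst \<omega>)) Z0 J0"
    and eq: "AE \<omega> in M. \<forall>t\<in>{0..T}.
               Y t \<omega> = \<xi> \<omega> + (LINT s:{t..T}|lborel. g \<omega> s) - (J T \<omega> - J t \<omega>) - (J0 T \<omega> - J0 t \<omega>)"
    using sol unfolding g_def by blast
  have Y_prog: "progressive F T Y" using Y_S by (simp add: S_space_def)
  have Y_F: "Y t \<in> borel_measurable (F t)" if "t \<in> {0..T}" for t
    using progressive_adapted[OF Y_prog that] .
  have Y_M: "Y t \<in> borel_measurable M" if "t \<in> {0..T}" for t
    by (rule measurable_from_subalg[OF subalgebra_F Y_F[OF that]])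
  have sup2: "(\<integral>\<^sup>+\<omega>. (SUP t\<in>{0..T}. ennreal ((norm (Y t \<omega>))\<^sup>2)) \<partial>M) < \<infinity>"
    using Y_S by (simp add: S_space_def)
  have Y_cont: "AE \<omega> in M. continuous_on {0..T} (\<lambda>t. Y t \<omega>)"
  proof -
    have "AE \<omega> in M. continuous_on {0..T} (\<lambda>t. J t \<omega>)" "AE \<omega> in M. continuous_on {0..T} (\<lambda>t. J0 t \<omega>)"
      using J J0 by (simp_all add: has_ito_integral_def)
    with g_int eq show ?thesis
    proof eventually_elim
      case (elim \<omega>)
      have "continuous_on {0..T} (\<lambda>t. \<xi> \<omega> + (LINT s:{t..T}|lborel. g \<omega> s) - (J T \<omega> - J t \<omega>) - (J0 T \<omega> - J0 t \<omega>))"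
        by (intro continuous_intros continuous_on_set_integral_left elim)
      then show ?case by (rule continuous_on_eq) (use elim in auto)
    qed
  qed
  obtain A' :: "real \<Rightarrow> 'a \<times> 'b \<Rightarrow> ennreal"
  where A'_meas: "(\<lambda>(s, \<omega>). A' s \<omega>) \<in> borel_measurable (lborel \<Otimes>\<^sub>M (M0 \<Otimes>\<^sub>M M1))"
    and A'_eq: "AE \<omega> in M. \<forall>s\<in>{0..T}. A' s \<omega> = ennreal ((norm (Y s \<omega>))\<^sup>2)"
    and A'_law: "AE x in M0. \<forall>s\<in>{0..T}. cond_law M1 (Y s) x \<in> P2 \<and>
       ennreal ((W2 (cond_law M1 (Y s) x) (return borel 0))\<^sup>2) \<le> (\<integral>\<^sup>+y. A' s (x, y) \<partial>M1)"
    using measurable_version[OF Y_M Y_cont M1(2) sup2] by blast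
  define f0 where "f0 = (\<lambda>s \<omega>. indicator {0..T} s *\<^sub>R f \<omega> s 0 0 0 (return borel 0))"
  define \<phi> where "\<phi> = (\<lambda>s \<omega>. (norm (f0 s \<omega>))\<^sup>2)"
  \<comment> \<open>\<open>m s\<close> is the second moment of the conditional law of \<open>Y s\<close>.\<close>
  define m where "m = (\<lambda>s x. \<integral>\<^sup>+y. A' s (x, y) \<partial>M1)"
  define G where "G = (\<lambda>s \<omega>. ennreal (\<phi> s \<omega>) + A' s \<omega> + m s (fst \<omega>))"
  have f0_meas [measurable]: "(\<lambda>(\<omega>, s). f0 s \<omega>) \<in> borel_measurable (M \<Otimes>\<^sub>M lborel)"
    unfolding f0_def by (intro progressive_measurable f_progressive dirac_in_P2)
  have \<phi>_meas [measurable]: "(\<lambda>(\<omega>, s). \<phi> s \<omega>) \<in> borel_measurable (M \<Otimes>\<^sub>M lborel)"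
    unfolding \<phi>_def by measurable
  have idM: "(\<lambda>\<omega>. \<omega>) \<in> M \<rightarrow>\<^sub>M M0 \<Otimes>\<^sub>M M1" by (rule M_measurable) simp
  have m_meas: "(\<lambda>(s, x). m s x) \<in> borel_measurable (lborel \<Otimes>\<^sub>M M0)"
  proof -
    have "(\<lambda>p. (fst (fst p), (snd (fst p), snd p))) \<in> (lborel \<Otimes>\<^sub>M M0) \<Otimes>\<^sub>M M1 \<rightarrow>\<^sub>M lborel \<Otimes>\<^sub>M (M0 \<Otimes>\<^sub>M M1)"
      by measurable
    from measurable_compose[OF this A'_meas]
    have "(\<lambda>(p, y). A' (fst p) (snd p, y)) \<in> borel_measurable ((lborel \<Otimes>\<^sub>M M0) \<Otimes>\<^sub>M M1)"
      by (simp add: case_prod_beta')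
    then have "(\<lambda>p. \<integral>\<^sup>+y. A' (fst p) (snd p, y) \<partial>M1) \<in> borel_measurable (lborel \<Otimes>\<^sub>M M0)"
      by (rule M1.borel_measurable_nn_integral)
    then show ?thesis by (simp add: m_def case_prod_beta')
  qed
  have G_meas: "(\<lambda>(\<omega>, s). G s \<omega>) \<in> borel_measurable (M \<Otimes>\<^sub>M lborel)"
  proof -
    have idM': "(\<lambda>p. fst p) \<in> M \<Otimes>\<^sub>M lborel \<rightarrow>\<^sub>M M0 \<Otimes>\<^sub>M M1"
      by (rule measurable_compose[OF measurable_fst idM])
    have "(\<lambda>p. (snd p, fst p)) \<in> M \<Otimes>\<^sub>M lborel \<rightarrow>\<^sub>M lborel \<Otimes>\<^sub>M (M0 \<Otimes>\<^sub>M M1)"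
      by (intro measurable_Pair measurable_snd idM')
    from measurable_compose[OF this A'_meas]
    have 1: "(\<lambda>p. A' (snd p) (fst p)) \<in> borel_measurable (M \<Otimes>\<^sub>M lborel)" by simp
    have "(\<lambda>p. (snd p, fst (fst p))) \<in> M \<Otimes>\<^sub>M lborel \<rightarrow>\<^sub>M lborel \<Otimes>\<^sub>M M0"
      by (intro measurable_Pair measurable_snd measurable_compose[OF idM' measurable_fst])
    from measurable_compose[OF this m_meas]
    have 2: "(\<lambda>p. m (snd p) (fst (fst p))) \<in> borel_measurable (M \<Otimes>\<^sub>M lborel)" by simp
    have 3: "(\<lambda>p. ennreal (\<phi> (snd p) (fst p))) \<in> borel_measurable (M \<Otimes>\<^sub>M lborel)"
      using \<phi>_meas by (simp add: case_prod_beta')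
    show ?thesis unfolding G_def case_prod_beta' by (intro borel_measurable_add 1 2 3)
  qed
  define L where "L = 5 * (1 + C\<^sub>f\<^sup>2)"
  have L: "0 \<le> L" by (simp add: L_def)
  have bound: "AE \<omega> in M. \<forall>s\<in>{0..T}. ennreal ((norm (g \<omega> s))\<^sup>2)
        \<le> ennreal L * (G s \<omega> + (ennreal ((norm (Z s \<omega>))\<^sup>2) + ennreal ((norm (Z0 s \<omega>))\<^sup>2)))"
    using f_lipschitz A'_eq AE_fst[OF A'_law]
  proof (eventually_elim, intro ballI)
    fix \<omega> s
    assume lip: "\<forall>t\<in>{0..T}. \<forall>y y' z z' w w'. \<forall>\<mu>\<in>P2. \<forall>\<nu>\<in>P2. norm (f \<omega> t y z w \<mu> - f \<omega> t y' z' w' \<nu>)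
           \<le> C\<^sub>f * (norm (y - y') + norm (z - z') + norm (w - w') + W2 \<mu> \<nu>)"
      and A's: "\<forall>s\<in>{0..T}. A' s \<omega> = ennreal ((norm (Y s \<omega>))\<^sup>2)"
      and law: "\<forall>s\<in>{0..T}. cond_law M1 (Y s) (fst \<omega>) \<in> P2 \<and>
       ennreal ((W2 (cond_law M1 (Y s) (fst \<omega>)) (return borel 0))\<^sup>2) \<le> (\<integral>\<^sup>+y. A' s (fst \<omega>, y) \<partial>M1)"
      and s: "s \<in> {0..T}"
    \<comment> \<open>The Lipschitz condition compares the driver with its value at \<open>(0, 0, 0, \<delta>\<^sub>0)\<close>.\<close>
    let ?u = "W2 (cond_law M1 (Y s) (fst \<omega>)) (return borel 0)"
    let ?S = "norm (Y s \<omega>) + norm (Z s \<omega>) + norm (Z0 s \<omega>) + ?u"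
    have u0: "0 \<le> ?u" by (simp add: W2_def)
    have "norm (g \<omega> s - f0 s \<omega>) \<le> C\<^sub>f * ?S"
      using lip[rule_format, OF s, of "cond_law M1 (Y s) (fst \<omega>)" "return borel 0" "Y s \<omega>" "Z s \<omega>" "Z0 s \<omega>" 0 0 0]
        law s dirac_in_P2 by (simp add: g_def f0_def)
    also have "\<dots> \<le> \<bar>C\<^sub>f\<bar> * ?S" using u0 by (intro mult_right_mono) auto
    finally have "norm (g \<omega> s) \<le> norm (f0 s \<omega>) + \<bar>C\<^sub>f\<bar> * ?S"
      using norm_triangle_ineq[of "f0 s \<omega>" "g \<omega> s - f0 s \<omega>"] by simp
    then have "(norm (g \<omega> s))\<^sup>2 \<le> L * ((norm (f0 s \<omega>))\<^sup>2 + (norm (Y s \<omega>))\<^sup>2 + ?u\<^sup>2 + ((norm (Z s \<omega>))\<^sup>2 + (norm (Z0 s \<omega>))\<^sup>2))"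
      unfolding L_def by (intro square_sum_bound) auto
    then have "ennreal ((norm (g \<omega> s))\<^sup>2) \<le> ennreal (L * ((norm (f0 s \<omega>))\<^sup>2 + (norm (Y s \<omega>))\<^sup>2 + ?u\<^sup>2 + ((norm (Z s \<omega>))\<^sup>2 + (norm (Z0 s \<omega>))\<^sup>2)))"
      by (rule ennreal_leI)
    also have "\<dots> = ennreal L * (ennreal (\<phi> s \<omega>) + A' s \<omega> + ennreal (?u\<^sup>2) + (ennreal ((norm (Z s \<omega>))\<^sup>2) + ennreal ((norm (Z0 s \<omega>))\<^sup>2)))"
      using L A's s by (simp add: ennreal_mult \<phi>_def)
    also have "\<dots> \<le> ennreal L * (G s \<omega> + (ennreal ((norm (Z s \<omega>))\<^sup>2) + ennreal ((norm (Z0 s \<omega>))\<^sup>2)))"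
      unfolding G_def m_def using law s by (intro mult_left_mono add_right_mono add_left_mono) auto
    finally show "ennreal ((norm (g \<omega> s))\<^sup>2)
        \<le> ennreal L * (G s \<omega> + (ennreal ((norm (Z s \<omega>))\<^sup>2) + ennreal ((norm (Z0 s \<omega>))\<^sup>2)))" .
  qed
  obtain K where K: "1 \<le> K" and weighted: "\<And>t V. t \<in> {0..T} \<Longrightarrow> V \<in> borel_measurable (F t) \<Longrightarrow> (\<And>\<omega>. 0 \<le> V \<omega>) \<Longrightarrow>
    (\<integral>\<^sup>+\<omega>. ennreal (V \<omega>) * ennreal ((norm (Y t \<omega>))\<^sup>2) \<partial>M)
    \<le> ennreal K * ((\<integral>\<^sup>+\<omega>. ennreal (V \<omega>) * ennreal ((norm (\<xi> \<omega>))\<^sup>2) \<partial>M)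
      + (\<integral>\<^sup>+\<omega>. ennreal (V \<omega>) * (\<integral>\<^sup>+s\<in>{t..T}. G s \<omega> \<partial>lborel) \<partial>M))"
    by (rule weighted_estimate[OF J J0 Z Z0 Y_F g_int eq G_meas L bound]) blast+
  obtain R where R: "0 \<le> R" "(\<integral>\<^sup>+\<omega>. (SUP t\<in>{0..T}. ennreal ((norm (Y t \<omega>))\<^sup>2)) \<partial>M) = ennreal R"
    using sup2 by (cases "\<integral>\<^sup>+\<omega>. (SUP t\<in>{0..T}. ennreal ((norm (Y t \<omega>))\<^sup>2)) \<partial>M" rule: ennreal_cases) auto
  define A where "A = (\<lambda>t \<omega>. (norm (Y t \<omega>))\<^sup>2)"
  define \<zeta> where "\<zeta> = (\<lambda>\<omega>. (norm (\<xi> \<omega>))\<^sup>2)"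
  have \<xi>_M [measurable]: "\<xi> \<in> borel_measurable M" by (rule measurable_from_subalg[OF subalgebra_F \<xi>])
  interpret WB: weighted_bound M F T K R A \<zeta> \<phi> G
  proof
    show "A t \<in> borel_measurable (F t)" if "t \<in> {0..T}" for t
    proof -
      note [measurable] = Y_F[OF that]
      show ?thesis unfolding A_def by measurable
    qed
    show "(\<integral>\<^sup>+\<omega>. ennreal (A t \<omega>) \<partial>M) \<le> ennreal R" if "t \<in> {0..T}" for t
      unfolding R(2)[symmetric] A_def using that by (intro nn_integral_mono SUP_upper)
    show "\<zeta> \<in> borel_measurable M" unfolding \<zeta>_def by measurable
    show "(\<integral>\<^sup>+\<omega>. ennreal (V \<omega>) * ennreal (A t \<omega>) \<partial>M)
        \<le> ennreal K * ((\<integral>\<^sup>+\<omega>. ennreal (V \<omega>) * ennreal (\<zeta> \<omega>) \<partial>M)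
          + (\<integral>\<^sup>+\<omega>. ennreal (V \<omega>) * (\<integral>\<^sup>+s\<in>{t..T}. G s \<omega> \<partial>lborel) \<partial>M))"
      if "t \<in> {0..T}" "V \<in> borel_measurable (F t)" "\<And>\<omega>. 0 \<le> V \<omega>" for t V
      unfolding A_def \<zeta>_def by (rule weighted[OF that])
    show "(\<integral>\<^sup>+\<omega>. ennreal (v (X \<omega>)) * G s \<omega> \<partial>M)
        \<le> 3 * (\<integral>\<^sup>+\<omega>. ennreal (\<alpha> (X \<omega>)) \<partial>M) + (\<integral>\<^sup>+\<omega>. ennreal (\<beta> (\<phi> s \<omega>)) \<partial>M)
          + 2 * (\<integral>\<^sup>+\<omega>. ennreal (\<beta> (A s \<omega>)) \<partial>M)"
      if s: "s \<in> {0..T}" and X: "X \<in> borel_measurable M" "\<And>\<omega>. 0 \<le> X \<omega>"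
        and meas: "v \<in> borel_measurable borel" "\<alpha> \<in> borel_measurable borel" "\<beta> \<in> borel_measurable borel"
        and nonneg: "\<And>x. 0 \<le> x \<Longrightarrow> 0 \<le> v x" "\<And>x. 0 \<le> x \<Longrightarrow> 0 \<le> \<alpha> x" "\<And>x. 0 \<le> x \<Longrightarrow> 0 \<le> \<beta> x"
        and young: "\<And>x y :: real. 0 \<le> x \<Longrightarrow> 0 \<le> y \<Longrightarrow> v x * y \<le> \<alpha> x + \<beta> y"
      for s and X :: "'a \<times> 'b \<Rightarrow> real" and v \<alpha> \<beta> :: "real \<Rightarrow> real"
    proof -
      have \<phi>s [measurable]: "\<phi> s \<in> borel_measurable M"
        using measurable_Pair1[OF \<phi>_meas, of s] by simp
      have As [measurable]: "A s \<in> borel_measurable M"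
        using Y_M[OF s] unfolding A_def by measurable
      have A's: "A' s \<in> borel_measurable (M0 \<Otimes>\<^sub>M M1)" using measurable_Pair2[OF A'_meas, of s] by simp
      define B where "B = (\<lambda>\<omega>. enn2real (A' s \<omega>))"
      have B: "B \<in> borel_measurable (M0 \<Otimes>\<^sub>M M1)" "0 \<le> B \<omega>" for \<omega> using A's by (auto simp: B_def)
      have BA: "AE \<omega> in M. B \<omega> = A s \<omega> \<and> A' s \<omega> = ennreal (B \<omega>)"
        using A'_eq by eventually_elim (use s in \<open>auto simp: B_def A_def\<close>)
      have m_eq: "AE \<omega> in M. m s (fst \<omega>) = (\<integral>\<^sup>+y. ennreal (B (fst \<omega>, y)) \<partial>M1)"
      proof (rule AE_fst)
        have "AE x in M0. AE y in M1. B (x, y) = A s (x, y) \<and> A' s (x, y) = ennreal (B (x, y))"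
          using BA unfolding AE_M_iff by (rule AE_sections)
        then show "AE x in M0. m s x = (\<integral>\<^sup>+y. ennreal (B (x, y)) \<partial>M1)"
          by eventually_elim (auto simp: m_def intro!: nn_integral_cong_AE elim!: eventually_mono)
      qed
      have BM: "B \<in> borel_measurable M" by (rule M_measurable[OF B(1)])
      have mB [measurable]: "(\<lambda>\<omega>. \<integral>\<^sup>+y. ennreal (B (fst \<omega>, y)) \<partial>M1) \<in> borel_measurable M"
      proof (rule measurable_compose[OF fst_measurable])
        note [measurable] = B(1)
        show "(\<lambda>x. \<integral>\<^sup>+y. ennreal (B (x, y)) \<partial>M1) \<in> borel_measurable M0" by measurable
      qed
      note [measurable] = X(1) meas BM
      have le: "ennreal (v x) * ennreal y \<le> ennreal (\<alpha> x) + ennreal (\<beta> y)" if "0 \<le> x" "0 \<le> y" for x y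
        using young[OF that] nonneg that by (intro ennreal_mult_le_add) auto
      let ?\<alpha> = "\<integral>\<^sup>+\<omega>. ennreal (\<alpha> (X \<omega>)) \<partial>M" and ?\<beta> = "\<lambda>y. \<integral>\<^sup>+\<omega>. ennreal (\<beta> (y \<omega>)) \<partial>M"
      have direct: "(\<integral>\<^sup>+\<omega>. ennreal (v (X \<omega>)) * ennreal (y \<omega>) \<partial>M) \<le> ?\<alpha> + ?\<beta> y"
        if [measurable]: "y \<in> borel_measurable M" and "\<And>\<omega>. 0 \<le> y \<omega>" for y
        by (subst nn_integral_add[symmetric]; (intro nn_integral_mono le X that)?; measurable)
      have \<beta>B: "?\<beta> B = ?\<beta> (A s)"
        by (rule nn_integral_cong_AE, use BA in eventually_elim) simp
      \<comment> \<open>The three parts of \<open>G s\<close> are \<open>\<phi> s\<close>, a version \<open>B\<close> of \<open>A s\<close>, and the mean of \<open>B\<close> over the second factor.\<close>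
      have decoupled: "(\<integral>\<^sup>+\<omega>. ennreal (v (X \<omega>)) * (\<integral>\<^sup>+y. ennreal (B (fst \<omega>, y)) \<partial>M1) \<partial>M) \<le> ?\<alpha> + ?\<beta> B"
        by (rule decoupling_inequality[where v = v and \<alpha> = \<alpha> and \<beta> = \<beta> and X = X and B = B])
           (fact X B meas nonneg young)+
      have "(\<integral>\<^sup>+\<omega>. ennreal (v (X \<omega>)) * G s \<omega> \<partial>M)
        = (\<integral>\<^sup>+\<omega>. ennreal (v (X \<omega>)) * ennreal (\<phi> s \<omega>) + (ennreal (v (X \<omega>)) * ennreal (B \<omega>)
            + ennreal (v (X \<omega>)) * (\<integral>\<^sup>+y. ennreal (B (fst \<omega>, y)) \<partial>M1)) \<partial>M)"
      proof (rule nn_integral_cong_AE, use BA m_eq in eventually_elim)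
        case (elim \<omega>)
        then show ?case by (simp only: G_def distrib_left add.assoc)
      qed
      also have "\<dots> = (\<integral>\<^sup>+\<omega>. ennreal (v (X \<omega>)) * ennreal (\<phi> s \<omega>) \<partial>M) + ((\<integral>\<^sup>+\<omega>. ennreal (v (X \<omega>)) * ennreal (B \<omega>) \<partial>M)
            + (\<integral>\<^sup>+\<omega>. ennreal (v (X \<omega>)) * (\<integral>\<^sup>+y. ennreal (B (fst \<omega>, y)) \<partial>M1) \<partial>M))"
        by (subst nn_integral_add, measurable, subst nn_integral_add) measurable
      also have "\<dots> \<le> (?\<alpha> + ?\<beta> (\<phi> s)) + ((?\<alpha> + ?\<beta> (A s)) + (?\<alpha> + ?\<beta> (A s)))"
        unfolding \<beta>B[symmetric] by (intro add_mono direct \<phi>s BM B(2) decoupled) (simp add: \<phi>_def)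
      also have "\<dots> = 3 * ?\<alpha> + ?\<beta> (\<phi> s) + 2 * ?\<beta> (A s)"
      proof -
        have "a + b + ((a + c) + (a + c)) = 3 * a + b + 2 * c" for a b c :: ennreal
        proof -
          have "(3::ennreal) = 1 + (1 + 1)" "(2::ennreal) = 1 + 1" by simp_all
          then show ?thesis by (simp only: distrib_right mult_1_left add_ac)
        qed
        then show ?thesis .
      qed
      finally show ?thesis .
    qed
  qed (use T K R subalgebra_F F_mono \<phi>_meas G_meas in \<open>auto simp: A_def \<zeta>_def \<phi>_def\<close>)
  have pw: "(x\<^sup>2) powr q = x powr p" if "0 \<le> x" for x :: real
  proof -
    have "x\<^sup>2 = x powr 2" using that by simp
    then show ?thesis by (simp only: powr_powr) (simp add: q_def)
  qed
  have "(\<integral>\<^sup>+\<omega>. ennreal (\<zeta> \<omega> powr q) \<partial>M) < \<infinity>"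
    using \<xi>_p unfolding \<zeta>_def by (simp add: pw integrable_iff_bounded)
  moreover have "(\<integral>\<^sup>+s\<in>{0..T}. (\<integral>\<^sup>+\<omega>. ennreal (\<phi> s \<omega> powr q) \<partial>M) \<partial>lborel) < \<infinity>"
  proof -
    interpret PL: pair_sigma_finite M "lborel :: real measure" ..
    have \<phi>s [measurable]: "\<phi> s \<in> borel_measurable M" for s
      using measurable_Pair1[OF \<phi>_meas, of s] by simp
    have "(\<integral>\<^sup>+s\<in>{0..T}. (\<integral>\<^sup>+\<omega>. ennreal (\<phi> s \<omega> powr q) \<partial>M) \<partial>lborel)
      = (\<integral>\<^sup>+s. (\<integral>\<^sup>+\<omega>. ennreal (\<phi> s \<omega> powr q) * indicator {0..T} s \<partial>M) \<partial>lborel)"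
      by (intro nn_integral_cong nn_integral_multc[symmetric]) measurable
    also have "\<dots> = (\<integral>\<^sup>+\<omega>. (\<integral>\<^sup>+s. ennreal (\<phi> s \<omega> powr q) * indicator {0..T} s \<partial>lborel) \<partial>M)"
      by (rule PL.Fubini') measurable
    also have "\<dots> = (\<integral>\<^sup>+\<omega>. (\<integral>\<^sup>+s\<in>{0..T}. ennreal (norm (f \<omega> s 0 0 0 (return borel 0)) powr p) \<partial>lborel) \<partial>M)"
      by (intro nn_integral_cong) (auto simp: \<phi>_def f0_def pw split: split_indicator)
    finally show ?thesis using f_zero_p by simp
  qed
  ultimately have "(\<integral>\<^sup>+\<omega>. (SUP t\<in>{0..T}. ennreal (A t \<omega> powr q)) \<partial>M) < \<infinity>"
    by (intro WB.sup_bound[OF q])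
       (use Y_cont in \<open>auto simp: A_def intro!: continuous_intros elim!: eventually_mono\<close>)
  then show ?thesis using Y_prog by (simp add: S_space_def A_def pw)
qed

end
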